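(* Let $(\mathfrak g,\pi)$ and $(\mathfrak h,\mu)$ be $3$-Lie algebras. Let $L=\bigoplus_{n\ge 0}C^n(\mathfrak g\oplus\mathfrak h,\mathfrak g\oplus\mathfrak h)$ with the graded Lie bracket $[\cdot,\cdot]_{\mathsf R}$, let $F=\bigoplus_{n\ge0}\mathrm{Hom}\big((\wedge^2\mathfrak g)^{\otimes n}\wedge\mathfrak g,\mathfrak h\big)$, regarded as a graded subspace of $L$, let $P:L\to L$ be the projection onto $F$, and let $\Delta=\pi+\mu$. Then $(L,F,P,\Delta)$ is a $V$-data (in particular $F$ is an abelian graded Lie subalgebra of $L$). Consequently, $(F,\{l_k\}_{k\ge1})$ is an $L_\infty$-algebra, where for homogeneous $a_1,a_2,a_3\in F$ $$l_1(a_1)=[\pi,a_1]_{\mathsf R},\qquad l_2(a_1,a_2)=0,\qquad l_3(a_1,a_2,a_3)=[[[\mu,a_1]_{\mathsf R},a_2]_{\mathsf R},a_3]_{\mathsf R},\qquad l_k=0\ (k\ge4).$$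
   Context: All vector spaces are over a field of characteristic $0$. A $3$-Lie algebra is a vector space $\mathfrak g$ with a linear map $\pi:\wedge^3\mathfrak g\to\mathfrak g$ such that $\pi(x_1,x_2,\pi(x_3,x_4,x_5))=\pi(\pi(x_1,x_2,x_3),x_4,x_5)+\pi(x_3,\pi(x_1,x_2,x_4),x_5)+\pi(x_3,x_4,\pi(x_1,x_2,x_5))$ for all $x_i\in\mathfrak g$. Notation: for a vector space $V$, $(\wedge^2V)^{\otimes n}\wedge V$ means $V$ if $n=0$ and $(\wedge^2V)^{\otimes(n-1)}\otimes\wedge^3V$ if $n\ge1$ (the last factor $\wedge^2V$ is wedged with $V$). Put $C^n(V,V)=\mathrm{Hom}((\wedge^2V)^{\otimes n}\wedge V,V)$, in degree $n\ge0$. The space $\bigoplus_n C^n(V,V)$ is a graded Lie algebra with bracket $[A,B]_{\mathsf R}=A\circ B-(-1)^{pq}B\circ A$ for $A\in C^p(V,V)$, $B\in C^q(V,V)$, where, for $\mathfrak X_i=x_i\wedge y_i\in\wedge^2V$, $x\in V$, $$\begin{aligned}(A\circ B)(\mathfrak X_1,\dots,\mathfrak X_{p+q},x)=&\sum_{k=1}^p(-1)^{(k-1)q}\sum_{\sigma\in\mathbb S(k-1,q)}(-1)^\sigma A\big(\mathfrak X_{\sigma(1)},\dots,\mathfrak X_{\sigma(k-1)},B(\mathfrak X_{\sigma(k)},\dots,\mathfrak X_{\sigma(k+q-1)},x_{k+q})\wedge y_{k+q},\mathfrak X_{k+q+1},\dots,\mathfrak X_{p+q},x\big)\\&+\sum_{k=1}^p(-1)^{(k-1)q}\sum_{\sigma\in\mathbb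 S(k-1,q)}(-1)^\sigma A\big(\mathfrak X_{\sigma(1)},\dots,\mathfrak X_{\sigma(k-1)},x_{k+q}\wedge B(\mathfrak X_{\sigma(k)},\dots,\mathfrak X_{\sigma(k+q-1)},y_{k+q}),\mathfrak X_{k+q+1},\dots,\mathfrak X_{p+q},x\big)\\&+\sum_{\sigma\in\mathbb S(p,q)}(-1)^{pq}(-1)^\sigma A\big(\mathfrak X_{\sigma(1)},\dots,\mathfrak X_{\sigma(p)},B(\mathfrak X_{\sigma(p+1)},\dots,\mathfrak X_{\sigma(p+q)},x)\big),\end{aligned}$$ with $\mathbb S(i,j)$ the set of $(i,j)$-shuffles. A map $\pi:\wedge^3V\to V$ is a $3$-Lie algebra structure iff $[\pi,\pi]_{\mathsf R}=0$. Embeddings: an element $Q\in\mathrm{Hom}((\wedge^2\mathfrak g)^{\otimes n}\wedge\mathfrak g,\mathfrak h)$ is identified with the element of $L$ given by $((x_1,a_1)\wedge(y_1,b_1),\dots,(x_n,a_n)\wedge(y_n,b_n),(x,a))\mapsto(0,Q(x_1\wedge y_1,\dots,x_n\wedge y_n,x))$. Similarly $\pi$ and $\mu$ are regarded as elements of $L$ of degree $1$: $\pi((x,a),(y,b),(z,c))=(\pi(x,y,z),0)$, $\mu((x,a),(y,b),(z,c))=(0,\mu(a,b,c))$. The projection $P$ is the one determined by the decomposition of $L$ according to the number of inputs in $\mathfrak g$ and in $\mathfrak h$ and to the target ($\mathfrak g$ or $\mathfrak h$): $P(A)$ is the component of $A$ with all inputs in $\mathfrak g$ and output in $\mathfrak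 h$. A $V$-data is a quadruple $(L,F,P,\Delta)$ with $(L,[\cdot,\cdot])$ a graded Lie algebra, $F$ an abelian graded Lie subalgebra of $L$, $P:L\to L$ a projection ($P\circ P=P$) with image $F$ and whose kernel is a graded Lie subalgebra, and $\Delta\in\ker(P)^1$ with $[\Delta,\Delta]=0$. An $L_\infty$-algebra is a $\mathbb Z$-graded vector space $V$ with degree $1$ linear maps $l_k:\otimes^kV\to V$ ($k\ge1$) which are graded symmetric, $l_n(x_{\sigma(1)},\dots,x_{\sigma(n)})=\varepsilon(\sigma)l_n(x_1,\dots,x_n)$ for $\sigma\in S_n$, and satisfy $\sum_{i=1}^n\sum_{\sigma\in S(i,n-i)}\varepsilon(\sigma)\,l_{n-i+1}(l_i(x_{\sigma(1)},\dots,x_{\sigma(i)}),x_{\sigma(i+1)},\dots,x_{\sigma(n)})=0$ for all $n\ge1$, where $\varepsilon(\sigma)$ is the Koszul sign and $S(i,n-i)$ denotes shuffles. *)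

theory Defs
  imports
    "HOL-Analysis.Product_Vector"
    "HOL-Library.Function_Algebras"
    "HOL-Combinatorics.Permutations"
begin

section \<open>Graded vector spaces, graded Lie algebras, V-data\<close>

text \<open>
  A graded vector space is given internally: a family of subspaces of an ambient vector space
  whose sum is direct.  The graded space itself is that sum, called \<open>total\<close>.
\<close>

locale graded_vector_space = vector_space scale
  for scale :: "'k::field_char_0 \<Rightarrow> 'v::ab_group_add \<Rightarrow> 'v" +
  fixes V :: "int \<Rightarrow> 'v set"
  assumes subspace_grade: "subspace (V i)"
    and direct: "\<lbrakk>finite I; \<And>i. i \<in> I \<Longrightarrow> v i \<in> V i; (\<Sum>i\<in>I. v i) = 0; i \<in> I\<rbrakk> \<Longrightarrow> v i = 0"
begin

definition total :: "'v set" where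
  "total = span (\<Union>i. V i)"

end

locale graded_lie_algebra = graded_vector_space scale L
  for scale :: "'k::field_char_0 \<Rightarrow> 'v::ab_group_add \<Rightarrow> 'v" and L :: "int \<Rightarrow> 'v set" +
  fixes br :: "'v \<Rightarrow> 'v \<Rightarrow> 'v"
  assumes br_add_left: "\<lbrakk>a \<in> total; b \<in> total; c \<in> total\<rbrakk> \<Longrightarrow> br (a + b) c = br a c + br b c"
    and br_add_right: "\<lbrakk>a \<in> total; b \<in> total; c \<in> total\<rbrakk> \<Longrightarrow> br a (b + c) = br a b + br a c"
    and br_scale_left: "\<lbrakk>a \<in> total; b \<in> total\<rbrakk> \<Longrightarrow> br (scale t a) b = scale t (br a b)"
    and br_scale_right: "\<lbrakk>a \<in> total; b \<in> total\<rbrakk> \<Longrightarrow> br a (scale t b) = scale t (br a b)"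
    and br_grade: "\<lbrakk>a \<in> L p; b \<in> L q\<rbrakk> \<Longrightarrow> br a b \<in> L (p + q)"
    and br_antisym: "\<lbrakk>a \<in> L p; b \<in> L q\<rbrakk> \<Longrightarrow> br a b = - scale ((-1) powi (p * q)) (br b a)"
    and br_jacobi: "\<lbrakk>a \<in> L p; b \<in> L q; c \<in> L r\<rbrakk> \<Longrightarrow>
      br a (br b c) = br (br a b) c + scale ((-1) powi (p * q)) (br b (br a c))"
begin

definition graded_lie_subalgebra :: "(int \<Rightarrow> 'v set) \<Rightarrow> bool" where
  "graded_lie_subalgebra S \<longleftrightarrow>
     (\<forall>i. subspace (S i) \<and> S i \<subseteq> L i) \<and>
     (\<forall>i j. \<forall>a\<in>S i. \<forall>b\<in>S j. br a b \<in> S (i + j))"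

end

text \<open>
  The assumption \<open>kernel_graded\<close> says that the kernel of \<open>P\<close> in the total space is the direct sum of
  its homogeneous parts, i.e. is a graded subspace.
\<close>

locale V_data = graded_lie_algebra scale L br
  for scale :: "'k::field_char_0 \<Rightarrow> 'v::ab_group_add \<Rightarrow> 'v" and L :: "int \<Rightarrow> 'v set"
    and br :: "'v \<Rightarrow> 'v \<Rightarrow> 'v" +
  fixes F :: "int \<Rightarrow> 'v set" and P :: "'v \<Rightarrow> 'v" and \<Delta> :: 'v
  assumes F_subalgebra: "graded_lie_subalgebra F"
    and F_abelian: "\<lbrakk>a \<in> F i; b \<in> F j\<rbrakk> \<Longrightarrow> br a b = 0"
    and P_add: "\<lbrakk>a \<in> total; b \<in> total\<rbrakk> \<Longrightarrow> P (a + b) = P a + P b"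
    and P_scale: "a \<in> total \<Longrightarrow> P (scale t a) = scale t (P a)"
    and P_idem: "a \<in> total \<Longrightarrow> P (P a) = P a"
    and P_image: "P ` total = span (\<Union>i. F i)"
    and kernel_graded: "{a \<in> total. P a = 0} = span (\<Union>i. {a \<in> L i. P a = 0})"
    and kernel_subalgebra: "graded_lie_subalgebra (\<lambda>i. {a \<in> L i. P a = 0})"
    and \<Delta>_grade: "\<Delta> \<in> L 1"
    and \<Delta>_kernel: "P \<Delta> = 0"
    and \<Delta>_square: "br \<Delta> \<Delta> = 0"


section \<open>L-infinity algebras\<close>

text \<open>Shuffles permute \<open>{..<i + j}\<close>, i.e. indices start at 0 as for lists.\<close>

definition shuffle_perms :: "nat \<Rightarrow> nat \<Rightarrow> (nat \<Rightarrow> nat) set" where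
  "shuffle_perms i j =
     {\<sigma>. \<sigma> permutes {..<i + j} \<and> strict_mono_on {..<i} \<sigma> \<and> strict_mono_on {i..<i + j} \<sigma>}"

text \<open>Koszul sign of \<open>x\<^sub>1 \<cdots> x\<^sub>n = \<epsilon>(\<sigma>) x\<^bsub>\<sigma>(1)\<^esub> \<cdots> x\<^bsub>\<sigma>(n)\<^esub>\<close>
  for \<open>x\<^sub>i\<close> of degree \<open>d i\<close>: one factor for each inversion of \<open>\<sigma>\<close>.\<close>

definition koszul_sign :: "nat \<Rightarrow> (nat \<Rightarrow> int) \<Rightarrow> (nat \<Rightarrow> nat) \<Rightarrow> 'k::field_char_0" where
  "koszul_sign n d \<sigma> =
     (\<Prod>(i, j)\<in>{(i, j). i < j \<and> j < n \<and> \<sigma> i > \<sigma> j}. (-1) powi (d (\<sigma> i) * d (\<sigma> j)))"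

text \<open>The operation \<open>l\<^sub>k\<close> is the restriction of \<open>l\<close> to lists of length \<open>k\<close>.\<close>

locale L_infinity_algebra = graded_vector_space scale V
  for scale :: "'k::field_char_0 \<Rightarrow> 'v::ab_group_add \<Rightarrow> 'v" and V :: "int \<Rightarrow> 'v set" +
  fixes l :: "'v list \<Rightarrow> 'v"
  assumes l_add: "\<lbrakk>set xs \<subseteq> total; i < length xs; a \<in> total; b \<in> total\<rbrakk> \<Longrightarrow>
      l (xs[i := a + b]) = l (xs[i := a]) + l (xs[i := b])"
    and l_scale: "\<lbrakk>set xs \<subseteq> total; i < length xs; a \<in> total\<rbrakk> \<Longrightarrow>
      l (xs[i := scale t a]) = scale t (l (xs[i := a]))"
    and l_degree: "\<lbrakk>xs \<noteq> []; \<And>i. i < length xs \<Longrightarrow> xs ! i \<in> V (d i)\<rbrakk> \<Longrightarrow>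
      l xs \<in> V ((\<Sum>i<length xs. d i) + 1)"
    and l_symmetric: "\<lbrakk>\<And>i. i < length xs \<Longrightarrow> xs ! i \<in> V (d i); \<sigma> permutes {..<length xs}\<rbrakk> \<Longrightarrow>
      l (permute_list \<sigma> xs) = scale (koszul_sign (length xs) d \<sigma>) (l xs)"
    and l_jacobi: "\<lbrakk>xs \<noteq> []; n = length xs; \<And>i. i < n \<Longrightarrow> xs ! i \<in> V (d i)\<rbrakk> \<Longrightarrow>
      (\<Sum>i=1..n. \<Sum>\<sigma>\<in>shuffle_perms i (n - i).
         scale (koszul_sign n d \<sigma>)
           (l (l (take i (permute_list \<sigma> xs)) # drop i (permute_list \<sigma> xs)))) = 0"


section \<open>3-Lie algebras\<close>

locale three_lie_algebra = vector_space scale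
  for scale :: "'k::field_char_0 \<Rightarrow> 'v::ab_group_add \<Rightarrow> 'v" +
  fixes \<pi> :: "'v \<Rightarrow> 'v \<Rightarrow> 'v \<Rightarrow> 'v"
  assumes linear1: "Vector_Spaces.linear scale scale (\<lambda>x. \<pi> x y z)"
    and linear2: "Vector_Spaces.linear scale scale (\<lambda>y. \<pi> x y z)"
    and linear3: "Vector_Spaces.linear scale scale (\<lambda>z. \<pi> x y z)"
    and alternating: "\<pi> x x z = 0" "\<pi> x y y = 0" "\<pi> x y x = 0"
    and fundamental_identity:
      "\<pi> x1 x2 (\<pi> x3 x4 x5) =
         \<pi> (\<pi> x1 x2 x3) x4 x5 + \<pi> x3 (\<pi> x1 x2 x4) x5 + \<pi> x3 x4 (\<pi> x1 x2 x5)"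


section \<open>Cochains and the bracket\<close>

text \<open>
  A linear map on the \<open>n\<close>-fold tensor power of \<open>\<wedge>\<^sup>2 V\<close> wedged with \<open>V\<close> is represented, through the
  universal property, by the map \<open>[(x\<^sub>1, y\<^sub>1), \<dots>, (x\<^sub>n, y\<^sub>n)], x \<mapsto>
  f(x\<^sub>1 \<wedge> y\<^sub>1, \<dots>, x\<^sub>n \<wedge> y\<^sub>n, x)\<close> that is multilinear, alternating in each pair, and alternating in
  the last pair together with \<open>x\<close>.  Cochains of degree \<open>n\<close> vanish on lists of other lengths, so a
  function on all lists is a sequence of cochains and the spaces for different \<open>n\<close> have a direct sum
  inside the function space.
\<close>

type_synonym ('a, 'b) cochain = "('a \<times> 'a) list \<Rightarrow> 'a \<Rightarrow> 'b"

definition cochains ::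
  "('k::field_char_0 \<Rightarrow> 'a::ab_group_add \<Rightarrow> 'a) \<Rightarrow> ('k \<Rightarrow> 'b::ab_group_add \<Rightarrow> 'b) \<Rightarrow> nat \<Rightarrow>
   ('a, 'b) cochain set" where
  "cochains sV sW n = {f.
     (\<forall>Xs x. length Xs \<noteq> n \<longrightarrow> f Xs x = 0) \<and>
     (\<forall>Xs. length Xs = n \<longrightarrow> Vector_Spaces.linear sV sW (f Xs)) \<and>
     (\<forall>Xs x y i. length Xs = n \<and> i < n \<longrightarrow>
        Vector_Spaces.linear sV sW (\<lambda>u. f (Xs[i := (u, y)]) x) \<and>
        Vector_Spaces.linear sV sW (\<lambda>u. f (Xs[i := (y, u)]) x) \<and>
        f (Xs[i := (y, y)]) x = 0) \<and>
     (\<forall>Xs x y. length Xs + 1 = n \<longrightarrow> f (Xs @ [(x, y)]) x = 0 \<and> f (Xs @ [(y, x)]) x = 0)}"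

definition cochain_scale ::
  "('k \<Rightarrow> 'b \<Rightarrow> 'b) \<Rightarrow> 'k \<Rightarrow> ('a, 'b) cochain \<Rightarrow> ('a, 'b) cochain" where
  "cochain_scale s c f = (\<lambda>Xs x. s c (f Xs x))"

text \<open>
  \<open>A \<circ> B\<close> for \<open>A\<close> of degree \<open>p\<close> and \<open>B\<close> of degree \<open>q\<close>, evaluated on lists of length \<open>p + q\<close>.
  The index \<open>k\<close> is one less than in the usual formula, where it runs from 1 to \<open>p\<close>.
\<close>

definition rcirc ::
  "('k::field_char_0 \<Rightarrow> 'v::ab_group_add \<Rightarrow> 'v) \<Rightarrow> nat \<Rightarrow> nat \<Rightarrow>
   ('v, 'v) cochain \<Rightarrow> ('v, 'v) cochain \<Rightarrow> ('v, 'v) cochain" where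
  "rcirc s p q A B Xs x =
     (\<Sum>k<p. \<Sum>\<sigma>\<in>shuffle_perms k q.
        s ((-1) ^ (k * q) * of_int (sign \<sigma>))
          (let Ys = permute_list \<sigma> (take (k + q) Xs); (u, v) = Xs ! (k + q)
           in A (take k Ys @ [(B (drop k Ys) u, v)] @ drop (k + q + 1) Xs) x)) +
     (\<Sum>k<p. \<Sum>\<sigma>\<in>shuffle_perms k q.
        s ((-1) ^ (k * q) * of_int (sign \<sigma>))
          (let Ys = permute_list \<sigma> (take (k + q) Xs); (u, v) = Xs ! (k + q)
           in A (take k Ys @ [(u, B (drop k Ys) v)] @ drop (k + q + 1) Xs) x)) +
     (\<Sum>\<sigma>\<in>shuffle_perms p q.
        s ((-1) ^ (p * q) * of_int (sign \<sigma>))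
          (let Ys = permute_list \<sigma> Xs in A (take p Ys) (B (drop p Ys) x)))"

text \<open>
  The bilinear extension of \<open>[A, B] = A \<circ> B - (-1)\<^bsup>pq\<^esup> B \<circ> A\<close> to sums of homogeneous cochains:
  the degree \<open>n\<close> component of the bracket collects the components \<open>p\<close> of \<open>A\<close> and \<open>q\<close> of \<open>B\<close>
  with \<open>p + q = n\<close>.
\<close>

definition rbracket ::
  "('k::field_char_0 \<Rightarrow> 'v::ab_group_add \<Rightarrow> 'v) \<Rightarrow>
   ('v, 'v) cochain \<Rightarrow> ('v, 'v) cochain \<Rightarrow> ('v, 'v) cochain" where
  "rbracket s A B = (\<lambda>Xs x. \<Sum>(p, q)\<in>{(p, q). p + q = length Xs}.
     rcirc s p q A B Xs x - s ((-1) ^ (p * q)) (rcirc s q p B A Xs x))"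

definition L_grade ::
  "('k::field_char_0 \<Rightarrow> 'v::ab_group_add \<Rightarrow> 'v) \<Rightarrow> int \<Rightarrow> ('v, 'v) cochain set" where
  "L_grade s i = (if i < 0 then {0} else cochains s s (nat i))"


section \<open>Cochains on a direct sum\<close>

text \<open>The direct sum of the two vector spaces is the product type.\<close>

definition embed_hom ::
  "('g::ab_group_add, 'h::ab_group_add) cochain \<Rightarrow> ('g \<times> 'h, 'g \<times> 'h) cochain" where
  "embed_hom Q = (\<lambda>Xs x. (0, Q (map (map_prod fst fst) Xs) (fst x)))"

definition embed_left ::
  "('g \<Rightarrow> 'g \<Rightarrow> 'g \<Rightarrow> 'g::ab_group_add) \<Rightarrow> ('g \<times> 'h::ab_group_add, 'g \<times> 'h) cochain" where
  "embed_left \<pi> = (\<lambda>Xs z. case Xs of [(x, y)] \<Rightarrow> (\<pi> (fst x) (fst y) (fst z), 0) | _ \<Rightarrow> 0)"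

definition embed_right ::
  "('h \<Rightarrow> 'h \<Rightarrow> 'h \<Rightarrow> 'h::ab_group_add) \<Rightarrow> ('g::ab_group_add \<times> 'h, 'g \<times> 'h) cochain" where
  "embed_right \<mu> = (\<lambda>Xs z. case Xs of [(x, y)] \<Rightarrow> (0, \<mu> (snd x) (snd y) (snd z)) | _ \<Rightarrow> 0)"

definition F_grade ::
  "('k::field_char_0 \<Rightarrow> 'g::ab_group_add \<Rightarrow> 'g) \<Rightarrow> ('k \<Rightarrow> 'h::ab_group_add \<Rightarrow> 'h) \<Rightarrow> int \<Rightarrow>
   ('g \<times> 'h, 'g \<times> 'h) cochain set" where
  "F_grade sg sh i = (if i < 0 then {0} else embed_hom ` cochains sg sh (nat i))"

text \<open>
  The component of a cochain with all inputs in the first summand and output in the second: by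
  multilinearity it is obtained by projecting every input to the first summand and the value to
  the second.
\<close>

definition F_proj ::
  "('g::ab_group_add \<times> 'h::ab_group_add, 'g \<times> 'h) cochain \<Rightarrow> ('g \<times> 'h, 'g \<times> 'h) cochain" where
  "F_proj A = (\<lambda>Xs x.
     (0, snd (A (map (\<lambda>(u, v). ((fst u, 0), (fst v, 0))) Xs) (fst x, 0))))"

end

theory Submission
  imports Defs
begin

text \<open>
  Contraction \<open>\<iota>\<^sub>X A = A(X, \<dots>)\<close> with the first pair of inputs determines a cochain of
  positive degree, and it is a graded derivation of the bracket up to degree 0 terms:
  \<open>\<iota>\<^sub>X [A, B] = [A, \<iota>\<^sub>X B] + (-1)\<^sup>q [\<iota>\<^sub>X A, B] + \<iota>\<^bsub>B X\<^esub> A - \<iota>\<^bsub>A X\<^esub> B\<close> for \<open>B\<close> of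
  degree \<open>q\<close>, where \<open>A X\<close> is the action of \<open>A\<close> on \<open>\<wedge>\<^sup>2\<close> if \<open>A\<close> has degree 0, and 0 otherwise.  With this recursion the alternating
  property of brackets and the graded Jacobi identity follow by induction on the degree.

  The bracket respects the weight given by the number of inputs in \<open>\<hh>\<close> minus the number of outputs
  in \<open>\<hh>\<close>.  All weights are at least -1, and \<open>F\<close> is the part of weight -1, while \<open>\<pi>\<close> and \<open>\<mu>\<close> have
  weights 0 and 2.  So \<open>F\<close> is abelian, and \<open>[\<pi>, \<cdot>]\<close> and \<open>[[[\<mu>, \<cdot>], \<cdot>], \<cdot>]\<close> map \<open>F\<close> to itself.  The
  \<open>L\<^sub>\<infinity>\<close> relations are obtained by expanding the iterated brackets of \<open>[\<pi>, \<pi>] = 0\<close>, \<open>[\<pi>, \<mu>] = 0\<close> and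
  \<open>[\<mu>, \<mu>] = 0\<close> with 1, 3 and 5 elements of \<open>F\<close> by the derivation rule.
\<close>

section \<open>Shuffles and Koszul signs\<close>

text \<open>The k-th derived bracket of a V-data is
  \<open>P [...[\<Delta>, a\<^sub>1], ..., a\<^sub>k]\<close>, and weights explain the formulas for
  \<open>l\<close>: k elements of \<open>F\<close> lower the weight by k, so \<open>\<pi>\<close>
  reaches the weight -1 only for k = 1 and \<open>\<mu>\<close> only for k = 3; in weight at least 0
  the projection gives 0, and in weight at most -2 nothing is left. The same count for
  \<open>[\<pi>, \<pi>]\<close>, \<open>[\<pi>, \<mu>]\<close> and \<open>[\<mu>, \<mu>]\<close>, of
  weights 0, 2 and 4, yields the arities 1, 3 and 5 of the relations. As these are so few, they are
  checked directly and not through a general theorem on derived brackets. The obstacle is that the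
  bracket and the relations are sums over shuffle permutations, which do not lend themselves to
  induction. Both are turned into one recursion over lists that decides for each entry in turn which
  of two blocks receives it. The correction terms in the contraction rule arise because a cochain of
  degree 0 consumes no pair, so it can be inserted into the very pair that is contracted.\<close>

definition neg_pow :: "int \<Rightarrow> 'v::ab_group_add \<Rightarrow> 'v" where
  "neg_pow n v = (if even n then v else - v)"

lemma neg_pow_simps [simp]:
  "neg_pow n 0 = 0" "neg_pow 0 v = v" "neg_pow n (neg_pow n v) = v"
  by (auto simp: neg_pow_def)

lemma neg_pow_add: "neg_pow (m + n) v = neg_pow m (neg_pow n v)"
  by (auto simp: neg_pow_def)

lemma neg_pow_plus: "neg_pow n (v + w) = neg_pow n v + neg_pow n w"
  by (auto simp: neg_pow_def)

lemma (in vector_space) scale_neg_one_powi: "scale ((-1) powi n) v = neg_pow n v"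
  by (auto simp: neg_pow_def power_int_minus_left)

lemma (in vector_space) scale_neg_one_power: "scale ((-1) ^ n) v = neg_pow (int n) v"
  by (auto simp: neg_pow_def uminus_power_if)

section \<open>Permutations and shuffles, split by the position of the first element\<close>

definition shift_perm :: "(nat \<Rightarrow> nat) \<Rightarrow> nat \<Rightarrow> nat" where
  "shift_perm \<tau> i = (case i of 0 \<Rightarrow> 0 | Suc j \<Rightarrow> Suc (\<tau> j))"

lemma shift_perm_simps [simp]: "shift_perm \<tau> 0 = 0" "shift_perm \<tau> (Suc i) = Suc (\<tau> i)"
  by (auto simp: shift_perm_def)

text \<open>As \<open>permute_list \<sigma> xs\<close> reads entry \<open>\<sigma> i\<close> at
  position \<open>i\<close>, the composite \<open>shift_perm \<tau> \<circ> rot_perm j\<close>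
  inserts the head of a list at position \<open>j\<close> of the tail permuted by
  \<open>\<tau>\<close>. Every permutation of \<open>{..<Suc n}\<close> has this form, with
  \<open>j\<close> the preimage of 0.\<close>

definition rot_perm :: "nat \<Rightarrow> nat \<Rightarrow> nat" where
  "rot_perm k i = (if i < k then Suc i else if i = k then 0 else i)"

text \<open>The coface map omitting \<open>k\<close>: it lists the positions left for the tail once
  the head sits at \<open>k\<close>.\<close>

definition skip :: "nat \<Rightarrow> nat \<Rightarrow> nat" where
  "skip k i = (if i < k then i else Suc i)"

lemma rot_perm_self [simp]: "rot_perm k k = 0"
  by (simp add: rot_perm_def)

lemma rot_perm_skip [simp]: "rot_perm k (skip k i) = Suc i"
  by (auto simp: rot_perm_def skip_def)

lemma rot_perm_0 [simp]: "rot_perm 0 = id"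
  by (auto simp: rot_perm_def)

lemma skip_cases: obtains "i = k" | j where "i = skip k j"
proof (cases "i < k")
  case True then show ?thesis using that(2)[of i] by (simp add: skip_def)
next
  case False
  then show ?thesis using that(1) that(2)[of "i - 1"] by (cases "i = k") (auto simp: skip_def)
qed

lemma skip_neq: "skip k i \<noteq> k"
  by (simp add: skip_def)

lemma rot_perm_Suc: "rot_perm (Suc k) = rot_perm k \<circ> transpose k (Suc k)"
  by (rule ext) (auto simp: rot_perm_def transpose_def)

lemma rot_perm_permutes: "k < n \<Longrightarrow> rot_perm k permutes {..<n}"
proof (induction k)
  case 0 show ?case unfolding rot_perm_0 by (rule permutes_id)
next
  case (Suc k)
  then show ?case unfolding rot_perm_Suc
    by (intro permutes_compose permutes_swap_id) auto
qed

lemma sign_rot_perm: "sign (rot_perm k) = (-1) ^ k"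
proof (induction k)
  case (Suc k)
  have "permutation (rot_perm k)"
    using rot_perm_permutes[of k "Suc k"] permutation_permutes by blast
  then have "sign (rot_perm (Suc k)) = sign (rot_perm k) * sign (transpose k (Suc k))"
    unfolding rot_perm_Suc by (rule sign_compose) (rule permutation_swap_id)
  then show ?case
    using Suc by (simp add: sign_swap_id)
qed (simp only: rot_perm_0 sign_id power_0)

lemma bij_shift_perm:
  assumes "bij \<tau>" shows "bij (shift_perm \<tau>)"
proof (rule o_bij)
  show "shift_perm (inv \<tau>) \<circ> shift_perm \<tau> = id"
    by (rule ext) (simp add: shift_perm_def bij_is_inj[OF assms] split: nat.split)
  show "shift_perm \<tau> \<circ> shift_perm (inv \<tau>) = id"
    by (rule ext) (simp add: shift_perm_def surj_f_inv_f[OF bij_is_surj[OF assms]] split: nat.split)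
qed

lemma shift_perm_permutes:
  assumes "\<tau> permutes {..<n}" shows "shift_perm \<tau> permutes {..<Suc n}"
proof -
  have "\<forall>x. x \<notin> {..<Suc n} \<longrightarrow> shift_perm \<tau> x = x"
    using assms by (auto simp: shift_perm_def permutes_def split: nat.splits)
  then show ?thesis
    using bij_shift_perm[OF permutes_bij[OF assms]] by (simp add: permutes_def bij_iff)
qed

lemma shift_perm_id [simp]: "shift_perm id = id"
  by (auto simp: shift_perm_def split: nat.splits)

lemma shift_perm_compose: "shift_perm (\<sigma> \<circ> \<tau>) = shift_perm \<sigma> \<circ> shift_perm \<tau>"
  by (auto simp: shift_perm_def split: nat.splits)

lemma shift_perm_transpose: "shift_perm (transpose a b) = transpose (Suc a) (Suc b)"
  by (auto simp: shift_perm_def transpose_def fun_eq_iff split: nat.splits)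

lemma sign_shift_perm:
  assumes "\<tau> permutes {..<n}" shows "sign (shift_perm \<tau>) = sign \<tau>"
proof -
  have "finite {..<n}" by simp
  from assms this show ?thesis
  proof (induction rule: permutes_induct)
    case id show ?case by (simp only: shift_perm_id)
  next
    case (swap a b p)
    have p: "permutation p" using swap permutation_permutes by blast
    have q: "permutation (shift_perm p)"
      using swap(4) shift_perm_permutes permutation_permutes by (metis finite_lessThan)
    show ?case
      unfolding shift_perm_compose shift_perm_transpose sign_compose[OF permutation_swap_id p]
        sign_compose[OF permutation_swap_id q] sign_swap_id
      using swap by simp
  qed
qed

text \<open>The head has the smallest index 0, so it is inverted with exactly the \<open>j\<close>
  entries standing before it; the remaining inversions are those of \<open>\<tau>\<close>, moved by
  \<open>skip j\<close>.\<close>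

lemma inversions_shift_rot:
  assumes "j \<le> n"
  shows "{(a, b). a < b \<and> b < Suc n \<and> (shift_perm \<tau> \<circ> rot_perm j) a > (shift_perm \<tau> \<circ> rot_perm j) b}
     = (\<lambda>a. (a, j)) ` {..<j} \<union> map_prod (skip j) (skip j) ` {(a, b). a < b \<and> b < n \<and> \<tau> a > \<tau> b}"
    (is "?L = ?R")
proof
  show "?L \<subseteq> ?R"
  proof safe
    fix a b assume ab: "a < b" "b < Suc n"
      "(shift_perm \<tau> \<circ> rot_perm j) a > (shift_perm \<tau> \<circ> rot_perm j) b"
      and no: "(a, b) \<notin> map_prod (skip j) (skip j) ` {(a, b). a < b \<and> b < n \<and> \<tau> a > \<tau> b}"
    show "(a, b) \<in> (\<lambda>a. (a, j)) ` {..<j}"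
    proof (cases a j rule: skip_cases)
      case 1 then show ?thesis using ab by simp
    next
      case (2 a')
      show ?thesis
      proof (cases b j rule: skip_cases)
        case 1 then show ?thesis using ab by auto
      next
        case b: (2 b')
        have "a' < b'" "b' < n" using ab assms unfolding 2 b by (auto simp: skip_def split: if_splits)
        then show ?thesis using no ab 2 b by auto
      qed
    qed
  qed
  have "skip j a < skip j b \<and> skip j b < Suc n" if "a < b" "b < n" for a b
    using that assms by (auto simp: skip_def)
  moreover have "rot_perm j a > 0" if "a < j" for a
    using that by (simp add: rot_perm_def)
  then have "shift_perm \<tau> (rot_perm j a) > 0" if "a < j" for a
    using that by (metis gr0_conv_Suc shift_perm_simps(2) zero_less_Suc)
  ultimately show "?R \<subseteq> ?L" using assms
    by auto
qed

lemma koszul_sign_shift_rot: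
  fixes d :: "nat \<Rightarrow> int"
  assumes "j \<le> n"
  shows "(koszul_sign (Suc n) d (shift_perm \<tau> \<circ> rot_perm j) :: 'k::field_char_0) =
    (\<Prod>a<j. (-1) powi (d 0 * d (Suc (\<tau> a)))) * koszul_sign n (d \<circ> Suc) \<tau>"
proof -
  let ?I = "{(a, b). a < b \<and> b < n \<and> \<tau> a > \<tau> b}"
  have fin: "finite ?I" by (rule finite_subset[of _ "{..<n} \<times> {..<n}"]) auto
  have inj: "inj_on (map_prod (skip j) (skip j)) ?I"
    by (auto simp: inj_on_def skip_def split: if_splits)
  have disj: "(\<lambda>a. (a, j)) ` {..<j} \<inter> map_prod (skip j) (skip j) ` ?I = {}"
    by (use skip_neq in force)
  have rot: "rot_perm j a = Suc a" if "a < j" for a using that by (simp add: rot_perm_def)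
  define h where "h = (\<lambda>(a, b). (-1 :: 'k) powi
      (d ((shift_perm \<tau> \<circ> rot_perm j) a) * d ((shift_perm \<tau> \<circ> rot_perm j) b)))"
  have "prod h ((\<lambda>a. (a, j)) ` {..<j}) = (\<Prod>a<j. (-1) powi (d 0 * d (Suc (\<tau> a))))"
    by (subst prod.reindex) (auto simp: inj_on_def h_def rot mult.commute)
  moreover have "prod h (map_prod (skip j) (skip j) ` ?I) = koszul_sign n (d \<circ> Suc) \<tau>"
    unfolding koszul_sign_def prod.reindex[OF inj] by (rule prod.cong) (auto simp: h_def)
  ultimately show ?thesis
    unfolding koszul_sign_def inversions_shift_rot[OF assms] h_def[symmetric]
    using prod.union_disjoint[OF _ finite_imageI[OF fin] disj, of h] by simp
qed

lemma sign_shift_rot: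
  assumes "\<tau> permutes {..<n}" "j \<le> n"
  shows "sign (shift_perm \<tau> \<circ> rot_perm j) = (-1) ^ j * sign \<tau>"
proof -
  have "permutation (shift_perm \<tau>)" "permutation (rot_perm j)"
    using shift_perm_permutes[OF assms(1)] rot_perm_permutes[of j "Suc j"]
      permutation_permutes by blast+
  then show ?thesis
    by (simp add: sign_compose sign_shift_perm[OF assms(1)] sign_rot_perm)
qed

lemma permute_list_shift_rot:
  assumes "j \<le> length xs" "\<tau> permutes {..<length xs}"
  shows "permute_list (shift_perm \<tau> \<circ> rot_perm j) (x # xs) =
    take j (permute_list \<tau> xs) @ x # drop j (permute_list \<tau> xs)"
proof (rule nth_equalityI)
  fix i assume i: "i < length (permute_list (shift_perm \<tau> \<circ> rot_perm j) (x # xs))"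
  show "permute_list (shift_perm \<tau> \<circ> rot_perm j) (x # xs) ! i =
    (take j (permute_list \<tau> xs) @ x # drop j (permute_list \<tau> xs)) ! i"
    using i assms(1)
    by (cases i j rule: skip_cases)
       (auto simp: permute_list_def nth_append skip_def rot_perm_def simp del: upt_Suc split: if_splits)
qed (use assms in simp)

lemma shift_rot_inj: "inj (\<lambda>\<tau>. shift_perm \<tau> \<circ> rot_perm j)"
proof (rule injI)
  fix \<sigma> \<tau> assume *: "shift_perm \<sigma> \<circ> rot_perm j = shift_perm \<tau> \<circ> rot_perm j"
  show "\<sigma> = \<tau>"
  proof
    fix i show "\<sigma> i = \<tau> i" using fun_cong[OF *, of "skip j i"] by simp
  qed
qed

lemma shift_rot_decompose:
  assumes "\<sigma> permutes {..<Suc n}"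
  obtains j \<tau> where "j \<le> n" "\<tau> permutes {..<n}" "\<sigma> = shift_perm \<tau> \<circ> rot_perm j"
proof -
  from assms obtain j where j: "\<sigma> j = 0" "j \<le> n"
    by (metis lessThan_iff less_Suc_eq_le permutes_def zero_less_Suc)
  have inj: "inj \<sigma>" using assms by (rule permutes_inj)
  have nz: "\<sigma> (skip j i) \<noteq> 0" for i
    using inj j by (metis injD rot_perm_self rot_perm_skip nat.distinct(1))
  define \<tau> where "\<tau> = (\<lambda>i. \<sigma> (skip j i) - 1)"
  have eq: "\<sigma> = shift_perm \<tau> \<circ> rot_perm j"
  proof
    fix i show "\<sigma> i = (shift_perm \<tau> \<circ> rot_perm j) i"
      using nz by (cases i j rule: skip_cases) (auto simp: j \<tau>_def)
  qed
  have out: "\<tau> i = i" if "i \<notin> {..<n}" for i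
    using that assms j by (auto simp: \<tau>_def skip_def permutes_def)
  have "inj \<tau>"
  proof (rule injI)
    fix a b assume "\<tau> a = \<tau> b"
    then have "\<sigma> (skip j a) = \<sigma> (skip j b)" using nz[of a] nz[of b] by (simp add: \<tau>_def)
    then have "skip j a = skip j b" using inj by (auto dest: injD)
    then show "a = b" by (auto simp: skip_def split: if_splits)
  qed
  moreover have "\<tau> ` {..<n} \<subseteq> {..<n}"
  proof safe
    fix i assume "i < n"
    then have "skip j i < Suc n" by (auto simp: skip_def)
    then have "\<sigma> (skip j i) < Suc n" using assms permutes_in_image by fastforce
    then show "\<tau> i < n" using nz[of i] by (simp add: \<tau>_def)
  qed
  ultimately have "\<tau> permutes {..<n}"
    using out by (metis finite_lessThan inj_imp_permutes image_subset_iff inj_on_subset subset_UNIV)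
  then show ?thesis using that j eq by blast
qed

text \<open>A shuffle increases on each block, so the index 0 stands at the start of the first block
  (\<open>j = 0\<close>) or of the second (\<open>j = k\<close>). The conditions
  \<open>k > 0\<close> and \<open>q > 0\<close> say that this block is not empty; the former also
  keeps the two cases apart.\<close>

lemma shift_rot_shuffle_iff:
  assumes "\<tau> permutes {..<n}" "k + q = Suc n" "j \<le> n"
  shows "shift_perm \<tau> \<circ> rot_perm j \<in> shuffle_perms k q \<longleftrightarrow>
    (j = 0 \<and> k > 0 \<and> \<tau> \<in> shuffle_perms (k - 1) q) \<or> (j = k \<and> q > 0 \<and> \<tau> \<in> shuffle_perms k (q - 1))"
    (is "?\<sigma> \<in> _ \<longleftrightarrow> ?A \<or> ?B")
proof -
  have perm: "?\<sigma> permutes {..<Suc n}"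
    using assms shift_perm_permutes rot_perm_permutes by (intro permutes_compose) auto
  show ?thesis
  proof
    assume "?\<sigma> \<in> shuffle_perms k q"
    then have m1: "strict_mono_on {..<k} ?\<sigma>" and m2: "strict_mono_on {k..<k+q} ?\<sigma>"
      by (auto simp: shuffle_perms_def)
    have "\<not> (0 < j \<and> j < k)"
      using strict_mono_onD[OF m1, of 0 j] by auto
    moreover have "\<not> (k < j)"
      using strict_mono_onD[OF m2, of k j] assms by auto
    ultimately consider "j = 0" "k > 0" | "j = k" "k > 0 \<Longrightarrow> j \<noteq> 0" by force
    then show "?A \<or> ?B"
    proof cases
      case 1
      have "\<tau> a < \<tau> b" if "a < b" "b < k - 1" for a b
        using strict_mono_onD[OF m1, of "Suc a" "Suc b"] that 1 by auto
      moreover have "\<tau> a < \<tau> b" if "a < b" "k - 1 \<le> a" "b < n" for a b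
        using strict_mono_onD[OF m2, of "Suc a" "Suc b"] that 1 assms by auto
      ultimately show ?thesis using 1 assms
        by (auto simp: shuffle_perms_def intro!: strict_mono_onI)
    next
      case 2
      have q: "q > 0" using 2 assms by auto
      have "\<tau> a < \<tau> b" if "a < b" "b < k" for a b
        using strict_mono_onD[OF m1, of a b] that 2 by (auto simp: rot_perm_def)
      moreover have "\<tau> a < \<tau> b" if "a < b" "k \<le> a" "b < n" for a b
        using strict_mono_onD[OF m2, of "Suc a" "Suc b"] that 2 assms by (auto simp: rot_perm_def)
      ultimately show ?thesis using 2 assms q
        by (auto simp: shuffle_perms_def intro!: strict_mono_onI)
    qed
  next
    assume "?A \<or> ?B"
    then show "?\<sigma> \<in> shuffle_perms k q"
    proof
      assume A: ?A
      then have t1: "\<And>a b. a < b \<Longrightarrow> b < k - 1 \<Longrightarrow> \<tau> a < \<tau> b"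
        and t2: "\<And>a b. a < b \<Longrightarrow> k - 1 \<le> a \<Longrightarrow> b < n \<Longrightarrow> \<tau> a < \<tau> b"
        using assms by (auto simp: shuffle_perms_def strict_mono_on_def)
      have "?\<sigma> a < ?\<sigma> b" if "a < b" "b < k" for a b
        using t1[of "a - 1" "b - 1"] that A by (cases a; cases b) auto
      moreover have "?\<sigma> a < ?\<sigma> b" if "a < b" "k \<le> a" "b < Suc n" for a b
        using t2[of "a - 1" "b - 1"] that A by (cases a; cases b) auto
      ultimately show ?thesis using perm assms
        by (auto simp: shuffle_perms_def intro!: strict_mono_onI)
    next
      assume B: ?B
      then have t1: "\<And>a b. a < b \<Longrightarrow> b < k \<Longrightarrow> \<tau> a < \<tau> b"
        and t2: "\<And>a b. a < b \<Longrightarrow> k \<le> a \<Longrightarrow> b < n \<Longrightarrow> \<tau> a < \<tau> b"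
        using assms by (auto simp: shuffle_perms_def strict_mono_on_def)
      have "?\<sigma> a < ?\<sigma> b" if "a < b" "b < k" for a b
        using t1[of a b] that B by (auto simp: rot_perm_def)
      moreover have "?\<sigma> a < ?\<sigma> b" if "a < b" "k \<le> a" "b < Suc n" for a b
        using t2[of "a - 1" "b - 1"] that B by (cases a; cases b) (auto simp: rot_perm_def)
      ultimately show ?thesis using perm assms
        by (auto simp: shuffle_perms_def intro!: strict_mono_onI)
    qed
  qed
qed

lemma shuffle_perms_permutes: "\<sigma> \<in> shuffle_perms k q \<Longrightarrow> \<sigma> permutes {..<k + q}"
  by (simp add: shuffle_perms_def)

lemma finite_shuffle_perms: "finite (shuffle_perms k q)"
  by (rule finite_subset[OF _ finite_permutations[of "{..<k + q}"]]) (auto simp: shuffle_perms_def)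

lemma shuffle_perms_Suc:
  assumes "k + q = Suc n"
  shows "shuffle_perms k q =
    (if k = 0 then {} else (\<lambda>\<tau>. shift_perm \<tau> \<circ> rot_perm 0) ` shuffle_perms (k - 1) q) \<union>
    (if q = 0 then {} else (\<lambda>\<tau>. shift_perm \<tau> \<circ> rot_perm k) ` shuffle_perms k (q - 1))" (is "?L = ?R")
proof
  show "?L \<subseteq> ?R"
  proof
    fix \<sigma> assume s: "\<sigma> \<in> shuffle_perms k q"
    obtain j \<tau> where t: "j \<le> n" "\<tau> permutes {..<n}" "\<sigma> = shift_perm \<tau> \<circ> rot_perm j"
      using shift_rot_decompose shuffle_perms_permutes[OF s] assms by metis
    show "\<sigma> \<in> ?R"
      using s shift_rot_shuffle_iff[OF t(2) assms t(1)] unfolding t(3) by auto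
  qed
  have "shift_perm \<tau> \<circ> rot_perm 0 \<in> ?L" if "k \<noteq> 0" "\<tau> \<in> shuffle_perms (k - 1) q" for \<tau>
    using shift_rot_shuffle_iff[of \<tau> n k q 0] that shuffle_perms_permutes[OF that(2)] assms by auto
  moreover have "shift_perm \<tau> \<circ> rot_perm k \<in> ?L" if "q \<noteq> 0" "\<tau> \<in> shuffle_perms k (q - 1)" for \<tau>
    using shift_rot_shuffle_iff[of \<tau> n k q k] that shuffle_perms_permutes[OF that(2)] assms by auto
  ultimately show "?R \<subseteq> ?L" by auto
qed

text \<open>The head of the list opens either the first block or the second, as in Pascal's rule for
  binomial coefficients.\<close>

lemma sum_shuffle_perms_Suc:
  assumes "k + q = Suc n"
  shows "sum f (shuffle_perms k q) =
    (if k = 0 then 0 else \<Sum>\<tau>\<in>shuffle_perms (k - 1) q. f (shift_perm \<tau> \<circ> rot_perm 0)) +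
    (if q = 0 then 0 else \<Sum>\<tau>\<in>shuffle_perms k (q - 1). f (shift_perm \<tau> \<circ> rot_perm k))"
proof -
  have "shift_perm \<sigma> \<circ> rot_perm 0 \<noteq> shift_perm \<tau> \<circ> rot_perm k" if "k \<noteq> 0" for \<sigma> \<tau>
  proof
    assume "shift_perm \<sigma> \<circ> rot_perm 0 = shift_perm \<tau> \<circ> rot_perm k"
    from fun_cong[OF this, of 0] show False using that by (auto simp: rot_perm_def)
  qed
  then have disj: "(if k = 0 then {} else (\<lambda>\<tau>. shift_perm \<tau> \<circ> rot_perm 0) ` shuffle_perms (k - 1) q) \<inter>
    (if q = 0 then {} else (\<lambda>\<tau>. shift_perm \<tau> \<circ> rot_perm k) ` shuffle_perms k (q - 1)) = {}"
    by auto
  have inj: "inj_on (\<lambda>\<tau>. shift_perm \<tau> \<circ> rot_perm j) S" for j S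
    using shift_rot_inj by (rule inj_on_subset) simp
  have img: "sum f ((\<lambda>\<tau>. shift_perm \<tau> \<circ> rot_perm j) ` S) = (\<Sum>\<tau>\<in>S. f (shift_perm \<tau> \<circ> rot_perm j))" for j S
    by (subst sum.reindex[OF inj]) (simp only: o_def)
  show ?thesis
    unfolding shuffle_perms_Suc[OF assms]
    using finite_shuffle_perms
    by (subst sum.union_disjoint[OF _ _ disj]; cases "k = 0"; cases "q = 0")
       (simp_all only: img finite_imageI finite.emptyI sum.empty if_True if_False simp_thms)
qed

lemma shuffle_perms_0: "shuffle_perms 0 0 = {id}"
  by (auto simp: shuffle_perms_def strict_mono_on_def)

text \<open>In both signs the head at position \<open>j\<close> contributes the factor
  \<open>(-1) ^ j\<close>. This lets the bracket, whose shuffles carry the signature, be treated by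
  Koszul sums with all degrees equal to 1.\<close>

lemma sign_eq_koszul_sign:
  assumes "\<sigma> \<in> shuffle_perms k q"
  shows "of_int (sign \<sigma>) = (koszul_sign (k + q) (\<lambda>_. 1) \<sigma> :: 'k::field_char_0)"
  using assms
proof (induction "k + q" arbitrary: k q \<sigma>)
  case 0
  then show ?case by (simp add: shuffle_perms_0 sign_id koszul_sign_def)
next
  case (Suc n)
  note * = shuffle_perms_Suc[OF Suc(2)[symmetric]]
  have one: "(\<lambda>_. 1) \<circ> Suc = (\<lambda>_. 1 :: int)" by auto
  from Suc(3) consider \<tau> where "k \<noteq> 0" "\<tau> \<in> shuffle_perms (k - 1) q" "\<sigma> = shift_perm \<tau> \<circ> rot_perm 0"
    | \<tau> where "q \<noteq> 0" "\<tau> \<in> shuffle_perms k (q - 1)" "\<sigma> = shift_perm \<tau> \<circ> rot_perm k"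
    unfolding * by (auto split: if_splits)
  then show ?case
  proof cases
    case 1
    have n: "n = k - 1 + q" using 1 Suc(2) by simp
    have t: "\<tau> permutes {..<n}" using shuffle_perms_permutes[OF 1(2)] n by simp
    show ?thesis
      using Suc(1)[OF n 1(2)] koszul_sign_shift_rot[where 'k='k, of 0 n "\<lambda>_. 1" \<tau>] sign_shift_rot[OF t, of 0]
      unfolding Suc(2)[symmetric] one 1(3) n[symmetric] by simp
  next
    case 2
    have n: "n = k + (q - 1)" using 2 Suc(2) by simp
    have t: "\<tau> permutes {..<n}" using shuffle_perms_permutes[OF 2(2)] n by simp
    have kn: "k \<le> n" using n by simp
    show ?thesis
      using Suc(1)[OF n 2(2)] koszul_sign_shift_rot[where 'k='k, of k n "\<lambda>_. 1" \<tau>, OF kn] sign_shift_rot[OF t kn]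
      unfolding Suc(2)[symmetric] one 2(3) n[symmetric] by (simp del: o_apply)
  qed
qed

section \<open>Koszul-signed sums over splittings of a list\<close>

text \<open>All ways to distribute a list over two subsequences \<open>a\<close> and
  \<open>b\<close>, signed by the cost of moving \<open>a\<close> in front of \<open>b\<close>: an
  entry \<open>x\<close> assigned to \<open>b\<close> is passed by the later entries assigned to
  \<open>a\<close>. The block lengths are fixed afterwards by a test inside \<open>G\<close>, so
  that one recursion serves all of them.\<close>

fun koszul_sum ::
  "('b \<Rightarrow> int) \<Rightarrow> ('b list \<Rightarrow> 'b list \<Rightarrow> 'v::ab_group_add) \<Rightarrow> 'b list \<Rightarrow> 'v" where
  "koszul_sum d G [] = G [] []"
| "koszul_sum d G (x # xs) = koszul_sum d (\<lambda>a. G (x # a)) xs +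
     koszul_sum d (\<lambda>a b. neg_pow (d x * sum_list (map d a)) (G a (x # b))) xs"

lemma koszul_sum_cong:
  assumes "\<And>a b. length a + length b = length xs \<Longrightarrow> set a \<subseteq> set xs \<Longrightarrow> set b \<subseteq> set xs \<Longrightarrow> G a b = H a b"
  shows "koszul_sum d G xs = koszul_sum d H xs"
  using assms
proof (induction xs arbitrary: G H)
  case (Cons x xs)
  have "koszul_sum d (\<lambda>a. G (x # a)) xs = koszul_sum d (\<lambda>a. H (x # a)) xs"
    by (rule Cons.IH, rule Cons.prems) auto
  moreover have "koszul_sum d (\<lambda>a b. neg_pow (d x * sum_list (map d a)) (G a (x # b))) xs =
     koszul_sum d (\<lambda>a b. neg_pow (d x * sum_list (map d a)) (H a (x # b))) xs"
    by (rule Cons.IH, subst Cons.prems) auto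
  ultimately show ?case by simp
qed auto

lemma koszul_sum_zero [simp]: "koszul_sum d (\<lambda>_ _. 0) xs = 0"
  by (induction xs) auto

lemma koszul_sum_add: "koszul_sum d (\<lambda>a b. G a b + H a b) xs = koszul_sum d G xs + koszul_sum d H xs"
  by (induction xs arbitrary: G H) (auto simp: neg_pow_plus)

text \<open>Moving the whole block \<open>a\<close> past the whole block \<open>b\<close> costs the
  product of their total degrees.\<close>

lemma koszul_sum_commute:
  "koszul_sum d G xs =
    koszul_sum d (\<lambda>a b. neg_pow (sum_list (map d a) * sum_list (map d b)) (G b a)) xs"
proof (induction xs arbitrary: G)
  case (Cons x xs)
  show ?case
    by (simp add: Cons.IH[of "\<lambda>a. G (x # a)"]
        Cons.IH[of "\<lambda>a b. neg_pow (d x * sum_list (map d a)) (G a (x # b))"]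
        neg_pow_add[symmetric] algebra_simps) (simp add: neg_pow_def)
qed simp

text \<open>Both sides satisfy the same recursion on the head of the list, the left one by
  \<open>sum_shuffle_perms_Suc\<close>. This is the passage from shuffle permutations to recursive
  sums, for the bracket and for the L-infinity relations alike.\<close>

lemma koszul_sum_eq_shuffle_sum:
  fixes scale :: "'k::field_char_0 \<Rightarrow> 'v::ab_group_add \<Rightarrow> 'v"
  assumes vs: "vector_space scale" and kq: "k + q = length xs"
  shows "(\<Sum>\<sigma>\<in>shuffle_perms k q. scale (koszul_sign (k + q) (\<lambda>i. d (xs ! i)) \<sigma>)
       (G (take k (permute_list \<sigma> xs)) (drop k (permute_list \<sigma> xs)))) =
    koszul_sum d (\<lambda>a b. if length a = k then G a b else 0) xs"
  using kq
proof (induction xs arbitrary: k q G)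
  case Nil
  then show ?case using vector_space.vector_space_assms(4)[OF vs] by (simp add: shuffle_perms_0 koszul_sign_def)
next
  case (Cons x xs)
  let ?n = "length xs"
  have kq: "k + q = Suc ?n" using Cons.prems by simp
  let ?f = "\<lambda>\<sigma>. scale (koszul_sign (k + q) (\<lambda>i. d ((x # xs) ! i)) \<sigma>)
       (G (take k (permute_list \<sigma> (x # xs))) (drop k (permute_list \<sigma> (x # xs))))"
  have o: "(\<lambda>i. d ((x # xs) ! i)) \<circ> Suc = (\<lambda>i. d (xs ! i))" by auto
  have 1: "(if k = 0 then 0 else \<Sum>\<tau>\<in>shuffle_perms (k - 1) q. ?f (shift_perm \<tau> \<circ> rot_perm 0)) =
    koszul_sum d (\<lambda>a b. if length (x # a) = k then G (x # a) b else 0) xs"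
  proof (cases k)
    case (Suc k')
    have n: "k' + q = ?n" using kq Suc by simp
    have "?f (shift_perm \<tau> \<circ> rot_perm 0) = scale (koszul_sign (k' + q) (\<lambda>i. d (xs ! i)) \<tau>)
       (G (x # take k' (permute_list \<tau> xs)) (drop k' (permute_list \<tau> xs)))"
      if "\<tau> \<in> shuffle_perms k' q" for \<tau>
      using permute_list_shift_rot[of 0 xs \<tau> x] shuffle_perms_permutes[OF that]
        koszul_sign_shift_rot[where 'k='k, of 0 ?n "\<lambda>i. d ((x # xs) ! i)" \<tau>, unfolded o]
      unfolding kq n[symmetric] by (simp add: Suc n)
    then show ?thesis
      using Cons.IH[OF n, of "\<lambda>a. G (x # a)"] by (simp add: Suc)
  qed simp
  have 2: "(if q = 0 then 0 else \<Sum>\<tau>\<in>shuffle_perms k (q - 1). ?f (shift_perm \<tau> \<circ> rot_perm k)) =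
    koszul_sum d (\<lambda>a b. neg_pow (d x * sum_list (map d a)) (if length a = k then G a (x # b) else 0)) xs"
  proof (cases q)
    case 0
    \<comment> \<open>For \<open>q = 0\<close> the tail is shorter than \<open>k\<close>, so
      \<open>length a = k\<close> never holds.\<close>
    then have "koszul_sum d (\<lambda>a b. neg_pow (d x * sum_list (map d a)) (if length a = k then G a (x # b) else 0)) xs
        = koszul_sum d (\<lambda>_ _. 0) xs"
      using kq by (intro koszul_sum_cong) auto
    then show ?thesis using 0 by simp
  next
    case (Suc q')
    have n: "k + q' = ?n" using kq Suc by simp
    have "?f (shift_perm \<tau> \<circ> rot_perm k) = scale (koszul_sign (k + q') (\<lambda>i. d (xs ! i)) \<tau>)
       (neg_pow (d x * sum_list (map d (take k (permute_list \<tau> xs))))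
         (G (take k (permute_list \<tau> xs)) (x # drop k (permute_list \<tau> xs))))"
      if "\<tau> \<in> shuffle_perms k q'" for \<tau>
    proof -
      have perm: "\<tau> permutes {..<length xs}" using shuffle_perms_permutes[OF that] n by simp
      have len: "k \<le> length xs" using n by simp
      have tk: "take k (permute_list \<tau> xs) = map (\<lambda>a. xs ! \<tau> a) [0..<k]"
        using len by (simp add: permute_list_def take_map)
      have prod_powi: "(\<Prod>a<j. (-1::'k) powi (c * g a)) = (-1) powi (c * sum_list (map g [0..<j]))"
        for c :: int and g :: "nat \<Rightarrow> int" and j
        by (induction j) (auto simp: distrib_left power_int_add)
      \<comment> \<open>The head, placed at position \<open>k\<close>, is passed by the first
        \<open>k\<close> entries of the permuted tail; the signs multiply to one with their total
        degree.\<close>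
      have pr: "(\<Prod>a<k. (-1 :: 'k) powi (d x * d (xs ! \<tau> a))) =
          (-1) powi (d x * sum_list (map d (take k (permute_list \<tau> xs))))"
        unfolding tk map_map o_def by (rule prod_powi)
      have p: "permute_list (shift_perm \<tau> \<circ> rot_perm k) (x # xs) =
          take k (permute_list \<tau> xs) @ x # drop k (permute_list \<tau> xs)"
        by (rule permute_list_shift_rot[OF len perm])
      have ks: "koszul_sign (k + q) (\<lambda>i. d ((x # xs) ! i)) (shift_perm \<tau> \<circ> rot_perm k) =
         (koszul_sign (k + q') (\<lambda>i. d (xs ! i)) \<tau> * (-1) powi (d x * sum_list (map d (take k (permute_list \<tau> xs)))) :: 'k)"
        unfolding kq koszul_sign_shift_rot[OF len] o n using pr by (simp add: mult.commute)
      show ?thesis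
        unfolding p ks using len by (simp add: vector_space.scale_neg_one_powi[OF vs] flip: vector_space.vector_space_assms(3)[OF vs])
    qed
    moreover have "(\<lambda>a b. neg_pow (d x * sum_list (map d a)) (if length a = k then G a (x # b) else 0)) =
      (\<lambda>a b. if length a = k then neg_pow (d x * sum_list (map d a)) (G a (x # b)) else 0)"
      by (intro ext) simp
    ultimately show ?thesis
      using Cons.IH[OF n, of "\<lambda>a b. neg_pow (d x * sum_list (map d a)) (G a (x # b))"]
      by (simp add: Suc)
  qed
  show ?case
    unfolding sum_shuffle_perms_Suc[OF kq] 1 2 by simp
qed

section \<open>The bracket of cochains\<close>

lemma neg_pow_minus: "neg_pow n (v - w) = neg_pow n v - neg_pow n w"
  by (auto simp: neg_pow_def)

lemma neg_pow_sum: "neg_pow n (sum f S) = (\<Sum>i\<in>S. neg_pow n (f i))"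
  by (auto simp: neg_pow_def sum_negf)

lemma neg_pow_apply: "neg_pow n f x = neg_pow n (f x)"
  by (auto simp: neg_pow_def)

lemma koszul_sum_neg_pow: "koszul_sum d (\<lambda>a b. neg_pow n (G a b)) xs = neg_pow n (koszul_sum d G xs)"
proof (induction xs arbitrary: G)
  case (Cons x xs)
  have "(\<lambda>a b. neg_pow (d x * sum_list (map d a)) (neg_pow n (G a (x # b)))) =
    (\<lambda>a b. neg_pow n (neg_pow (d x * sum_list (map d a)) (G a (x # b))))"
    by (intro ext) (simp add: neg_pow_def)
  then show ?case by (simp add: Cons.IH neg_pow_plus)
qed simp

text \<open>With the sign \<open>(-1)\<^bsup>kq\<^esup>\<close> of \<open>rcirc\<close> included, the signs in the recursion below depend on \<open>q\<close> only.\<close>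

definition shuffle_sum :: "nat \<Rightarrow> nat \<Rightarrow> ('b list \<Rightarrow> 'b list \<Rightarrow> 'v::ab_group_add) \<Rightarrow> 'b list \<Rightarrow> 'v" where
  "shuffle_sum k q H Ys =
     neg_pow (int (k * q)) (koszul_sum (\<lambda>_. 1) (\<lambda>a b. if length a = k then H a b else 0) Ys)"

lemma shuffle_sum_cong:
  assumes "length Ys = k + q"
    and "\<And>a b. length a = k \<Longrightarrow> length b = q \<Longrightarrow> set a \<subseteq> set Ys \<Longrightarrow> set b \<subseteq> set Ys \<Longrightarrow> G a b = H a b"
  shows "shuffle_sum k q G Ys = shuffle_sum k q H Ys"
  unfolding shuffle_sum_def
  by (rule arg_cong[where f = "neg_pow _"], rule koszul_sum_cong) (use assms in auto)

lemma shuffle_sum_zero [simp]: "shuffle_sum k q (\<lambda>_ _. 0) Ys = 0"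
  by (simp add: shuffle_sum_def cong: if_cong)

lemma shuffle_sum_add:
  "shuffle_sum k q (\<lambda>a b. G a b + H a b) Ys = shuffle_sum k q G Ys + shuffle_sum k q H Ys"
proof -
  have "(\<lambda>a b. if length a = k then G a b + H a b else 0) =
    (\<lambda>a b. (if length a = k then G a b else 0) + (if length a = k then H a b else 0))"
    by (intro ext) auto
  then show ?thesis by (simp add: shuffle_sum_def koszul_sum_add neg_pow_plus)
qed

lemma shuffle_sum_Nil [simp]: "shuffle_sum 0 0 H [] = H [] []"
  by (simp add: shuffle_sum_def)

text \<open>If the head goes to \<open>a\<close>, the prefactor exponent drops from kq to (k - 1)q,
  which leaves the sign of exponent q. If it goes to \<open>b\<close>, the drop from kq to k(q - 1)
  leaves exponent k, and this cancels the Koszul sign for passing the k entries of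
  \<open>a\<close>.\<close>

lemma shuffle_sum_Cons:
  assumes "k + q = Suc (length Ys)"
  shows "shuffle_sum k q H (X # Ys) =
    (if k = 0 then 0 else neg_pow (int q) (shuffle_sum (k - 1) q (\<lambda>a. H (X # a)) Ys)) +
    (if q = 0 then 0 else shuffle_sum k (q - 1) (\<lambda>a b. H a (X # b)) Ys)"
proof -
  let ?K = "koszul_sum (\<lambda>_. 1 :: int)"
  have 1: "neg_pow (int (k * q)) (?K (\<lambda>a b. if length (X # a) = k then H (X # a) b else 0) Ys) =
    (if k = 0 then 0 else neg_pow (int q) (shuffle_sum (k - 1) q (\<lambda>a. H (X # a)) Ys))"
    by (cases k) (simp_all add: shuffle_sum_def neg_pow_add[symmetric] algebra_simps)
  have eq: "neg_pow (1 * sum_list (map (\<lambda>_. 1) a)) (if length a = k then H a (X # b) else 0) =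
      neg_pow (int k) (if length a = k then H a (X # b) else 0)" for a b
    by (simp add: sum_list_triv)
  have 2: "neg_pow (int (k * q)) (?K (\<lambda>a b. neg_pow (1 * sum_list (map (\<lambda>_. 1) a))
       (if length a = k then H a (X # b) else 0)) Ys) =
    (if q = 0 then 0 else shuffle_sum k (q - 1) (\<lambda>a b. H a (X # b)) Ys)"
  proof (cases q)
    case 0
    have "?K (\<lambda>a b. if length a = k then H a (X # b) else 0) Ys = ?K (\<lambda>_ _. 0) Ys"
      using 0 assms by (intro koszul_sum_cong) auto
    then show ?thesis unfolding eq koszul_sum_neg_pow using 0 by simp
  next
    case (Suc q')
    have e: "neg_pow (int (k * q)) (neg_pow (int k) v) = neg_pow (int (k * q')) v" for v :: 'b
      by (auto simp: Suc neg_pow_def)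
    show ?thesis unfolding eq koszul_sum_neg_pow e by (simp add: Suc shuffle_sum_def)
  qed
  show ?thesis
    unfolding 1[symmetric] 2[symmetric] by (simp add: shuffle_sum_def neg_pow_plus)
qed

definition contract :: "'a \<times> 'a \<Rightarrow> ('a, 'b) cochain \<Rightarrow> ('a, 'b) cochain" where
  "contract X A = (\<lambda>Xs. A (X # Xs))"

lemma contract_apply [simp]: "contract X A Xs = A (X # Xs)"
  by (simp add: contract_def)

lemma contract_simps [simp]: "contract X 0 = 0" "contract X (A + B) = contract X A + contract X B"
  "contract X (A - B) = contract X A - contract X B" "contract X (- A) = - contract X A"
  "contract X (neg_pow n A) = neg_pow n (contract X A)"
  by (intro ext, simp add: neg_pow_apply)+

locale char_0_vector_space = vector_space scale
  for scale :: "'k::field_char_0 \<Rightarrow> 'v::ab_group_add \<Rightarrow> 'v"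
begin

abbreviation "br \<equiv> rbracket scale"
abbreviation "C \<equiv> cochains scale scale"
abbreviation "cscale \<equiv> cochain_scale scale :: 'k \<Rightarrow> ('v, 'v) cochain \<Rightarrow> ('v, 'v) cochain"
abbreviation "lin \<equiv> Vector_Spaces.linear scale scale"

lemma scale_neg_pow: "scale c (neg_pow n v) = neg_pow n (scale c v)"
  by (simp add: neg_pow_def)

lemma koszul_sum_scale: "koszul_sum d (\<lambda>a b. scale c (G a b)) xs = scale c (koszul_sum d G xs)"
  by (induction xs arbitrary: G) (simp_all add: scale_neg_pow[symmetric] scale_right_distrib)

lemma shuffle_sum_scale:
  "shuffle_sum k q (\<lambda>a b. scale c (G a b)) Ys = scale c (shuffle_sum k q G Ys)"
proof -
  have "(\<lambda>a b. if length a = k then scale c (G a b) else 0) =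
    (\<lambda>a b. scale c (if length a = k then G a b else 0))"
    by (intro ext) auto
  then show ?thesis by (simp add: shuffle_sum_def koszul_sum_scale scale_neg_pow)
qed

lemma shuffle_sum_eq:
  assumes "length Ys = k + q"
  shows "(\<Sum>\<sigma>\<in>shuffle_perms k q. scale ((-1) ^ (k * q) * of_int (sign \<sigma>))
      (H (take k (permute_list \<sigma> Ys)) (drop k (permute_list \<sigma> Ys)))) = shuffle_sum k q H Ys"
proof -
  have "(\<Sum>\<sigma>\<in>shuffle_perms k q. scale ((-1) ^ (k * q) * of_int (sign \<sigma>))
      (H (take k (permute_list \<sigma> Ys)) (drop k (permute_list \<sigma> Ys)))) =
    scale ((-1) ^ (k * q)) (\<Sum>\<sigma>\<in>shuffle_perms k q. scale (koszul_sign (k + q) (\<lambda>_. 1) \<sigma>)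
      (H (take k (permute_list \<sigma> Ys)) (drop k (permute_list \<sigma> Ys))))"
    unfolding scale_sum_right scale_scale by (intro sum.cong refl) (simp add: sign_eq_koszul_sign)
  then show ?thesis
    using koszul_sum_eq_shuffle_sum[OF vector_space_axioms, of k q Ys "\<lambda>_. 1" H] assms
    by (simp add: shuffle_sum_def scale_neg_one_power)
qed

text \<open>One insertion in \<open>A \<circ> B\<close>: \<open>B\<close> acts as a derivation on
  the pair at position \<open>k + q\<close>, hence the two summands, united here under a single
  shuffle sum.\<close>

definition rterm where
  "rterm k q A B Xs x = shuffle_sum k q (\<lambda>a b. 
     A (a @ (B b (fst (Xs ! (k + q))), snd (Xs ! (k + q))) # drop (k + q + 1) Xs) x +
     A (a @ (fst (Xs ! (k + q)), B b (snd (Xs ! (k + q)))) # drop (k + q + 1) Xs) x)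
     (take (k + q) Xs)"

lemma rcirc_eq:
  assumes "length Xs = p + q"
  shows "rcirc scale p q A B Xs x =
    (\<Sum>k<p. rterm k q A B Xs x) + shuffle_sum p q (\<lambda>a b. A a (B b x)) Xs"
proof -
  have len: "length (take (k + q) Xs) = k + q" if "k \<in> {..<p}" for k using that assms by simp
  show ?thesis
    unfolding rcirc_def rterm_def Let_def case_prod_unfold shuffle_sum_add
      shuffle_sum_eq[OF assms, where H = "\<lambda>a b. A a (B b x)"] sum.distrib
      append_Cons append_Nil
    by (intro arg_cong2[where f = "(+)"] sum.cong refl; rule trans[OF _ shuffle_sum_eq[OF len]])
       (auto intro: refl)
qed

text \<open>The head pair \<open>X\<close> is one of the shuffled inputs unless
  \<open>k + q = 0\<close>; in that case \<open>X\<close> is itself the pair on which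
  \<open>B\<close> acts, and this yields the two extra terms.\<close>

lemma rterm_Cons:
  assumes "k < p" "p + q = Suc (length Xs)"
  shows "rterm k q A B (X # Xs) x =
    (if k = 0 then 0 else neg_pow (int q) (rterm (k - 1) q (contract X A) B Xs x)) +
    (if q = 0 then if k = 0 then A ((B [] (fst X), snd X) # Xs) x + A ((fst X, B [] (snd X)) # Xs) x else 0
     else rterm k (q - 1) A (contract X B) Xs x)"
proof (cases "k + q")
  case 0
  then show ?thesis by (simp add: rterm_def)
next
  case (Suc m)
  have len: "k + q = Suc (length (take m Xs))" using assms Suc by simp
  have m: "k - 1 + q = m" if "k \<noteq> 0" using that Suc by simp
  have m': "k + (q - 1) = m" if "q \<noteq> 0" using that Suc by simp
  have 1: "(if k = 0 then 0 else neg_pow (int q) (rterm (k - 1) q (contract X A) B Xs x)) =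
    (if k = 0 then 0 else neg_pow (int q) (shuffle_sum (k - 1) q (\<lambda>a b.
     A ((X # a) @ (B b (fst (Xs ! m)), snd (Xs ! m)) # drop (m + 1) Xs) x +
     A ((X # a) @ (fst (Xs ! m), B b (snd (Xs ! m))) # drop (m + 1) Xs) x) (take m Xs)))"
    unfolding rterm_def contract_apply append_Cons using m by (cases "k = 0") (simp_all only: if_True if_False refl simp_thms)
  have 2: "(if q = 0 then if k = 0 then A ((B [] (fst X), snd X) # Xs) x + A ((fst X, B [] (snd X)) # Xs) x else 0
     else rterm k (q - 1) A (contract X B) Xs x) =
    (if q = 0 then 0 else shuffle_sum k (q - 1) (\<lambda>a b.
     A (a @ (B (X # b) (fst (Xs ! m)), snd (Xs ! m)) # drop (m + 1) Xs) x +
     A (a @ (fst (Xs ! m), B (X # b) (snd (Xs ! m))) # drop (m + 1) Xs) x) (take m Xs))"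
    unfolding rterm_def contract_apply using m' Suc by (cases "q = 0") (simp_all only: if_True if_False refl simp_thms add_0_right nat.distinct)
  show ?thesis
    unfolding 1 2
    unfolding rterm_def Suc take_Suc_Cons shuffle_sum_Cons[OF len] by simp
qed

lemma rcirc_Cons:
  assumes "p + q = Suc (length Xs)"
  shows "rcirc scale p q A B (X # Xs) x =
    (if p = 0 then 0 else neg_pow (int q) (rcirc scale (p - 1) q (contract X A) B Xs x)) +
    (if q = 0 then A ((B [] (fst X), snd X) # Xs) x + A ((fst X, B [] (snd X)) # Xs) x
     else rcirc scale p (q - 1) A (contract X B) Xs x)"
proof -
  have shift: "(\<Sum>k<p. if k = 0 then 0 else f (k - 1)) = (\<Sum>k<p - 1. f k)" for f :: "nat \<Rightarrow> 'v"
    by (cases p) (simp_all add: sum.lessThan_Suc_shift del: sum.lessThan_Suc)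
  have 1: "(\<Sum>k<p. rterm k q A B (X # Xs) x) =
    neg_pow (int q) (\<Sum>k<p - 1. rterm k q (contract X A) B Xs x) +
    (if q = 0 then A ((B [] (fst X), snd X) # Xs) x + A ((fst X, B [] (snd X)) # Xs) x
     else (\<Sum>k<p. rterm k (q - 1) A (contract X B) Xs x))"
  proof -
    have "(\<Sum>k<p. rterm k q A B (X # Xs) x) =
       (\<Sum>k<p. if k = 0 then 0 else neg_pow (int q) (rterm (k - 1) q (contract X A) B Xs x)) +
       (\<Sum>k<p. if q = 0 then if k = 0 then A ((B [] (fst X), snd X) # Xs) x + A ((fst X, B [] (snd X)) # Xs) x else 0
         else rterm k (q - 1) A (contract X B) Xs x)"
      unfolding sum.distrib[symmetric] by (intro sum.cong refl rterm_Cons[OF _ assms]) simp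
    \<comment> \<open>Here \<open>q = 0\<close> forces \<open>p > 0\<close>, so the exceptional
      index \<open>k = 0\<close> does occur in the sum.\<close>
    moreover have "(\<Sum>k<p. if q = 0 then if k = 0 then A ((B [] (fst X), snd X) # Xs) x + A ((fst X, B [] (snd X)) # Xs) x else 0
         else rterm k (q - 1) A (contract X B) Xs x) = (if q = 0 then A ((B [] (fst X), snd X) # Xs) x + A ((fst X, B [] (snd X)) # Xs) x
     else (\<Sum>k<p. rterm k (q - 1) A (contract X B) Xs x))"
      using assms by (cases "q = 0") simp_all
    ultimately show ?thesis
      using shift[of "\<lambda>k. neg_pow (int q) (rterm k q (contract X A) B Xs x)"]
      by (simp only: neg_pow_sum)
  qed
  have 2: "shuffle_sum p q (\<lambda>a b. A a (B b x)) (X # Xs) =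
    (if p = 0 then 0 else neg_pow (int q) (shuffle_sum (p - 1) q (\<lambda>a b. contract X A a (B b x)) Xs)) +
    (if q = 0 then 0 else shuffle_sum p (q - 1) (\<lambda>a b. A a (contract X B b x)) Xs)"
    using shuffle_sum_Cons[OF assms, of "\<lambda>a b. A a (B b x)" X] by simp
  have l: "length (X # Xs) = p + q" using assms by simp
  have l1: "length Xs = p - 1 + q" if "p \<noteq> 0" using that assms by simp
  have l2: "length Xs = p + (q - 1)" if "q \<noteq> 0" using that assms by simp
  show ?thesis
    unfolding rcirc_eq[OF l] 1 2
    by (cases "p = 0"; cases "q = 0")
       (use assms rcirc_eq[OF l1, where A = "contract X A" and B = B and x = x]
          rcirc_eq[OF l2, where A = A and B = "contract X B" and x = x]
        in \<open>simp_all add: neg_pow_plus add_ac\<close>)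
qed

lemma rcirc_Nil: "rcirc scale 0 0 A B [] x = A [] (B [] x)"
  by (simp add: rcirc_eq)

text \<open>Imposed on lists of every length and without alternation, this property is stable under
  sums of cochains of different degrees. Bilinearity of the bracket on inhomogeneous elements rests
  on it.\<close>

definition multilinear :: "('v, 'v) cochain \<Rightarrow> bool" where
  "multilinear A \<longleftrightarrow> (\<forall>Xs. lin (A Xs)) \<and>
    (\<forall>Xs v Ys x. lin (\<lambda>u. A (Xs @ (u, v) # Ys) x) \<and> lin (\<lambda>u. A (Xs @ (v, u) # Ys) x))"

lemma multilinearD:
  assumes "multilinear A"
  shows "lin (A Xs)" "lin (\<lambda>u. A (Xs @ (u, v) # Ys) x)" "lin (\<lambda>u. A (Xs @ (v, u) # Ys) x)"
  using assms by (auto simp: multilinear_def)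

lemma lin_iff: "lin f \<longleftrightarrow> (\<forall>u v. f (u + v) = f u + f v) \<and> (\<forall>c u. f (scale c u) = scale c (f u))"
  by (simp add: Vector_Spaces.linear_iff_module_hom module_hom_iff module_axioms)

lemma multilinear_add_slot:
  assumes "multilinear A"
  shows "A Xs (x + y) = A Xs x + A Xs y" "A (Xs @ (u + u', v) # Ys) x = A (Xs @ (u, v) # Ys) x + A (Xs @ (u', v) # Ys) x"
    "A (Xs @ (v, u + u') # Ys) x = A (Xs @ (v, u) # Ys) x + A (Xs @ (v, u') # Ys) x"
  using multilinearD[OF assms, unfolded lin_iff] by simp_all

lemma multilinear_scale_slot:
  assumes "multilinear A"
  shows "A Xs (scale c x) = scale c (A Xs x)" "A (Xs @ (scale c u, v) # Ys) x = scale c (A (Xs @ (u, v) # Ys) x)"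
    "A (Xs @ (v, scale c u) # Ys) x = scale c (A (Xs @ (v, u) # Ys) x)"
  using multilinearD[OF assms, unfolded lin_iff] by simp_all

lemma multilinear_zero_slot:
  assumes "multilinear A"
  shows "A Xs 0 = 0" "A (Xs @ (0, v) # Ys) x = 0" "A (Xs @ (v, 0) # Ys) x = 0"
  using multilinear_scale_slot[OF assms, where c = 0] by auto

lemma multilinear_0: "multilinear 0"
  by (simp add: multilinear_def lin_iff)

lemma multilinear_add: "multilinear A \<Longrightarrow> multilinear B \<Longrightarrow> multilinear (A + B)"
  by (simp add: multilinear_def lin_iff algebra_simps scale_right_distrib)

lemma multilinear_cscale: "multilinear A \<Longrightarrow> multilinear (cscale c A)"
  by (simp add: multilinear_def lin_iff cochain_scale_def scale_right_distrib mult.commute)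

lemma multilinear_contract:
  assumes "multilinear A" shows "multilinear (contract X A)"
  using multilinearD[OF assms, of "X # _"] by (simp add: multilinear_def)

lemma rcirc_cong:
  assumes "length Xs = p + q"
    and "\<And>Ys. length Ys = p \<Longrightarrow> A Ys = A' Ys" "\<And>Ys. length Ys = q \<Longrightarrow> B Ys = B' Ys"
  shows "rcirc scale p q A B Xs x = rcirc scale p q A' B' Xs x"
  unfolding rcirc_eq[OF assms(1)] rterm_def
  by (intro arg_cong2[where f = "(+)"] sum.cong refl shuffle_sum_cong) (use assms in auto)

lemma rcirc_add_left:
  "length Xs = p + q \<Longrightarrow> rcirc scale p q (A + A') B Xs x = rcirc scale p q A B Xs x + rcirc scale p q A' B Xs x"
  by (simp add: rcirc_eq rterm_def shuffle_sum_add sum.distrib algebra_simps)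

lemma rcirc_scale_left:
  "length Xs = p + q \<Longrightarrow> rcirc scale p q (cscale c A) B Xs x = scale c (rcirc scale p q A B Xs x)"
  by (simp add: rcirc_eq rterm_def cochain_scale_def shuffle_sum_add shuffle_sum_scale scale_right_distrib scale_sum_right sum.distrib)

lemma rcirc_add_right:
  "multilinear A \<Longrightarrow> length Xs = p + q \<Longrightarrow>
    rcirc scale p q A (B + B') Xs x = rcirc scale p q A B Xs x + rcirc scale p q A B' Xs x"
  by (simp add: rcirc_eq rterm_def multilinear_add_slot shuffle_sum_add sum.distrib algebra_simps)

lemma rcirc_scale_right:
  "multilinear A \<Longrightarrow> length Xs = p + q \<Longrightarrow>
    rcirc scale p q A (cscale c B) Xs x = scale c (rcirc scale p q A B Xs x)"
  by (simp add: rcirc_eq rterm_def cochain_scale_def multilinear_scale_slot shuffle_sum_add shuffle_sum_scale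
      scale_right_distrib scale_sum_right sum.distrib)

lemma rcirc_zero_left: "length Xs = p + q \<Longrightarrow> rcirc scale p q 0 B Xs x = 0"
  by (simp add: rcirc_eq rterm_def)

lemma rcirc_zero_right: "multilinear A \<Longrightarrow> length Xs = p + q \<Longrightarrow> rcirc scale p q A 0 Xs x = 0"
  by (simp add: rcirc_eq rterm_def multilinear_zero_slot)

lemma br_apply:
  "br A B Xs x = (\<Sum>i\<le>length Xs. rcirc scale i (length Xs - i) A B Xs x -
     scale ((-1) ^ (i * (length Xs - i))) (rcirc scale (length Xs - i) i B A Xs x))"
  unfolding rbracket_def
  by (rule sum.reindex_bij_witness[of _ "\<lambda>i. (i, length Xs - i)" fst])
     (auto dest!: sym[of _ "length Xs"])

lemma cscale_apply: "cscale c A Xs x = scale c (A Xs x)"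
  by (simp add: cochain_scale_def)

text \<open>\<open>rcirc\<close> is additive in its outer argument by definition, and in its inner
  argument if the outer one is multilinear. In the two halves of the bracket the sum is once
  inserted into \<open>A\<close> and once the outer argument, so the condition falls on
  \<open>A\<close>.\<close>

lemma br_add_right:
  assumes "multilinear A"
  shows "br A (B + B') = br A B + br A B'"
proof (intro ext)
  fix Xs :: "('v \<times> 'v) list" and x
  have l: "length Xs = i + (length Xs - i)" "length Xs = length Xs - i + i" if "i \<in> {..length Xs}" for i
    using that by simp_all
  show "(br A (B + B')) Xs x = (br A B + br A B') Xs x"
    unfolding plus_fun_apply[of "br A B" "br A B'" Xs] plus_fun_apply[of "br A B Xs"] sum.distrib[symmetric] br_apply
    by (intro sum.cong refl) (simp only: rcirc_add_left[OF l(1)] rcirc_add_left[OF l(2)] rcirc_add_right[OF assms(1) l(1)] rcirc_add_right[OF assms(1) l(2)] scale_right_distrib diff_conv_add_uminus minus_add_distrib add_ac)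
qed

lemma br_add_left:
  assumes "multilinear B"
  shows "br (A + A') B = br A B + br A' B"
proof (intro ext)
  fix Xs :: "('v \<times> 'v) list" and x
  have l: "length Xs = i + (length Xs - i)" "length Xs = length Xs - i + i" if "i \<in> {..length Xs}" for i
    using that by simp_all
  show "(br (A + A') B) Xs x = (br A B + br A' B) Xs x"
    unfolding plus_fun_apply[of "br A B" "br A' B" Xs] plus_fun_apply[of "br A B Xs"] sum.distrib[symmetric] br_apply
    by (intro sum.cong refl) (simp only: rcirc_add_left[OF l(1)] rcirc_add_left[OF l(2)] rcirc_add_right[OF assms(1) l(1)] rcirc_add_right[OF assms(1) l(2)] scale_right_distrib diff_conv_add_uminus minus_add_distrib add_ac)
qed

lemma br_scale_right:
  assumes "multilinear A"
  shows "br A (cscale c B) = cscale c (br A B)"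
proof (intro ext)
  fix Xs :: "('v \<times> 'v) list" and x
  have l: "length Xs = i + (length Xs - i)" "length Xs = length Xs - i + i" if "i \<in> {..length Xs}" for i
    using that by simp_all
  show "(br A (cscale c B)) Xs x = (cscale c (br A B)) Xs x"
    unfolding cscale_apply[of c "br A B"] scale_sum_right br_apply
    by (intro sum.cong refl) (simp only: rcirc_scale_left[OF l(1)] rcirc_scale_left[OF l(2)] rcirc_scale_right[OF assms(1) l(1)] rcirc_scale_right[OF assms(1) l(2)] scale_right_diff_distrib scale_left_commute[of c])
qed

lemma br_scale_left:
  assumes "multilinear B"
  shows "br (cscale c A) B = cscale c (br A B)"
proof (intro ext)
  fix Xs :: "('v \<times> 'v) list" and x
  have l: "length Xs = i + (length Xs - i)" "length Xs = length Xs - i + i" if "i \<in> {..length Xs}" for i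
    using that by simp_all
  show "(br (cscale c A) B) Xs x = (cscale c (br A B)) Xs x"
    unfolding cscale_apply[of c "br A B"] scale_sum_right br_apply
    by (intro sum.cong refl) (simp only: rcirc_scale_left[OF l(1)] rcirc_scale_left[OF l(2)] rcirc_scale_right[OF assms(1) l(1)] rcirc_scale_right[OF assms(1) l(2)] scale_right_diff_distrib scale_left_commute[of c])
qed

lemma br_zero: "multilinear A \<Longrightarrow> br A 0 = 0" "multilinear A \<Longrightarrow> br 0 A = 0"
  by (intro ext, force simp: rbracket_def rcirc_zero_left rcirc_zero_right add.commute intro!: sum.neutral)+

end

section \<open>Contraction with the first pair of inputs\<close>

context char_0_vector_space
begin

lemma lin_zero: "lin (\<lambda>_. 0)"
  by (simp add: lin_iff)

lemma lin_diff: "lin f \<Longrightarrow> lin g \<Longrightarrow> lin (\<lambda>u. f u - g u)"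
  by (simp add: lin_iff scale_right_diff_distrib)

lemma lin_compose: "lin f \<Longrightarrow> lin g \<Longrightarrow> lin (\<lambda>u. f (g u))"
  by (simp add: lin_iff)

lemma cochain_length:
  assumes "A \<in> C n" "length Xs \<noteq> n" shows "A Xs x = 0" "A Xs = (\<lambda>_. 0)"
  using assms by (auto simp: cochains_def)

lemma cochain_update:
  assumes "A \<in> C n" "length Xs = n" "i < n"
  shows "lin (\<lambda>u. A (Xs[i := (u, y)]) x) \<and> lin (\<lambda>u. A (Xs[i := (y, u)]) x) \<and> A (Xs[i := (y, y)]) x = 0"
  using assms unfolding cochains_def mem_Collect_eq by blast

lemma cochain_last:
  assumes "A \<in> C n" "length Xs + 1 = n"
  shows "A (Xs @ [(x, y)]) x = 0 \<and> A (Xs @ [(y, x)]) x = 0"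
  using assms unfolding cochains_def mem_Collect_eq by blast

lemma cochain_linear:
  assumes "A \<in> C n" shows "lin (A Xs)"
proof (cases "length Xs = n")
  case True then show ?thesis using assms unfolding cochains_def mem_Collect_eq by blast
next
  case False then show ?thesis using lin_zero by (simp add: cochain_length(2)[OF assms])
qed

lemma cochain_contract_self:
  assumes "A \<in> C n" shows "contract (u, u) A = 0"
proof (intro ext)
  fix Xs x
  have "A ((u, u) # Xs) x = 0" if "Suc (length Xs) = n"
    using cochain_update[OF assms, of "(u, u) # Xs" 0] that by simp
  moreover have "A ((u, u) # Xs) x = 0" if "Suc (length Xs) \<noteq> n"
    using cochain_length[OF assms] that by simp
  ultimately show "contract (u, u) A Xs x = 0 Xs x"
    unfolding contract_apply zero_fun_apply by blast
qed

lemma multilinear_cochain: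
  assumes "A \<in> C n" shows "multilinear A"
proof -
  note cochain_linear[OF assms]
  moreover have "lin (\<lambda>u. A (Xs @ (u, v) # Ys) x) \<and> lin (\<lambda>u. A (Xs @ (v, u) # Ys) x)" for Xs v Ys x
  proof (cases "length (Xs @ (v, v) # Ys) = n")
    case True
    then have "lin (\<lambda>u. A ((Xs @ (v, v) # Ys)[length Xs := (u, v)]) x) \<and>
      lin (\<lambda>u. A ((Xs @ (v, v) # Ys)[length Xs := (v, u)]) x)"
      using cochain_update[OF assms, of "Xs @ (v, v) # Ys" "length Xs"] by auto
    then show ?thesis by simp
  next
    case False
    then show ?thesis using lin_zero by (simp add: cochain_length(1)[OF assms])
  qed
  ultimately show ?thesis by (auto simp: multilinear_def)
qed

lemma cochain_0I:
  assumes "\<And>X. contract X A = 0" "lin (A [])"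
  shows "A \<in> C 0"
proof -
  have "A (X # Xs) x = 0" for X Xs x
    using fun_cong[OF fun_cong[OF assms(1)[of X]], of Xs x] by simp
  then have "A Xs x = 0" if "Xs \<noteq> []" for Xs x using that by (cases Xs) auto
  then show ?thesis using assms(2) by (auto simp: cochains_def)
qed

lemma cochain_contract_0:
  assumes "A \<in> C 0" shows "contract X A = 0"
  by (intro ext) (simp add: cochain_length[OF assms])

text \<open>Contractions inherit the conditions on the later pairs, so only the first pair has to be
  examined. The condition tying the last pair to \<open>x\<close> concerns the first pair only when
  \<open>n = 0\<close>.\<close>

lemma cochain_Suc_iff:
  "A \<in> C (Suc n) \<longleftrightarrow> (\<forall>x. A [] x = 0) \<and> (\<forall>X. contract X A \<in> C n) \<and>
     (\<forall>v Xs x. lin (\<lambda>u. A ((u, v) # Xs) x) \<and> lin (\<lambda>u. A ((v, u) # Xs) x)) \<and>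
     (\<forall>u. contract (u, u) A = 0) \<and> (n = 0 \<longrightarrow> (\<forall>x y. A [(x, y)] x = 0 \<and> A [(y, x)] x = 0))"
    (is "?L \<longleftrightarrow> ?R")
proof
  assume A: ?L
  have "contract X A \<in> C n" for X
  proof -
    have m: "length (X # Xs) = Suc n \<Longrightarrow> i < n \<Longrightarrow>
        lin (\<lambda>u. A ((X # Xs)[Suc i := (u, y)]) x) \<and> lin (\<lambda>u. A ((X # Xs)[Suc i := (y, u)]) x) \<and>
        A ((X # Xs)[Suc i := (y, y)]) x = 0" for Xs x y i
      using cochain_update[OF A, of "X # Xs" "Suc i" y x] by simp
    have l: "length ((X # Xs) @ [(x, y)]) = Suc n \<Longrightarrow>
        A ((X # Xs) @ [(x, y)]) x = 0 \<and> A ((X # Xs) @ [(y, x)]) x = 0" for Xs x y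
    proof -
      assume "length ((X # Xs) @ [(x, y)]) = Suc n"
      then have "length (X # Xs) + 1 = Suc n" by simp
      then show ?thesis using cochain_last[OF A] by blast
    qed
    show ?thesis
      using m l cochain_length(1)[OF A] cochain_linear[OF A]
      by (simp add: cochains_def)
  qed
  moreover have "A [(x, y)] x = 0 \<and> A [(y, x)] x = 0" if "n = 0" for x y
  proof -
    have "length [] + 1 = Suc n" using that by simp
    then have "A ([] @ [(x, y)]) x = 0 \<and> A ([] @ [(y, x)]) x = 0"
      using cochain_last[OF A] by blast
    then show ?thesis by simp
  qed
  ultimately show ?R
    using cochain_contract_self[OF A] cochain_length(1)[OF A]
      multilinearD(2,3)[OF multilinear_cochain[OF A], of "[]"] by simp
next
  assume R: ?R
  have c: "A (X # Xs) = contract X A Xs" for X Xs by simp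
  have C: "contract X A \<in> C n" for X using R by blast
  show ?L unfolding cochains_def mem_Collect_eq
  proof (intro conjI allI impI; (elim conjE)?)
    fix Xs :: "('v \<times> 'v) list" and x assume "length Xs \<noteq> Suc n"
    then show "A Xs x = 0"
      using R cochain_length(1)[OF C] by (cases Xs) (auto simp: c simp del: contract_apply)
  next
    fix Xs :: "('v \<times> 'v) list" assume "length Xs = Suc n"
    then show "lin (A Xs)"
      using cochain_linear[OF C]
      by (cases Xs) (auto simp: c simp del: contract_apply)
  next
    fix Xs :: "('v \<times> 'v) list" and x y i assume l: "length Xs = Suc n" "i < Suc n"
    then obtain X Ys where X: "Xs = X # Ys" "length Ys = n" by (cases Xs) auto
    have "lin (\<lambda>u. A (Xs[i := (u, y)]) x) \<and> lin (\<lambda>u. A (Xs[i := (y, u)]) x) \<and> A (Xs[i := (y, y)]) x = 0"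
    proof (cases i)
      case 0
      have "contract (y, y) A = 0" using R by blast
      then have "A ((y, y) # Ys) x = 0" by (metis contract_apply zero_fun_apply)
      then show ?thesis using R 0 X by (simp del: split_paired_All)
    next
      case (Suc j)
      then have "j < n" using l by simp
      then have "lin (\<lambda>u. contract X A (Ys[j := (u, y)]) x) \<and> lin (\<lambda>u. contract X A (Ys[j := (y, u)]) x) \<and>
        contract X A (Ys[j := (y, y)]) x = 0"
        using cochain_update[OF C X(2)] by blast
      then show ?thesis using Suc X by simp
    qed
    then show "lin (\<lambda>u. A (Xs[i := (u, y)]) x)" "lin (\<lambda>u. A (Xs[i := (y, u)]) x)" "A (Xs[i := (y, y)]) x = 0"
      by blast+
  next
    fix Xs :: "('v \<times> 'v) list" and x y assume l: "length Xs + 1 = Suc n"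
    have "A (Xs @ [(x, y)]) x = 0 \<and> A (Xs @ [(y, x)]) x = 0"
    proof (cases Xs)
      case Nil then show ?thesis using R l by simp
    next
      case (Cons X Ys)
      then have "length Ys + 1 = n" using l by simp
      then have "contract X A (Ys @ [(x, y)]) x = 0 \<and> contract X A (Ys @ [(y, x)]) x = 0"
        using cochain_last[OF C] by blast
      then show ?thesis using Cons by simp
    qed
    then show "A (Xs @ [(x, y)]) x = 0" "A (Xs @ [(y, x)]) x = 0" by blast+
  qed
qed

lemma zero_cochain: "0 \<in> C n"
  by (auto simp: cochains_def lin_iff)

lemma add_cochain: "A \<in> C n \<Longrightarrow> B \<in> C n \<Longrightarrow> A + B \<in> C n"
  by (auto simp: cochains_def lin_iff scale_right_distrib algebra_simps)

lemma cscale_cochain: "A \<in> C n \<Longrightarrow> cscale c A \<in> C n"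
  by (auto simp: cochains_def cochain_scale_def lin_iff scale_right_distrib scale_left_commute)

lemma uminus_cochain: "A \<in> C n \<Longrightarrow> - A \<in> C n"
  using cscale_cochain[of A n "-1"] by (simp add: cochain_scale_def fun_Compl_def)

lemma diff_cochain: "A \<in> C n \<Longrightarrow> B \<in> C n \<Longrightarrow> A - B \<in> C n"
  using add_cochain[of A n "- B"] uminus_cochain by simp

lemma neg_pow_cochain: "A \<in> C n \<Longrightarrow> neg_pow m A \<in> C n"
  by (simp add: neg_pow_def uminus_cochain)

lemma cochain_contract: "A \<in> C n \<Longrightarrow> contract X A \<in> C (n - 1)"
  using cochain_contract_0 zero_cochain cochain_Suc_iff[of A "n - 1"]
  by (cases n) (simp_all del: split_paired_All)

lemma cochain_eqI:
  assumes "\<And>x. A [] x = B [] x" "\<And>X. contract X A = contract X B"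
  shows "A = B"
proof (intro ext)
  fix Xs x show "A Xs x = B Xs x"
  proof (cases Xs)
    case (Cons X Ys) then show ?thesis using fun_cong[OF fun_cong[OF assms(2)[of X]], of Ys x] by simp
  qed (use assms(1) in simp)
qed

lemma rcirc_wrong_degree:
  assumes "A \<in> C p" "B \<in> C q" "length Xs = i + j" "i \<noteq> p \<or> j \<noteq> q"
  shows "rcirc scale i j A B Xs x = 0"
proof (cases "i = p")
  case False
  have "rcirc scale i j A B Xs x = rcirc scale i j 0 B Xs x"
    using cochain_length(2)[OF assms(1)] False
    by (intro rcirc_cong[OF assms(3)]) auto
  then show ?thesis by (simp add: rcirc_zero_left[OF assms(3)])
next
  case True
  have "rcirc scale i j A B Xs x = rcirc scale i j A 0 Xs x"
    using cochain_length(2)[OF assms(2)] True assms(4)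
    by (intro rcirc_cong[OF assms(3)]) auto
  then show ?thesis by (simp add: rcirc_zero_right[OF multilinear_cochain[OF assms(1)] assms(3)])
qed

lemma br_cochains:
  assumes "A \<in> C p" "B \<in> C q"
  shows "br A B Xs x = (if length Xs = p + q
    then rcirc scale p q A B Xs x - neg_pow (int (p * q)) (rcirc scale q p B A Xs x) else 0)"
proof -
  let ?n = "length Xs"
  let ?t = "if ?n = p + q then rcirc scale p q A B Xs x - neg_pow (int (p * q)) (rcirc scale q p B A Xs x) else 0"
  have "br A B Xs x = (\<Sum>i\<le>?n. if i = p then ?t else 0)"
    unfolding br_apply
  proof (intro sum.cong refl)
    fix i assume "i \<in> {..?n}"
    then have l: "?n = i + (?n - i)" "?n = (?n - i) + i" by simp_all
    show "rcirc scale i (?n - i) A B Xs x - scale ((-1) ^ (i * (?n - i))) (rcirc scale (?n - i) i B A Xs x) =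
      (if i = p then ?t else 0)"
    proof (cases "i = p \<and> ?n - i = q")
      case True
      then have "?n = p + q" using l(1) by metis
      then show ?thesis using True by (simp add: scale_neg_one_power)
    next
      case False
      then have "\<not> (i = p \<and> ?n = p + q)" by auto
      then show ?thesis
        using rcirc_wrong_degree[OF assms l(1)] rcirc_wrong_degree[OF assms(2,1) l(2)] False by auto
    qed
  qed
  then show ?thesis by auto
qed

lemma br_Nil: "br A B [] x = A [] (B [] x) - B [] (A [] x)"
  by (simp add: br_apply rcirc_Nil)

lemma br_antisym:
  assumes "A \<in> C p" "B \<in> C q"
  shows "br A B = - neg_pow (int (p * q)) (br B A)"
  by (intro ext) (simp add: br_cochains[OF assms] br_cochains[OF assms(2,1)] neg_pow_apply
      neg_pow_minus add.commute mult.commute)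

lemma br_neg_pow:
  assumes "multilinear A" "multilinear B"
  shows "br A (neg_pow n B) = neg_pow n (br A B)" "br (neg_pow n A) B = neg_pow n (br A B)"
proof -
  have "cscale (-1) A = - A" for A by (simp add: cochain_scale_def fun_Compl_def)
  then show "br A (neg_pow n B) = neg_pow n (br A B)" "br (neg_pow n A) B = neg_pow n (br A B)"
    using br_scale_left[OF assms(2), of "-1" A] br_scale_right[OF assms(1), of "-1" B]
    by (auto simp: neg_pow_def)
qed

lemma br_diff_right:
  assumes "multilinear A" "multilinear B" "multilinear B'"
  shows "br A (B - B') = br A B - br A B'"
  using br_add_right[OF assms(1), of B "- B'"] br_neg_pow(1)[OF assms(1,3), of 1]
  by (simp add: neg_pow_def)

lemma br_diff_left:
  assumes "multilinear A" "multilinear A'" "multilinear B"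
  shows "br (A - A') B = br A B - br A' B"
  using br_add_left[OF assms(3), of A "- A'"] br_neg_pow(2)[OF assms(2,3), of 1]
  by (simp add: neg_pow_def)

text \<open>Only the degree 0 component of \<open>B\<close> enters, so \<open>act B X A\<close> is zero for \<open>B\<close> of positive degree.\<close>

definition act :: "('v, 'v) cochain \<Rightarrow> 'v \<times> 'v \<Rightarrow> ('v, 'v) cochain \<Rightarrow> ('v, 'v) cochain" where
  "act B X A = contract (B [] (fst X), snd X) A + contract (fst X, B [] (snd X)) A"

lemma contract_zero_pair:
  assumes "multilinear A" shows "contract (0, v) A = 0" "contract (v, 0) A = 0"
  using multilinear_zero_slot(2,3)[OF assms, of "[]"] by (auto simp: fun_eq_iff)

lemma act_zero:
  assumes "multilinear A" "B [] = (\<lambda>_. 0)" shows "act B X A = 0"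
  by (simp add: act_def assms contract_zero_pair)

lemma act_cochain: "A \<in> C p \<Longrightarrow> act B X A \<in> C (p - 1)"
  unfolding act_def by (intro add_cochain cochain_contract)

text \<open>This recursion replaces the shuffles in all proofs about the bracket.\<close>

lemma contract_br:
  assumes A: "A \<in> C p" and B: "B \<in> C q"
  shows "contract X (br A B) =
    br A (contract X B) + neg_pow (int q) (br (contract X A) B) + act B X A - act A X B"
proof (intro ext)
  fix Xs x
  note mA = multilinear_cochain[OF A] and mB = multilinear_cochain[OF B]
  have cA: "contract X A \<in> C (p - 1)" and cB: "contract X B \<in> C (q - 1)"
    by (rule cochain_contract[OF A], rule cochain_contract[OF B])
  have zA: "contract X A = 0" if "p = 0" using that A cochain_contract_0 by simp
  have zB: "contract X B = 0" if "q = 0" using that B cochain_contract_0 by simp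
  have aB: "act B X A Xs x = (if q = 0 then A ((B [] (fst X), snd X) # Xs) x + A ((fst X, B [] (snd X)) # Xs) x else 0)"
    using fun_cong[OF fun_cong[OF act_zero[OF mA, of B X], of Xs], of x] cochain_length(2)[OF B, of "[]"]
    by (auto simp: act_def)
  have aA: "act A X B Xs x = (if p = 0 then B ((A [] (fst X), snd X) # Xs) x + B ((fst X, A [] (snd X)) # Xs) x else 0)"
    using fun_cong[OF fun_cong[OF act_zero[OF mB, of A X], of Xs], of x] cochain_length(2)[OF A, of "[]"]
    by (auto simp: act_def)
  show "contract X (br A B) Xs x =
    (br A (contract X B) + neg_pow (int q) (br (contract X A) B) + act B X A - act A X B) Xs x"
  proof (cases "p + q = Suc (length Xs)")
    case True
    \<comment> \<open>In the half \<open>B \<circ> A\<close> of the bracket, the recursion gives the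
      sign of exponent p when \<open>X\<close> goes to \<open>B\<close>, turning pq into p(q - 1),
      the exponent for \<open>br A (contract X B)\<close>. When \<open>X\<close> goes to
      \<open>A\<close> there is no new sign, and pq is q plus (p - 1)q, as required for
      \<open>br (contract X A) B\<close>.\<close>
    have "neg_pow (int (p * q)) (neg_pow (int p) v) = neg_pow (int (p * (q - 1))) v" if "q \<noteq> 0" for v :: 'v
      using that by (cases q) (auto simp: neg_pow_def)
    moreover have "neg_pow (int q) (neg_pow (int ((p - 1) * q)) v) = neg_pow (int (p * q)) v" if "p \<noteq> 0" for v :: 'v
      using that by (cases p) (auto simp: neg_pow_def)
    ultimately show ?thesis
      using True br_cochains[OF A B, of "X # Xs" x] br_cochains[OF A cB, of Xs x] br_cochains[OF cA B, of Xs x]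
        rcirc_Cons[OF True, of A B X x] rcirc_Cons[of q p Xs B A X x] aA aB
        br_zero(1)[OF mA] br_zero(2)[OF mB]
      by (cases "p = 0"; cases "q = 0")
         (simp_all add: zA zB neg_pow_apply neg_pow_plus neg_pow_minus add.commute)
  next
    case False
    have "act B X A Xs x = 0"
      unfolding aB using False cochain_length(1)[OF A] by simp
    moreover have "act A X B Xs x = 0"
      unfolding aA using False cochain_length(1)[OF B] by simp
    moreover have "br A (contract X B) Xs x = 0"
      using False br_cochains[OF A cB, of Xs x] br_zero(1)[OF mA] zB by (cases q) auto
    moreover have "br (contract X A) B Xs x = 0"
      using False br_cochains[OF cA B, of Xs x] br_zero(2)[OF mB] zA by (cases p) auto
    ultimately show ?thesis
      using False by (simp add: br_cochains[OF A B] neg_pow_apply)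
  qed
qed


lemma br_length:
  assumes "A \<in> C p" "B \<in> C q" "length Xs \<noteq> p + q" shows "br A B Xs x = 0"
  using br_cochains[OF assms(1,2)] assms(3) by simp

lemma contract_slot_add:
  assumes "multilinear A"
  shows "contract (u + u', v) A = contract (u, v) A + contract (u', v) A"
    "contract (v, u + u') A = contract (v, u) A + contract (v, u') A"
  using multilinear_add_slot(2,3)[OF assms, of "[]"] by (auto simp: fun_eq_iff)

lemma contract_slot_scale:
  assumes "multilinear A"
  shows "contract (scale c u, v) A = cscale c (contract (u, v) A)"
    "contract (v, scale c u) A = cscale c (contract (v, u) A)"
  using multilinear_scale_slot(2,3)[OF assms, of "[]"] by (auto simp: fun_eq_iff cochain_scale_def)

lemma cscale_add: "cscale c (A + B) = cscale c A + cscale c B"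
  by (simp add: cochain_scale_def scale_right_distrib fun_eq_iff)

lemma cscale_diff: "cscale c (A - B) = cscale c A - cscale c B"
  by (simp add: cochain_scale_def scale_right_diff_distrib fun_eq_iff)

lemma cscale_neg_pow: "cscale c (neg_pow n A) = neg_pow n (cscale c A)"
  by (simp add: cochain_scale_def neg_pow_def fun_eq_iff)

lemma act_slot_add:
  assumes "multilinear A" "multilinear B"
  shows "act B (u + u', v) A = act B (u, v) A + act B (u', v) A"
    "act B (v, u + u') A = act B (v, u) A + act B (v, u') A"
  by (simp_all add: act_def contract_slot_add assms multilinear_add_slot(1))

lemma act_slot_scale:
  assumes "multilinear A" "multilinear B"
  shows "act B (scale c u, v) A = cscale c (act B (u, v) A)"
    "act B (v, scale c u) A = cscale c (act B (v, u) A)"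
  by (simp_all add: act_def contract_slot_scale assms multilinear_scale_slot(1) cscale_add)

text \<open>Polarisation of \<open>contract (u + v, u + v) A = 0\<close>.\<close>

lemma contract_swap:
  assumes "A \<in> C p" shows "contract (u, v) A + contract (v, u) A = 0"
proof -
  note self = cochain_contract_self[OF assms] and m = multilinear_cochain[OF assms]
  have "contract (u + v, u + v) A = contract (u, v) A + contract (v, u) A"
    unfolding contract_slot_add[OF m] unfolding self by simp
  then show ?thesis unfolding self by (rule sym)
qed

lemma act_self: "A \<in> C p \<Longrightarrow> act B (u, u) A = 0"
  by (simp add: act_def contract_swap)

text \<open>Base case for the condition on the last pair and \<open>x\<close>, which contractions do
  not see in degree 1. \<open>B\<close> acts on \<open>A\<close> as a derivation: two of the terms
  cancel by skew-symmetry of \<open>A\<close>, the other two contain \<open>A\<close> with a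
  repeated argument.\<close>

lemma br_cochain_degree_1:
  assumes A: "A \<in> C 1" and B: "B \<in> C 0"
  shows "br A B [(x, y)] x = 0 \<and> br A B [(y, x)] x = 0"
proof -
  have l: "A [(u, v)] u = 0" "A [(v, u)] u = 0" for u v
    using cochain_last[OF A, of "[]"] by simp_all
  note mA = multilinear_cochain[OF A] and mB = multilinear_cochain[OF B]
  note add = multilinear_add_slot(1)[OF mA, of "[_]"] multilinear_add_slot(2,3)[OF mA, where Xs = "[]" and Ys = "[]", simplified]
  have swap: "A [(u, v)] w + A [(w, v)] u = 0" "A [(v, u)] w + A [(v, w)] u = 0" for u v w
    using l(1)[of "u + w" v] l(2)[of v "u + w"] by (simp_all add: add l add_ac)
  have "br A B [X] x = A [X] (B [] x) + (A [(B [] (fst X), snd X)] x + A [(fst X, B [] (snd X))] x) - B [] (A [X] x)" for X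
    using fun_cong[OF fun_cong[OF contract_br[OF A B, of X], of "[]"], of x]
      cochain_contract_0[OF B, of X] br_zero(1)[OF mA]
      fun_cong[OF fun_cong[OF act_zero[OF mB, of A X], of "[]"], of x] cochain_length(2)[OF A, of "[]"]
    by (simp add: br_Nil act_def)
  moreover have "B [] 0 = 0" using multilinear_zero_slot(1)[OF mB] .
  ultimately show ?thesis
    using swap(1)[of x y "B [] x"] swap(2)[of y x "B [] x"] by (simp add: l add_ac)
qed

lemma br_lin_Nil:
  assumes "multilinear A" "multilinear B" shows "lin (br A B [])"
proof -
  have "br A B [] = (\<lambda>x. A [] (B [] x) - B [] (A [] x))" by (simp add: br_Nil fun_eq_iff)
  then show ?thesis
    using lin_diff[OF lin_compose lin_compose, OF multilinearD(1) multilinearD(1) multilinearD(1) multilinearD(1)]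
      assms by simp
qed

text \<open>Induction on \<open>p + q\<close>: by \<open>contract_br\<close> the contractions
  consist of brackets of smaller total degree and of actions, and the conditions on the first pair
  hold term by term up to the skew-symmetry used in \<open>act_self\<close>.\<close>

lemma br_cochain:
  assumes "A \<in> C p" "B \<in> C q"
  shows "br A B \<in> C (p + q)"
  using assms
proof (induction "p + q" arbitrary: p q A B)
  case 0
  have "contract X (br A B) = 0" for X
    by (intro ext) (use br_length[OF 0(2,3)] 0(1) in simp)
  then show ?case
    using 0(1) cochain_0I br_lin_Nil[OF multilinear_cochain[OF 0(2)] multilinear_cochain[OF 0(3)]] by simp
next
  case (Suc n)
  note A = Suc.prems(1) and B = Suc.prems(2)
  note mA = multilinear_cochain[OF A] and mB = multilinear_cochain[OF B]
  note c = contract_br[OF A B]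
  have 1: "br A (contract X B) \<in> C n" for X
  proof (cases q)
    case 0
    then have "contract X B = 0" using cochain_contract_0 B by simp
    then show ?thesis using br_zero(1)[OF mA] zero_cochain by simp
  next
    case (Suc q')
    then show ?thesis using Suc.hyps(1)[OF _ A cochain_contract[OF B]] Suc.hyps(2) by simp
  qed
  have 2: "br (contract X A) B \<in> C n" for X
  proof (cases p)
    case 0
    then have "contract X A = 0" using cochain_contract_0 A by simp
    then show ?thesis using br_zero(2)[OF mB] zero_cochain by simp
  next
    case (Suc p')
    then show ?thesis using Suc.hyps(1)[OF _ cochain_contract[OF A] B] Suc.hyps(2) by simp
  qed
  have 3: "act B X A \<in> C n" for X
  proof (cases "q = 0")
    case True then show ?thesis using act_cochain[OF A, of B X] Suc.hyps(2) by (metis add_0_right diff_Suc_1)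
  next
    case False
    then have "act B X A = 0" using act_zero[OF mA] cochain_length(2)[OF B] by simp
    then show ?thesis using zero_cochain by simp
  qed
  have 4: "act A X B \<in> C n" for X
  proof (cases "p = 0")
    case True then show ?thesis using act_cochain[OF B, of A X] Suc.hyps(2) by (metis add_0 diff_Suc_1)
  next
    case False
    then have "act A X B = 0" using act_zero[OF mB] cochain_length(2)[OF A] by simp
    then show ?thesis using zero_cochain by simp
  qed
  have "br A B \<in> C (Suc n)"
    unfolding cochain_Suc_iff
  proof (intro conjI allI impI)
    show "br A B [] x = 0" for x
      using br_length[OF A B, of "[]"] Suc.hyps(2) by (metis list.size(3) nat.distinct(1))
    show "contract X (br A B) \<in> C n" for X
      unfolding c by (intro add_cochain diff_cochain neg_pow_cochain 1 2 3 4)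
    have "contract (u + u', v) (br A B) = contract (u, v) (br A B) + contract (u', v) (br A B)"
      "contract (v, u + u') (br A B) = contract (v, u) (br A B) + contract (v, u') (br A B)" for u u' v
      unfolding c contract_slot_add[OF mA] contract_slot_add[OF mB] act_slot_add[OF mA mB]
        act_slot_add[OF mB mA] br_add_right[OF mA] br_add_left[OF mB] neg_pow_plus
      by (simp_all add: algebra_simps)
    moreover have "contract (scale t u, v) (br A B) = cscale t (contract (u, v) (br A B))"
      "contract (v, scale t u) (br A B) = cscale t (contract (v, u) (br A B))" for t u v
      unfolding c contract_slot_scale[OF mA] contract_slot_scale[OF mB] act_slot_scale[OF mA mB]
        act_slot_scale[OF mB mA] br_scale_right[OF mA] br_scale_left[OF mB]
      by (simp_all add: cscale_add cscale_diff cscale_neg_pow)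
    ultimately show "lin (\<lambda>u. br A B ((u, v) # Xs) x)" "lin (\<lambda>u. br A B ((v, u) # Xs) x)" for v Xs x
      by (simp_all add: lin_iff cscale_apply flip: contract_apply)
    show "contract (u, u) (br A B) = 0" for u
      unfolding c by (simp add: cochain_contract_self[OF A] cochain_contract_self[OF B]
          br_zero mA mB act_self[OF A] act_self[OF B])
    fix x y assume "n = 0"
    then consider "p = 1" "q = 0" | "p = 0" "q = 1" using Suc.hyps(2) by fastforce
    then have "br A B [(x, y)] x = 0 \<and> br A B [(y, x)] x = 0"
    proof cases
      case 1 then show ?thesis using br_cochain_degree_1 A B by simp
    next
      case 2
      then have "br A B = - br B A" using br_antisym[OF A B] by simp
      then show ?thesis using 2 br_cochain_degree_1[of B A x y] A B by simp
    qed
    then show "br A B [(x, y)] x = 0" "br A B [(y, x)] x = 0" by blast+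
  qed
  then show ?case using Suc.hyps(2) by simp
qed

lemma act_zero_pair:
  assumes "multilinear A" "multilinear B"
  shows "act B (0, v) A = 0" "act B (v, 0) A = 0"
  using assms by (simp_all add: act_def contract_zero_pair multilinear_zero_slot(1)[of B "[]"])

lemma act_br:
  assumes "A \<in> C p" "B \<in> C q"
  shows "act D X (br A B) = br A (act D X B) + neg_pow (int q) (br (act D X A) B) +
    (act B (D [] (fst X), snd X) A + act B (fst X, D [] (snd X)) A) -
    (act A (D [] (fst X), snd X) B + act A (fst X, D [] (snd X)) B)"
  unfolding act_def[of D] contract_br[OF assms]
  using multilinear_cochain[OF assms(1)] multilinear_cochain[OF assms(2)]
  by (simp add: br_add_right br_add_left neg_pow_plus)

text \<open>On the empty list the bracket is the commutator of linear maps, and \<open>act\<close>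
  is the induced action on pairs. The terms in which \<open>B\<close> and \<open>D\<close> act on
  different entries cancel.\<close>

lemma br_act:
  assumes "multilinear A" "multilinear B" "multilinear D"
  shows "act (br B D) X A =
    (act B (D [] (fst X), snd X) A + act B (fst X, D [] (snd X)) A) -
    (act D (B [] (fst X), snd X) A + act D (fst X, B [] (snd X)) A)"
proof -
  have "contract (u - u', v) A = contract (u, v) A - contract (u', v) A"
    "contract (v, u - u') A = contract (v, u) A - contract (v, u') A" for u u' v
    using contract_slot_add(1)[OF assms(1), where u = "u - u'" and u' = u' and v = v]
      contract_slot_add(2)[OF assms(1), where u = "u - u'" and u' = u' and v = v]
    by (simp_all add: algebra_simps)
  then show ?thesis by (simp add: act_def br_Nil)
qed

text \<open>Both sides are compared on the empty list and after contraction. Two uses of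
  \<open>contract_br\<close> on each term leave brackets with one contracted argument, which the
  induction hypothesis relates (\<open>J1\<close>, \<open>J2\<close>, \<open>J3\<close>), and
  actions, which \<open>act_br\<close> and \<open>br_act\<close> match.\<close>

lemma br_jacobi:
  assumes "A \<in> C p" "B \<in> C q" "D \<in> C r"
  shows "br A (br B D) = br (br A B) D + neg_pow (int (p * q)) (br B (br A D))"
  using assms
proof (induction "p + q + r" arbitrary: p q r A B D rule: less_induct)
  case less
  note A = less.prems(1) and B = less.prems(2) and D = less.prems(3)
  note m = multilinear_cochain[OF A] multilinear_cochain[OF B] multilinear_cochain[OF D]
  note mb = multilinear_cochain[OF br_cochain[OF A B]] multilinear_cochain[OF br_cochain[OF A D]]
    multilinear_cochain[OF br_cochain[OF B D]]
  note mc = multilinear_cochain[OF br_cochain[OF cochain_contract[OF A] B]]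
    multilinear_cochain[OF br_cochain[OF cochain_contract[OF A] D]]
    multilinear_cochain[OF br_cochain[OF cochain_contract[OF B] D]]
    multilinear_cochain[OF br_cochain[OF A cochain_contract[OF B]]]
    multilinear_cochain[OF br_cochain[OF A cochain_contract[OF D]]]
    multilinear_cochain[OF br_cochain[OF B cochain_contract[OF D]]]
  note ma = multilinear_cochain[OF act_cochain[OF A]] multilinear_cochain[OF act_cochain[OF B]]
    multilinear_cochain[OF act_cochain[OF D]]
  note ops = multilinear_contract m mb mc ma
  have z: "contract X E = 0" if "E \<in> C 0" for X E using that by (rule cochain_contract_0)
  have mneg: "multilinear (neg_pow n E)" if "multilinear E" for n E
    using multilinear_cscale[OF that, of "-1"] that
    by (simp add: neg_pow_def cochain_scale_def fun_Compl_def)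
  have madd: "multilinear (E + E')" "multilinear (E - E')" if "multilinear E" "multilinear E'" for E E'
    using multilinear_add[OF that(1), of E'] multilinear_add[OF that(1), of "- E'"] mneg[OF that(2), of 1] that
    by (simp_all add: neg_pow_def)
  show ?case
  proof (rule cochain_eqI)
    fix x
    show "br A (br B D) [] x = (br (br A B) D + neg_pow (int (p * q)) (br B (br A D))) [] x"
    \<comment> \<open>If \<open>p * q\<close> is odd, both degrees are positive and
      \<open>A []\<close>, \<open>B []\<close> vanish. Otherwise the sign is + and the claim is the
      Jacobi identity for commutators of linear maps.\<close>
    proof (cases "even (p * q)")
      case True
      have d: "E [] (u - v) = E [] u - E [] v" if "multilinear E" for E u v
        using multilinear_add_slot(1)[OF that, of "[]" "u - v" v] by (simp add: algebra_simps)
      show ?thesis using True by (simp add: neg_pow_def br_Nil d m)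
    next
      case False
      then have "A [] = (\<lambda>_. 0)" "B [] = (\<lambda>_. 0)"
        using cochain_length(2)[OF A, of "[]"] cochain_length(2)[OF B, of "[]"] by auto
      then show ?thesis
        by (simp add: neg_pow_apply br_Nil multilinear_zero_slot(1)[OF m(3)])
    qed
  next
    fix X
    \<comment> \<open>Contraction lowers a degree only if it is positive, so in each of the three
      instances an argument of degree 0 is treated apart; its contraction is 0.\<close>
    have J1: "br A (br B (contract X D)) =
        br (br A B) (contract X D) + neg_pow (int p * int q) (br B (br A (contract X D)))"
    proof (cases "r = 0")
      case True
      then show ?thesis using z D by (simp add: br_zero m mb)
    next
      case False
      then show ?thesis using less.hyps[OF _ A B cochain_contract[OF D], of X] by simp
    qed
    have J2: "br A (br (contract X B) D) =
        br (br A (contract X B)) D + neg_pow (int p * (int q - 1)) (br (contract X B) (br A D))"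
    proof (cases "q = 0")
      case True
      then show ?thesis using z B by (simp add: br_zero m mb)
    next
      case False
      then show ?thesis using less.hyps[OF _ A cochain_contract[OF B] D, of X] by simp
    qed
    have J3: "br (contract X A) (br B D) =
        br (br (contract X A) B) D + neg_pow ((int p - 1) * int q) (br B (br (contract X A) D))"
    proof (cases "p = 0")
      case True
      then show ?thesis using z A by (simp add: br_zero m mb)
    next
      case False
      then show ?thesis using less.hyps[OF _ cochain_contract[OF A] B D, of X] by simp
    qed
    \<comment> \<open>\<open>act_br\<close> for \<open>br A B\<close> produces
      \<open>act D X A\<close> to the left of \<open>B\<close>, while contracting
      \<open>br B (br A D)\<close> produces it to the right; antisymmetry in degree
      \<open>p - 1\<close> brings both to one form.\<close>
    have S: "neg_pow (int q) (br (act D X A) B) = - neg_pow (int p * int q) (br B (act D X A))"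
    proof (cases p)
      case 0
      then have "act D X A = 0" using A z by (simp add: act_def)
      then show ?thesis by (simp add: br_zero m)
    next
      case (Suc p')
      then show ?thesis using br_antisym[OF act_cochain[OF A, of D X] B]
        by (auto simp: neg_pow_def)
    qed
    have ZA: "A [] = (\<lambda>_. 0)" if "p \<noteq> 0"
      using cochain_length(2)[OF A, of "[]"] that by simp
    have ZB: "B [] = (\<lambda>_. 0)" if "q \<noteq> 0"
      using cochain_length(2)[OF B, of "[]"] that by simp
    have L: "contract X (br A (br B D)) = br A (br B (contract X D)) +
        neg_pow (int r) (br A (br (contract X B) D)) + br A (act D X B) - br A (act B X D) +
        neg_pow (int q + int r) (br (contract X A) (br B D)) + act (br B D) X A - act A X (br B D)"
      unfolding contract_br[OF A br_cochain[OF B D]] contract_br[OF B D]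
      by (simp add: br_add_right br_diff_right br_neg_pow ops madd mneg algebra_simps)
    have R1: "contract X (br (br A B) D) = br (br A B) (contract X D) +
        neg_pow (int r) (br (br A (contract X B)) D + neg_pow (int q) (br (br (contract X A) B) D) +
          br (act B X A) D - br (act A X B) D) + act D X (br A B) - act (br A B) X D"
      unfolding contract_br[OF br_cochain[OF A B] D] contract_br[OF A B]
      by (simp add: br_add_left br_diff_left br_neg_pow ops madd mneg)
    have R2: "contract X (br B (br A D)) = br B (br A (contract X D)) +
        neg_pow (int r) (br B (br (contract X A) D)) + br B (act D X A) - br B (act A X D) +
        neg_pow (int p + int r) (br (contract X B) (br A D)) + act (br A D) X B - act B X (br A D)"
      unfolding contract_br[OF B br_cochain[OF A D]] contract_br[OF A D]
      by (simp add: br_add_right br_diff_right br_neg_pow ops madd mneg algebra_simps)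
    have "contract X (br A (br B D)) =
      contract X (br (br A B) D) + neg_pow (int p * int q) (contract X (br B (br A D)))"
    \<comment> \<open>The actions of \<open>A\<close> and of \<open>B\<close> survive only for a
      cochain of degree 0, so the four cases differ in the correction terms that remain.\<close>
    proof (cases "p = 0"; cases "q = 0")
      assume pq: "p = 0" "q = 0"
      show ?thesis
        unfolding L R1 R2 J1 J2 J3 act_br[OF A B] act_br[OF A D] act_br[OF B D] br_act[OF m]
          br_act[OF m(2,1,3)] br_act[OF m(3,1,2)]
        using S pq by (simp add: neg_pow_def algebra_simps)
    next
      assume pq: "p = 0" "q \<noteq> 0"
      note zero = ZB[OF pq(2)]
      show ?thesis
        unfolding L R1 R2 J1 J2 J3 act_br[OF A B] act_br[OF A D] act_br[OF B D] br_act[OF m]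
          br_act[OF m(2,1,3)] br_act[OF m(3,1,2)]
        using S pq(1) by (cases "even q"; simp add: zero act_zero act_zero_pair ops br_zero neg_pow_def algebra_simps)
    next
      assume pq: "p \<noteq> 0" "q = 0"
      note zero = ZA[OF pq(1)]
      show ?thesis
        unfolding L R1 R2 J1 J2 J3 act_br[OF A B] act_br[OF A D] act_br[OF B D] br_act[OF m]
          br_act[OF m(2,1,3)] br_act[OF m(3,1,2)]
        using S pq(2) by (cases "even p"; simp add: zero act_zero act_zero_pair ops br_zero neg_pow_def algebra_simps)
    next
      assume pq: "p \<noteq> 0" "q \<noteq> 0"
      note zero = ZA[OF pq(1)] ZB[OF pq(2)]
      show ?thesis
        unfolding L R1 R2 J1 J2 J3 act_br[OF A B] act_br[OF A D] act_br[OF B D] br_act[OF m]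
          br_act[OF m(2,1,3)] br_act[OF m(3,1,2)]
        using S by (cases "even p"; cases "even q"; simp add: zero act_zero act_zero_pair ops br_zero neg_pow_def algebra_simps)
    qed
    then show "contract X (br A (br B D)) =
        contract X (br (br A B) D + neg_pow (int (p * q)) (br B (br A D)))"
      by simp
  qed
qed

end

section \<open>L-infinity algebras from cubic elements\<close>

text \<open>Division by 2, available in characteristic 0.\<close>

lemma double_eq_0:
  fixes scale :: "'k::field_char_0 \<Rightarrow> 'v::ab_group_add \<Rightarrow> 'v"
  and v :: 'v
  assumes "vector_space scale" "v + v = 0" shows "v = 0"
proof -
  interpret vector_space scale by fact
  show ?thesis using scale_left_distrib[of 1 1 v] assms(2) by simp
qed

lemma koszul_sign_cong:
  assumes "\<sigma> permutes {..<n}" "\<And>i. i < n \<Longrightarrow> d i = d' i"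
  shows "koszul_sign n d \<sigma> = koszul_sign n d' \<sigma>"
proof -
  have "\<sigma> i < n" if "i < n" for i using permutes_in_image[OF assms(1), of i] that by simp
  then show ?thesis unfolding koszul_sign_def using assms(2) by (intro prod.cong) auto
qed

lemma koszul_sign_id: "koszul_sign n d id = 1"
  by (auto simp: koszul_sign_def intro!: prod.neutral)

lemma koszul_sign_3:
  "koszul_sign 3 d \<sigma> = (\<Prod>(i, j)\<in>{(0, 1), (0, 2), (1, 2)}.
    if \<sigma> i > \<sigma> j then (-1) powi (d (\<sigma> i) * d (\<sigma> j)) else 1)"
proof -
  have "{(i, j). i < j \<and> j < 3 \<and> \<sigma> i > \<sigma> j} =
      {p \<in> {(0, 1), (0, 2), (1, 2)}. \<sigma> (fst p) > \<sigma> (snd p)}"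
    by (auto simp: less_Suc_eq numeral_3_eq_3)
  then show ?thesis
    unfolding koszul_sign_def by (simp only: prod.inter_filter finite.intros case_prod_unfold)
qed

context graded_lie_algebra
begin

lemma grade_total: "a \<in> L i \<Longrightarrow> a \<in> total"
  unfolding total_def by (rule span_base) blast

lemma subspace_total: "subspace total"
  unfolding total_def by (rule subspace_span)

lemma zero_total [simp]: "0 \<in> total"
  by (rule subspace_0[OF subspace_total])

lemma br_0_left [simp]: "b \<in> total \<Longrightarrow> br 0 b = 0"
  using br_scale_left[of 0 b 0] by simp

lemma br_0_right [simp]: "a \<in> total \<Longrightarrow> br a 0 = 0"
  using br_scale_right[of a 0 0] by simp

lemma br_total:
  assumes "a \<in> total" "b \<in> total" shows "br a b \<in> total"
proof -
  note in_total = subspace_add[OF subspace_total] subspace_scale[OF subspace_total]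
  have *: "total \<subseteq> S" if "subspace S" "\<And>i. L i \<subseteq> S" for S
    unfolding total_def by (rule span_minimal) (use that in blast)+
  \<comment> \<open>Span minimality is applied twice: in the right argument for a homogeneous left
    one, then in the left argument.\<close>
  have "total \<subseteq> {y \<in> total. br x y \<in> total}" if x: "x \<in> L i" for x i
    using grade_total[OF x] grade_total[OF br_grade[OF x]] grade_total in_total
    by (intro *) (auto simp: subspace_def br_add_right br_scale_right)
  then have "total \<subseteq> {x \<in> total. br x b \<in> total}"
    using assms(2) grade_total in_total
    by (intro *) (auto simp: subspace_def br_add_left br_scale_left)
  then show ?thesis using assms(1) by blast
qed

lemma br_uminus_left: "a \<in> total \<Longrightarrow> b \<in> total \<Longrightarrow> br (- a) b = - br a b"
  using br_scale_left[of a b "-1"] by simp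

lemma neg_pow_grade: "a \<in> L i \<Longrightarrow> neg_pow n a \<in> L i"
  using subspace_neg[OF subspace_grade] by (simp add: neg_pow_def)

lemma br_flip: "a \<in> L p \<Longrightarrow> b \<in> L q \<Longrightarrow> br a b = - neg_pow (p * q) (br b a)"
  using br_antisym[of a p b q] by (simp add: scale_neg_one_powi)

text \<open>The Jacobi identity read as a rule for the right bracket with \<open>x\<close>, the form
  that \<open>nest\<close> calls for; \<open>x\<close> passes \<open>v\<close> in order to reach
  \<open>u\<close>.\<close>

lemma br_br:
  assumes "u \<in> L i" "v \<in> L j" "x \<in> L k"
  shows "br (br u v) x = br u (br v x) + neg_pow (j * k) (br (br u x) v)"
proof -
  have "br v (br u x) = - neg_pow (j * (i + k)) (br (br u x) v)"
    by (rule br_flip[OF assms(2) br_grade[OF assms(1,3)]])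
  then show ?thesis
    using br_jacobi[OF assms]
    by (cases "even i"; cases "even j"; cases "even k")
       (simp_all add: scale_neg_one_powi neg_pow_def algebra_simps)
qed

text \<open>Vectors are paired with a degree because they do not determine it: 0 lies in every
  degree. Koszul signs are then read off the list.\<close>

definition nest :: "'v \<Rightarrow> (int \<times> 'v) list \<Rightarrow> 'v" where
  "nest u xs = foldl br u (map snd xs)"

lemma nest_simps [simp]: "nest u [] = u" "nest u (x # xs) = nest (br u (snd x)) xs"
  by (simp_all add: nest_def)

definition homogeneous :: "(int \<Rightarrow> 'v set) \<Rightarrow> (int \<times> 'v) list \<Rightarrow> bool" where
  "homogeneous F xs \<longleftrightarrow> (\<forall>(d, x)\<in>set xs. x \<in> F d)"

lemma homogeneous_simps [simp]: "homogeneous F []"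
  "homogeneous F (x # xs) \<longleftrightarrow> snd x \<in> F (fst x) \<and> homogeneous F xs"
  by (auto simp: homogeneous_def)

lemma homogeneous_subset: "homogeneous F xs \<Longrightarrow> set ys \<subseteq> set xs \<Longrightarrow> homogeneous F ys"
  by (auto simp: homogeneous_def)

abbreviation "deg xs \<equiv> sum_list (map fst xs)"

lemma nest_grade:
  "u \<in> L i \<Longrightarrow> homogeneous L xs \<Longrightarrow> nest u xs \<in> L (i + deg xs)"
proof (induction xs arbitrary: u i)
  case (Cons x xs)
  then show ?case using Cons.IH[of "br u (snd x)" "i + fst x"] br_grade by (simp add: algebra_simps)
qed simp

lemma nest_total: "u \<in> total \<Longrightarrow> homogeneous L xs \<Longrightarrow> nest u xs \<in> total"
  by (induction xs arbitrary: u) (auto simp: br_total grade_total)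

lemma nest_add:
  "u \<in> total \<Longrightarrow> v \<in> total \<Longrightarrow> homogeneous L xs \<Longrightarrow> nest (u + v) xs = nest u xs + nest v xs"
  by (induction xs arbitrary: u v) (auto simp: br_total grade_total br_add_left)

lemma nest_uminus:
  "u \<in> total \<Longrightarrow> homogeneous L xs \<Longrightarrow> nest (- u) xs = - nest u xs"
  by (induction xs arbitrary: u) (auto simp: br_total grade_total br_uminus_left)

lemma nest_neg_pow:
  "u \<in> total \<Longrightarrow> homogeneous L xs \<Longrightarrow> nest (neg_pow n u) xs = neg_pow n (nest u xs)"
  by (simp add: neg_pow_def nest_uminus)

lemma nest_0: "homogeneous L xs \<Longrightarrow> nest 0 xs = 0"
  by (induction xs) (auto simp: grade_total)

text \<open>Each bracket with an element of the list acts as a graded derivation.\<close>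

lemma nest_br:
  assumes "u \<in> L i" "v \<in> L j" "homogeneous L xs"
  shows "nest (br u v) xs =
    koszul_sum fst (\<lambda>a b. neg_pow (j * deg a) (br (nest u a) (nest v b))) xs"
  using assms
proof (induction xs arbitrary: u v i j)
  case Nil then show ?case by simp
next
  case (Cons x xs)
  let ?d = "fst x" and ?x = "snd x"
  have x: "?x \<in> L ?d" and xs: "homogeneous L xs" using Cons.prems by simp_all
  note u = Cons.prems(1) and v = Cons.prems(2)
  have "nest (br u v) (x # xs) = nest (br u (br v ?x) + neg_pow (j * ?d) (br (br u ?x) v)) xs"
    by (simp add: br_br[OF u v x])
  also have "\<dots> = nest (br u (br v ?x)) xs + neg_pow (j * ?d) (nest (br (br u ?x) v) xs)"
    using u v x xs
    by (subst nest_add) (auto simp: nest_neg_pow grade_total br_total intro!: grade_total[OF neg_pow_grade] br_grade)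
  also have "nest (br u (br v ?x)) xs =
      koszul_sum fst (\<lambda>a b. neg_pow (?d * deg a) (neg_pow (j * deg a) (br (nest u a) (nest v (x # b))))) xs"
    unfolding Cons.IH[OF u br_grade[OF v x] xs] by (simp add: neg_pow_add[symmetric] algebra_simps)
  also have "neg_pow (j * ?d) (nest (br (br u ?x) v) xs) =
      koszul_sum fst (\<lambda>a b. neg_pow (j * deg (x # a)) (br (nest u (x # a)) (nest v b))) xs"
    unfolding Cons.IH[OF br_grade[OF u x] v xs] koszul_sum_neg_pow[symmetric]
    by (simp add: neg_pow_add[symmetric] algebra_simps)
  finally show ?case by (simp add: add.commute)
qed

end

text \<open>The input of the L-infinity structure, freed from cochains. The closure assumptions
  \<open>l1_F\<close> and \<open>l3_F\<close> replace the projection in the derived brackets, and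
  the equation for the square of \<open>\<Delta>\<close> is split into its three components.\<close>

locale l3_data = graded_lie_algebra scale L br
  for scale :: "'k::field_char_0 \<Rightarrow> 'v::ab_group_add \<Rightarrow> 'v" and L :: "int \<Rightarrow> 'v set"
    and br :: "'v \<Rightarrow> 'v \<Rightarrow> 'v" +
  fixes F :: "int \<Rightarrow> 'v set" and \<pi> \<mu> :: 'v
  assumes F_subalgebra: "graded_lie_subalgebra F"
    and F_abelian: "\<lbrakk>a \<in> F i; b \<in> F j\<rbrakk> \<Longrightarrow> br a b = 0"
    and grade_\<pi>: "\<pi> \<in> L 1" and grade_\<mu>: "\<mu> \<in> L 1"
    and \<pi>_\<pi>: "br \<pi> \<pi> = 0" and \<pi>_\<mu>: "br \<pi> \<mu> = 0" and \<mu>_\<mu>: "br \<mu> \<mu> = 0"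
    and l1_F: "a \<in> F i \<Longrightarrow> br \<pi> a \<in> F (i + 1)"
    and l3_F: "\<lbrakk>a \<in> F i; b \<in> F j; c \<in> F k\<rbrakk> \<Longrightarrow> br (br (br \<mu> a) b) c \<in> F (i + j + k + 1)"
begin

lemma F_L: "a \<in> F i \<Longrightarrow> a \<in> L i"
  using F_subalgebra by (auto simp: graded_lie_subalgebra_def)

lemma subspace_F: "subspace (F i)"
  using F_subalgebra by (auto simp: graded_lie_subalgebra_def)

lemma homogeneous_L: "homogeneous F xs \<Longrightarrow> homogeneous L xs"
  by (auto simp: homogeneous_def dest: F_L)

sublocale F: graded_vector_space scale F
proof
  show "subspace (F i)" for i by (rule subspace_F)
next
  fix I v i assume "finite I" "\<And>i. i \<in> I \<Longrightarrow> v i \<in> F i" "sum v I = 0" "i \<in> I"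
  then show "v i = 0" using direct[of I v i] F_L by blast
qed

lemma F_total: "F.total \<subseteq> total"
  unfolding total_def F.total_def by (intro span_mono) (use F_L in blast)

definition l :: "'v list \<Rightarrow> 'v" where
  "l as = (case as of
      [a\<^sub>1] \<Rightarrow> br \<pi> a\<^sub>1
    | [a\<^sub>1, a\<^sub>2] \<Rightarrow> 0
    | [a\<^sub>1, a\<^sub>2, a\<^sub>3] \<Rightarrow> br (br (br \<mu> a\<^sub>1) a\<^sub>2) a\<^sub>3
    | _ \<Rightarrow> 0)"

lemma l_simps [simp]: "l [] = 0" "l [a] = br \<pi> a" "l [a, b] = 0"
  "l [a, b, c] = br (br (br \<mu> a) b) c" "l (a # b # c # e # xs) = 0"
  by (simp_all add: l_def)

lemma l_zero: "length xs \<noteq> 1 \<Longrightarrow> length xs \<noteq> 3 \<Longrightarrow> l xs = 0"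
  by (auto simp: l_def split: list.splits)

lemma length_1E: assumes "length xs = 1" obtains a where "xs = [a]"
  using assms by (auto simp: length_Suc_conv)

lemma length_3E: assumes "length xs = 3" obtains a b c where "xs = [a, b, c]"
  using assms by (auto simp: length_Suc_conv numeral_3_eq_3)

text \<open>As \<open>br x y = 0\<close>, the Jacobi identity reduces to an exchange of
  \<open>x\<close> and \<open>y\<close>. This is the source of the graded symmetry of
  \<open>l\<close>.\<close>

lemma br_swap:
  assumes "u \<in> L i" "x \<in> F j" "y \<in> F k"
  shows "br (br u x) y = neg_pow (j * k) (br (br u y) x)"
  using br_br[OF assms(1) F_L[OF assms(2)] F_L[OF assms(3)]] F_abelian[OF assms(2,3)]
    grade_total[OF assms(1)] by simp

lemma br_nest_swap:
  assumes "u \<in> L i" "f \<in> F k" "homogeneous F xs"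
  shows "br (nest u xs) f = neg_pow (k * deg xs) (nest (br u f) xs)"
  using assms
proof (induction xs arbitrary: u i)
  case (Cons x xs)
  have x: "snd x \<in> F (fst x)" and xs: "homogeneous F xs" using Cons.prems by simp_all
  have "br (br u f) (snd x) \<in> total"
    by (intro br_total grade_total[OF Cons.prems(1)] grade_total[OF F_L[OF x]]
        grade_total[OF F_L[OF Cons.prems(2)]])
  then show ?case
    using Cons.IH[OF br_grade[OF Cons.prems(1) F_L[OF x]] assms(2) xs]
      br_swap[OF Cons.prems(1) x assms(2)] homogeneous_L[OF xs]
    by (simp add: nest_neg_pow neg_pow_add[symmetric] algebra_simps)
qed simp

lemma nest_\<mu>_3: "length a = 3 \<Longrightarrow> nest \<mu> a = l (map snd a)"
  by (elim length_3E) simp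

lemma nest_\<pi>_1: "length a = 1 \<Longrightarrow> nest \<pi> a = l (map snd a)"
  by (elim length_1E) simp

lemma l_grade:
  assumes "homogeneous F a" shows "l (map snd a) \<in> F (deg a + 1)"
proof -
  consider "length a = 1" | "length a = 3" | "length a \<noteq> 1" "length a \<noteq> 3" by blast
  then show ?thesis
  proof cases
    case 1 then show ?thesis using assms by (elim length_1E) (simp add: l1_F)
  next
    case 2
    then obtain x y z where a: "a = [x, y, z]" by (elim length_3E)
    then show ?thesis using assms l3_F[of "snd x" "fst x" "snd y" "fst y" "snd z" "fst z"]
      by (simp add: add.assoc)
  next
    case 3 then show ?thesis using l_zero[of "map snd a"] subspace_0[OF subspace_F] by simp
  qed
qed

text \<open>One bracket with \<open>\<pi>\<close> already lands in the abelian \<open>F\<close>, so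
  the next one gives 0.\<close>

lemma nest_\<pi>_zero:
  assumes "homogeneous F a" "length a > 1" shows "nest \<pi> a = 0"
proof -
  obtain x y b where a: "a = x # y # b" using assms(2) by (cases a; cases "tl a") auto
  then have "br (br \<pi> (snd x)) (snd y) = 0" using assms(1) by (auto intro: F_abelian l1_F)
  then show ?thesis using assms(1) homogeneous_L[of b] nest_0 by (simp add: a)
qed

lemma nest_\<mu>_zero:
  assumes "homogeneous F a" "length a > 3" shows "nest \<mu> a = 0"
proof -
  have "length (take 3 a) = 3" "length (drop 3 a) > 0" using assms(2) by simp_all
  then obtain x y z w b where "take 3 a = [x, y, z]" "drop 3 a = w # b"
    by (metis length_3E length_greater_0_conv list.exhaust)
  then have a: "a = x # y # z # w # b" by (metis append_Cons append_Nil append_take_drop_id)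
  then have "br (br (br (br \<mu> (snd x)) (snd y)) (snd z)) (snd w) = 0"
    using assms(1) by (auto intro: F_abelian l3_F)
  then show ?thesis using assms(1) homogeneous_L[of b] nest_0 by (simp add: a)
qed

text \<open>Translates between the two expansions: in \<open>nest_br\<close> the element
  \<open>l (map snd a)\<close> of \<open>F\<close> stands on one side of
  \<open>nest \<mu> b\<close>, whereas in the L-infinity relation it is the first argument of the
  outer operation. Its degree is \<open>deg a + 1\<close>; the shift by 1 absorbs the signs on the
  left-hand sides.\<close>

lemma br_l_nest:
  assumes "homogeneous F a" "homogeneous F b"
  shows "neg_pow (deg a) (br (l (map snd a)) (nest \<mu> b)) = nest (br \<mu> (l (map snd a))) b"
    "neg_pow (deg b) (br (nest \<mu> b) (l (map snd a))) =
       neg_pow (deg a * deg b) (nest (br \<mu> (l (map snd a))) b)"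
proof -
  note l = l_grade[OF assms(1)]
  have *: "br (nest \<mu> b) (l (map snd a)) = neg_pow ((deg a + 1) * deg b) (nest (br \<mu> (l (map snd a))) b)"
    by (rule br_nest_swap[OF grade_\<mu> l assms(2)])
  have "br (l (map snd a)) (nest \<mu> b) = - neg_pow ((deg a + 1) * (1 + deg b)) (br (nest \<mu> b) (l (map snd a)))"
    by (rule br_flip[OF F_L[OF l] nest_grade[OF grade_\<mu> homogeneous_L[OF assms(2)]]])
  then show "neg_pow (deg a) (br (l (map snd a)) (nest \<mu> b)) = nest (br \<mu> (l (map snd a))) b"
    unfolding * by (auto simp: neg_pow_def)
  show "neg_pow (deg b) (br (nest \<mu> b) (l (map snd a))) =
       neg_pow (deg a * deg b) (nest (br \<mu> (l (map snd a))) b)"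
    unfolding * by (auto simp: neg_pow_def)
qed

section \<open>The L-infinity relations by arity\<close>

abbreviation "ll a b \<equiv> l (l (map snd a) # map snd b)"

abbreviation "jacobiator i xs \<equiv> koszul_sum fst (\<lambda>a b. if length a = i then ll a b else 0) xs"

text \<open>A contribution needs the inner arity \<open>i\<close> and the outer arity
  \<open>length xs - i + 1\<close> both to be 1 or 3.\<close>

lemma jacobiator_zero:
  assumes "homogeneous F xs" "i \<noteq> 1 \<and> i \<noteq> 3 \<or> length xs \<noteq> i \<and> length xs \<noteq> i + 2"
  shows "jacobiator i xs = 0"
proof -
  have "jacobiator i xs = koszul_sum fst (\<lambda>_ _. 0) xs"
  proof (rule koszul_sum_cong)
    fix a b assume len: "length a + length b = length xs" and sub: "set a \<subseteq> set xs" "set b \<subseteq> set xs"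
    show "(if length a = i then ll a b else 0) = 0"
    proof (cases "length a = i")
      case True
      show ?thesis
      proof (cases "i \<noteq> 1 \<and> i \<noteq> 3")
        case True
        then have "l (map snd a) = 0" if "length a = i" using that l_zero[of "map snd a"] by simp
        moreover have "l (0 # map snd b) = 0"
        proof (cases "length b = 0 \<or> length b = 2")
          case True
          then have "l (0 # map snd b) = 0 \<or> l (0 # map snd b) = nest 0 b"
            using grade_total[OF grade_\<pi>] grade_total[OF grade_\<mu>]
            by (auto simp: length_Suc_conv numeral_2_eq_2)
          then show ?thesis
            using nest_0[OF homogeneous_L[OF homogeneous_subset[OF assms(1) sub(2)]]] by auto
        next
          case False then show ?thesis by (intro l_zero) auto
        qed
        ultimately show ?thesis by simp
      next
        case False
        then show ?thesis using assms(2) len True by (auto intro!: l_zero)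
      qed
    qed simp
  qed
  then show ?thesis by simp
qed

text \<open>Bracketing \<open>br \<pi> \<pi> = 0\<close> with the single entry gives twice the
  claim.\<close>

lemma jacobiator_1:
  assumes "homogeneous F xs" "length xs = 1" shows "jacobiator 1 xs = 0"
proof -
  obtain x where xs: "xs = [x]" using assms(2) by (elim length_1E)
  have x: "snd x \<in> L (fst x)" using assms(1) xs F_L by simp
  have "br (br \<pi> (snd x)) \<pi> = - neg_pow ((1 + fst x) * 1) (br \<pi> (br \<pi> (snd x)))"
    by (rule br_flip[OF br_grade[OF grade_\<pi> x] grade_\<pi>])
  then have "br \<pi> (br \<pi> (snd x)) + br \<pi> (br \<pi> (snd x)) = 0"
    using br_br[OF grade_\<pi> grade_\<pi> x] grade_total[OF x]
    by (cases "even (fst x)") (simp_all add: \<pi>_\<pi> neg_pow_def)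
  then have "br \<pi> (br \<pi> (snd x)) = 0" by (rule double_eq_0[OF vector_space_axioms])
  then show ?thesis by (simp add: xs)
qed

text \<open>Expansion of \<open>nest (br \<pi> \<mu>) xs = 0\<close>: with all three entries in
  \<open>b\<close> the unary operation is applied to the ternary one, with one entry in
  \<open>a\<close> it is the reverse, and the other splittings vanish.\<close>

lemma jacobiator_3:
  assumes "homogeneous F xs" "length xs = 3" shows "jacobiator 1 xs + jacobiator 3 xs = 0"
proof -
  let ?K = "koszul_sum fst"
  \<comment> \<open>The blocks are exchanged so that the three inputs of the inner operation come to
    stand in \<open>b\<close>, next to \<open>\<mu>\<close>.\<close>
  have "jacobiator 3 xs = ?K (\<lambda>a b. neg_pow (deg a * deg b) (if length b = 3 then ll b a else 0)) xs"
    by (rule koszul_sum_commute)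
  also have "\<dots> = ?K (\<lambda>a b. if length a = 0 then neg_pow (deg a) (br (nest \<pi> a) (nest \<mu> b)) else 0) xs"
    using assms(2) by (intro koszul_sum_cong) (auto simp: nest_\<mu>_3)
  finally have "jacobiator 1 xs + jacobiator 3 xs =
    ?K (\<lambda>a b. (if length a = 1 then ll a b else 0) +
      (if length a = 0 then neg_pow (deg a) (br (nest \<pi> a) (nest \<mu> b)) else 0)) xs"
    by (simp add: koszul_sum_add)
  also have "\<dots> = ?K (\<lambda>a b. neg_pow (1 * deg a) (br (nest \<pi> a) (nest \<mu> b))) xs"
  proof (rule koszul_sum_cong)
    fix a b assume len: "length a + length b = length xs" and sub: "set a \<subseteq> set xs" "set b \<subseteq> set xs"
    note ab = homogeneous_subset[OF assms(1) sub(1)] homogeneous_subset[OF assms(1) sub(2)]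
    consider "length a = 0" | "length a = 1" "length b = 2" | "length a > 1" using len assms(2) by linarith
    then show "(if length a = 1 then ll a b else 0) +
      (if length a = 0 then neg_pow (deg a) (br (nest \<pi> a) (nest \<mu> b)) else 0) =
      neg_pow (1 * deg a) (br (nest \<pi> a) (nest \<mu> b))"
    proof cases
      case 2
      then have "ll a b = nest (br \<mu> (l (map snd a))) b"
        by (auto simp: length_Suc_conv numeral_2_eq_2)
      then show ?thesis using br_l_nest(1)[OF ab] 2 by (simp add: nest_\<pi>_1)
    next
      case 3
      then have "a \<noteq> []" by auto
      then show ?thesis
        using 3 nest_\<pi>_zero[OF ab(1)] nest_total[OF grade_total[OF grade_\<mu>] homogeneous_L[OF ab(2)]] by simp
    qed simp
  qed
  also have "\<dots> = nest (br \<pi> \<mu>) xs"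
    by (rule nest_br[OF grade_\<pi> grade_\<mu> homogeneous_L[OF assms(1)], symmetric])
  finally show ?thesis using nest_0[OF homogeneous_L[OF assms(1)]] by (simp add: \<pi>_\<mu>)
qed

text \<open>In the expansion of \<open>nest (br \<mu> \<mu>) xs = 0\<close> the splittings 3 + 2 and
  2 + 3 each contribute the whole relation, so it appears twice; more than three entries on one side
  give 0.\<close>

lemma jacobiator_5:
  assumes "homogeneous F xs" "length xs = 5" shows "jacobiator 3 xs = 0"
proof (rule double_eq_0[OF vector_space_axioms])
  let ?K = "koszul_sum fst"
  have "jacobiator 3 xs + jacobiator 3 xs = jacobiator 3 xs +
      ?K (\<lambda>a b. neg_pow (deg a * deg b) (if length b = 3 then ll b a else 0)) xs"
    using koszul_sum_commute[of fst "\<lambda>a b. if length a = 3 then ll a b else 0" xs] by simp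
  also have "\<dots> = ?K (\<lambda>a b. (if length a = 3 then ll a b else 0) +
      neg_pow (deg a * deg b) (if length b = 3 then ll b a else 0)) xs"
    by (simp add: koszul_sum_add)
  also have "\<dots> = ?K (\<lambda>a b. neg_pow (1 * deg a) (br (nest \<mu> a) (nest \<mu> b))) xs"
  proof (rule koszul_sum_cong)
    fix a b assume len: "length a + length b = length xs" and sub: "set a \<subseteq> set xs" "set b \<subseteq> set xs"
    note ab = homogeneous_subset[OF assms(1) sub(1)] homogeneous_subset[OF assms(1) sub(2)]
    have ll: "ll a b = nest (br \<mu> (l (map snd a))) b" if "length b = 2" for a b
      using that by (auto simp: length_Suc_conv numeral_2_eq_2)
    have t: "nest \<mu> a \<in> total" "nest \<mu> b \<in> total"
      using nest_total[OF grade_total[OF grade_\<mu>] homogeneous_L] ab by simp_all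
    consider "length a = 3" "length b = 2" | "length a = 2" "length b = 3" | "length a > 3" "length b \<noteq> 3" | "length b > 3" "length a \<noteq> 3"
      using len assms(2) by linarith
    then show "(if length a = 3 then ll a b else 0) +
      neg_pow (deg a * deg b) (if length b = 3 then ll b a else 0) =
      neg_pow (1 * deg a) (br (nest \<mu> a) (nest \<mu> b))"
    proof cases
      case 1 then show ?thesis using br_l_nest(1)[OF ab] by (simp add: ll nest_\<mu>_3)
    next
      case 2 then show ?thesis using br_l_nest(2)[OF ab(2,1)] by (simp add: ll nest_\<mu>_3 mult.commute)
    next
      case 3 then show ?thesis using nest_\<mu>_zero[OF ab(1)] t by simp
    next
      case 4 then show ?thesis using nest_\<mu>_zero[OF ab(2)] t by simp
    qed
  qed
  also have "\<dots> = nest (br \<mu> \<mu>) xs"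
    by (rule nest_br[OF grade_\<mu> grade_\<mu> homogeneous_L[OF assms(1)], symmetric])
  finally show "jacobiator 3 xs + jacobiator 3 xs = 0"
    using nest_0[OF homogeneous_L[OF assms(1)]] by (simp add: \<mu>_\<mu>)
qed

text \<open>Two operations of arity 1 or 3 compose to arity 1, 3 or 5.\<close>

lemma sum_jacobiator:
  assumes "homogeneous F xs" "xs \<noteq> []" shows "(\<Sum>i=1..length xs. jacobiator i xs) = 0"
proof -
  consider "length xs = 1" | "length xs = 3" | "length xs = 5" | "length xs \<notin> {1, 3, 5}" by blast
  then show ?thesis
  proof cases
    case 1 then show ?thesis using jacobiator_1 assms by simp
  next
    case 2
    have "{1..3::nat} = {1, 2, 3}" by auto
    then show ?thesis using 2 jacobiator_3[OF assms(1) 2] jacobiator_zero[OF assms(1), of 2] by simp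
  next
    case 3
    have "{1..5::nat} = {1, 2, 3, 4, 5}" by auto
    then show ?thesis using 3 jacobiator_5[OF assms(1) 3] jacobiator_zero[OF assms(1)] by simp
  next
    case 4
    then have "jacobiator i xs = 0" for i using assms(1) by (intro jacobiator_zero) auto
    then show ?thesis by simp
  qed
qed

lemma l3_symmetric:
  assumes "\<And>i. i < 3 \<Longrightarrow> xs ! i \<in> F (d i)" "\<sigma> permutes {..<3}" "length xs = 3"
  shows "l (permute_list \<sigma> xs) = scale (koszul_sign 3 d \<sigma>) (l xs)"
proof -
  obtain a b c where xs: "xs = [a, b, c]" using assms(3) by (elim length_3E)
  let ?t = "\<lambda>a b c. br (br (br \<mu> a) b) c"
  have abc: "a \<in> F (d 0)" "b \<in> F (d 1)" "c \<in> F (d 2)"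
    using assms(1)[of 0] assms(1)[of 1] assms(1)[of 2] by (simp_all add: xs)
  \<comment> \<open>Exchange of neighbours in the first two and in the last two places; all six
    permutations are products of these.\<close>
  have s12: "?t x y z = neg_pow (i * j) (?t y x z)" if "x \<in> F i" "y \<in> F j" "z \<in> F k" for x y z i j k
    using br_swap[OF grade_\<mu> that(1,2)] that grade_total[OF F_L] grade_total[OF grade_\<mu>]
    by (auto simp: neg_pow_def br_uminus_left br_total)
  have s23: "?t x y z = neg_pow (j * k) (?t x z y)" if "x \<in> F i" "y \<in> F j" "z \<in> F k" for x y z i j k
    by (rule br_swap[OF br_grade[OF grade_\<mu> F_L[OF that(1)]] that(2,3)])
  have bac: "?t b a c = neg_pow (d 1 * d 0) (?t a b c)" using s12 abc by blast
  have acb: "?t a c b = neg_pow (d 2 * d 1) (?t a b c)" using s23 abc by blast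
  have bca: "?t b c a = neg_pow (d 2 * d 0) (?t b a c)" using s23 abc by blast
  have cab: "?t c a b = neg_pow (d 2 * d 0) (?t a c b)" using s12 abc by blast
  have cba: "?t c b a = neg_pow (d 2 * d 1) (?t b c a)" using s12 abc by blast
  have lt: "\<sigma> i < 3" if "i < 3" for i using permutes_in_image[OF assms(2), of i] that by simp
  have "\<sigma> 0 < 3" "\<sigma> 1 < 3" "\<sigma> 2 < 3" using lt by simp_all
  moreover have "\<sigma> 0 \<noteq> \<sigma> 1" "\<sigma> 0 \<noteq> \<sigma> 2" "\<sigma> 1 \<noteq> \<sigma> 2"
    using permutes_inj[OF assms(2)] by (simp_all add: inj_eq)
  ultimately have "\<sigma> 0 = 0 \<and> \<sigma> 1 = 1 \<and> \<sigma> 2 = 2 \<or> \<sigma> 0 = 0 \<and> \<sigma> 1 = 2 \<and> \<sigma> 2 = 1 \<or>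
    \<sigma> 0 = 1 \<and> \<sigma> 1 = 0 \<and> \<sigma> 2 = 2 \<or> \<sigma> 0 = 1 \<and> \<sigma> 1 = 2 \<and> \<sigma> 2 = 0 \<or>
    \<sigma> 0 = 2 \<and> \<sigma> 1 = 0 \<and> \<sigma> 2 = 1 \<or> \<sigma> 0 = 2 \<and> \<sigma> 1 = 1 \<and> \<sigma> 2 = 0"
    by presburger
  moreover have p: "permute_list \<sigma> xs = [xs ! \<sigma> 0, xs ! \<sigma> 1, xs ! \<sigma> 2]"
    by (simp add: permute_list_def xs numeral_2_eq_2)
  ultimately show ?thesis
    by (elim disjE conjE) (simp_all only: p koszul_sign_3, simp_all add: xs bac acb bca cab cba scale_neg_one_powi
        neg_pow_add[symmetric] add_ac mult_ac flip: scale_scale)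
qed

lemma l_multilinear:
  assumes "set xs \<subseteq> F.total" "i < length xs" "a \<in> F.total" "b \<in> F.total"
  shows "l (xs[i := a + b]) = l (xs[i := a]) + l (xs[i := b])"
    "l (xs[i := scale t a]) = scale t (l (xs[i := a]))"
proof -
  have ab: "a \<in> total" "b \<in> total" using assms F_total by auto
  note pm = grade_total[OF grade_\<pi>] grade_total[OF grade_\<mu>]
  have s: "scale t a \<in> total" "a + b \<in> total"
    using ab subspace_scale[OF subspace_total] subspace_add[OF subspace_total] by blast+
  consider "length xs = 1" | "length xs = 3" | "length xs \<noteq> 1" "length xs \<noteq> 3" by blast
  then have "l (xs[i := a + b]) = l (xs[i := a]) + l (xs[i := b]) \<and>
    l (xs[i := scale t a]) = scale t (l (xs[i := a]))"
  proof cases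
    case 1
    then show ?thesis using ab pm assms(2) by (elim length_1E) (simp add: br_add_right br_scale_right)
  next
    case 2
    then obtain x y z where xs: "xs = [x, y, z]" by (elim length_3E)
    then have xyz: "x \<in> total" "y \<in> total" "z \<in> total" using assms(1) F_total by auto
    have "i = 0 \<or> i = 1 \<or> i = 2" using assms(2) xs by auto
    then show ?thesis
      using ab pm xyz s
      by (elim disjE) (simp_all add: xs br_add_right br_scale_right br_add_left br_scale_left br_total)
  next
    case 3 then show ?thesis by (simp add: l_zero)
  qed
  then show "l (xs[i := a + b]) = l (xs[i := a]) + l (xs[i := b])"
    "l (xs[i := scale t a]) = scale t (l (xs[i := a]))" by simp_all
qed

theorem L_infinity: "L_infinity_algebra scale F l"
proof
  show "l (xs[i := a + b]) = l (xs[i := a]) + l (xs[i := b])"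
    if "set xs \<subseteq> F.total" "i < length xs" "a \<in> F.total" "b \<in> F.total" for xs i a b
    using l_multilinear(1) that by blast
  show "l (xs[i := scale t a]) = scale t (l (xs[i := a]))"
    if "set xs \<subseteq> F.total" "i < length xs" "a \<in> F.total" for xs i a t
    using l_multilinear(2) that by blast
next
  fix xs :: "'v list" and d :: "nat \<Rightarrow> int"
  \<comment> \<open>\<open>koszul_sum\<close> and \<open>homogeneous\<close> take the degrees from
    the list itself, so each vector is paired with its given degree.\<close>
  let ?ps = "map (\<lambda>i. (d i, xs ! i)) [0..<length xs]"
  assume "xs \<noteq> []" and xs: "\<And>i. i < length xs \<Longrightarrow> xs ! i \<in> F (d i)"
  have hom: "homogeneous F ?ps" using xs by (auto simp: homogeneous_def)
  have snd: "map snd ?ps = xs" by (simp add: o_def map_nth)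
  have "deg ?ps = (\<Sum>i<length xs. d i)"
    by (simp add: o_def sum_list_sum_nth[of "map _ _"] sum_set_upt_conv_sum_list_nat lessThan_atLeast0 flip: sum_list_upt)
  then show "l xs \<in> F ((\<Sum>i<length xs. d i) + 1)"
    using l_grade[OF hom] unfolding snd by simp
next
  fix xs :: "'v list" and d :: "nat \<Rightarrow> int" and \<sigma>
  assume xs: "\<And>i. i < length xs \<Longrightarrow> xs ! i \<in> F (d i)" and \<sigma>: "\<sigma> permutes {..<length xs}"
  consider "length xs = 1" | "length xs = 3" | "length xs \<noteq> 1" "length xs \<noteq> 3" by blast
  then show "l (permute_list \<sigma> xs) = scale (koszul_sign (length xs) d \<sigma>) (l xs)"
  proof cases
    case 1
    then have "\<sigma> = id" using \<sigma> by (simp add: lessThan_Suc)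
    then show ?thesis by (simp only: koszul_sign_id permute_list_id scale_one)
  next
    case 2 then show ?thesis using l3_symmetric[OF _ _ 2, of d \<sigma>] xs \<sigma> by simp
  next
    case 3 then show ?thesis by (simp add: l_zero)
  qed
next
  fix xs :: "'v list" and n and d :: "nat \<Rightarrow> int"
  let ?ps = "map (\<lambda>i. (d i, xs ! i)) [0..<length xs]"
  assume ne: "xs \<noteq> []" and n: "n = length xs" and xs: "\<And>i. i < n \<Longrightarrow> xs ! i \<in> F (d i)"
  have hom: "homogeneous F ?ps" using xs n by (auto simp: homogeneous_def)
  have snd: "map snd ?ps = xs" by (simp add: o_def map_nth)
  have "(\<Sum>\<sigma>\<in>shuffle_perms i (n - i). scale (koszul_sign n d \<sigma>)
      (l (l (take i (permute_list \<sigma> xs)) # drop i (permute_list \<sigma> xs)))) = jacobiator i ?ps"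
    if i: "i \<in> {1..n}" for i
  proof -
    have in': "i + (n - i) = length ?ps" using i n by simp
    then have in'': "i + (n - i) = n" using n by simp
    show ?thesis
      unfolding koszul_sum_eq_shuffle_sum[OF vector_space_axioms in', of fst ll, symmetric]
    proof (intro sum.cong refl)
      fix \<sigma> assume "\<sigma> \<in> shuffle_perms i (n - i)"
      then have \<sigma>: "\<sigma> permutes {..<n}" using shuffle_perms_permutes in'' by metis
      have ks: "koszul_sign (i + (n - i)) (\<lambda>i. fst (?ps ! i)) \<sigma> = koszul_sign n d \<sigma>"
        unfolding in'' by (rule koszul_sign_cong[OF \<sigma>]) (simp add: n)
      have "map snd (permute_list \<sigma> ?ps) = permute_list \<sigma> xs"
        using permute_list_map[of \<sigma> ?ps snd] \<sigma> n unfolding snd by simp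
      then have "map snd (take i (permute_list \<sigma> ?ps)) = take i (permute_list \<sigma> xs)"
        "map snd (drop i (permute_list \<sigma> ?ps)) = drop i (permute_list \<sigma> xs)"
        by (metis take_map, metis drop_map)
      then show "scale (koszul_sign n d \<sigma>) (l (l (take i (permute_list \<sigma> xs)) # drop i (permute_list \<sigma> xs))) =
        scale (koszul_sign (i + (n - i)) (\<lambda>i. fst (?ps ! i)) \<sigma>)
          (ll (take i (permute_list \<sigma> ?ps)) (drop i (permute_list \<sigma> ?ps)))"
        unfolding ks by simp
    qed
  qed
  then show "(\<Sum>i=1..n. \<Sum>\<sigma>\<in>shuffle_perms i (n - i). scale (koszul_sign n d \<sigma>)
      (l (l (take i (permute_list \<sigma> xs)) # drop i (permute_list \<sigma> xs)))) = 0"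
    using sum_jacobiator[OF hom] ne n by simp
qed

end

section \<open>The graded Lie algebra of cochains\<close>

lemma linear_iff_add_scale:
  assumes "vector_space s1" "vector_space s2"
  shows "Vector_Spaces.linear s1 s2 f \<longleftrightarrow>
    (\<forall>u v. f (u + v) = f u + f v) \<and> (\<forall>c u. f (s1 c u) = s2 c (f u))"
  using assms by (auto simp: Vector_Spaces.linear_iff_module_hom module_hom_iff module_iff_vector_space)

context char_0_vector_space
begin

lemma vector_space_cscale: "vector_space cscale"
  by unfold_locales
    (auto simp: cochain_scale_def scale_right_distrib scale_left_distrib fun_eq_iff)

lemma L_gradeE:
  assumes "A \<in> L_grade scale i"
  obtains (neg) "i < 0" "A = 0" | (nonneg) n where "i = int n" "A \<in> C n"
  using assms by (cases "i < 0") (auto simp: L_grade_def intro: that(2)[of "nat i"])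

lemma L_grade_int [simp]: "L_grade scale (int n) = C n"
  by (simp add: L_grade_def)

lemma zero_L_grade: "0 \<in> L_grade scale i"
  by (simp add: L_grade_def zero_cochain)

lemma L_grade_apply:
  "A \<in> L_grade scale i \<Longrightarrow> int (length Xs) \<noteq> i \<Longrightarrow> A Xs x = 0"
  by (erule L_gradeE) (auto simp: cochain_length(1))

lemma graded_cochains: "graded_vector_space cscale (L_grade scale)"
proof -
  interpret cs: vector_space cscale by (rule vector_space_cscale)
  show ?thesis
  proof
    show "cs.subspace (L_grade scale i)" for i
      by (auto simp: cs.subspace_def L_grade_def zero_cochain add_cochain cscale_cochain
          cs.scale_zero_right simp del: cs.scale_zero_right)
  next
    fix I and v :: "int \<Rightarrow> ('v, 'v) cochain" and i
    assume *: "finite I" "\<And>i. i \<in> I \<Longrightarrow> v i \<in> L_grade scale i" "(\<Sum>i\<in>I. v i) = 0" "i \<in> I"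
    show "v i = 0"
    proof (intro ext)
      fix Xs x
      have "sum v I Xs x = (\<Sum>j\<in>I. v j Xs x)" using *(1) by (induction I) auto
      then have "(\<Sum>j\<in>I. v j Xs x) = 0" by (simp add: *(3))
      \<comment> \<open>Evaluation on lists of length \<open>i\<close> isolates the component of
        degree \<open>i\<close>.\<close>
      moreover have "(\<Sum>j\<in>I - {i}. v j Xs x) = 0" if "int (length Xs) = i"
        using that L_grade_apply[OF *(2)] by (intro sum.neutral) auto
      ultimately have "v i Xs x = 0" if "int (length Xs) = i"
        using that *(1,4) by (simp add: sum.remove)
      then show "v i Xs x = 0 Xs x" using L_grade_apply[OF *(2)[OF *(4)], of Xs x] by auto
    qed
  qed
qed

lemma graded_lie_algebra_cochains: "graded_lie_algebra cscale (L_grade scale) br"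
proof -
  interpret g: graded_vector_space cscale "L_grade scale" by (rule graded_cochains)
  \<comment> \<open>Multilinear functions form a subspace containing every homogeneous part, hence
    the total space; bilinearity of the bracket there follows.\<close>
  have "g.subspace {A. multilinear A}"
    by (auto simp: g.subspace_def multilinear_0 multilinear_add multilinear_cscale)
  then have "g.total \<subseteq> {A. multilinear A}"
    unfolding g.total_def
    by (rule g.span_minimal[rotated]) (auto elim!: L_gradeE simp: multilinear_0 multilinear_cochain)
  then have m: "multilinear A" if "A \<in> g.total" for A using that by blast
  have mL: "multilinear A" if "A \<in> L_grade scale i" for A i
    using that by (auto elim!: L_gradeE simp: multilinear_0 multilinear_cochain)
  show ?thesis
  proof
    fix A B D assume "A \<in> g.total" "B \<in> g.total" "D \<in> g.total"
    then show "br (A + B) D = br A D + br B D" "br A (B + D) = br A B + br A D"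
      using m by (simp_all add: br_add_left br_add_right)
  next
    fix A B t assume "A \<in> g.total" "B \<in> g.total"
    then show "br (cscale t A) B = cscale t (br A B)" "br A (cscale t B) = cscale t (br A B)"
      using m by (simp_all add: br_scale_left br_scale_right)
  next
    fix A B p q assume AB: "A \<in> L_grade scale p" "B \<in> L_grade scale q"
    note mm = mL[OF AB(1)] mL[OF AB(2)]
    have "br A B \<in> L_grade scale (p + q) \<and> br A B = - neg_pow (p * q) (br B A)"
    \<comment> \<open>Negative degrees contain only 0, so the degrees of nonzero arguments are
      natural numbers.\<close>
    proof (cases "A = 0 \<or> B = 0")
      case True
      then show ?thesis by (elim disjE) (simp_all add: br_zero mm zero_L_grade)
    next
      case False
      obtain a b where "p = int a" "q = int b" "A \<in> C a" "B \<in> C b"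
        using AB False by (elim L_gradeE) blast+
      then show ?thesis using br_antisym[of A a B b] br_cochain[of A a B b] L_grade_int[of "a + b"] by simp
    qed
    then show "br A B \<in> L_grade scale (p + q)" "br A B = - cscale ((-1) powi (p * q)) (br B A)"
      unfolding g.scale_neg_one_powi by blast+
  next
    fix A B D p q r
    assume ABD: "A \<in> L_grade scale p" "B \<in> L_grade scale q" "D \<in> L_grade scale r"
    note mm = mL[OF ABD(1)] mL[OF ABD(2)] mL[OF ABD(3)]
    have mb: "multilinear (br A' B')" if "A' \<in> L_grade scale i" "B' \<in> L_grade scale j" for A' B' i j
      using that mL by (elim L_gradeE) (auto simp: br_zero[OF multilinear_cochain] br_zero[OF multilinear_0] multilinear_0 intro: multilinear_cochain br_cochain)
    note mb' = mb[OF ABD(1,2)] mb[OF ABD(1,3)] mb[OF ABD(2,3)]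
    have "br A (br B D) = br (br A B) D + neg_pow (p * q) (br B (br A D))"
    proof (cases "A = 0 \<or> B = 0 \<or> D = 0")
      case True
      then show ?thesis by (elim disjE) (simp_all add: br_zero mm mb')
    next
      case False
      obtain a b d where "p = int a" "q = int b" "r = int d" "A \<in> C a" "B \<in> C b" "D \<in> C d"
        using ABD False by (elim L_gradeE) blast+
      then show ?thesis using br_jacobi[of A a B b D d] by simp
    qed
    then show "br A (br B D) = br (br A B) D + cscale ((-1) powi (p * q)) (br B (br A D))"
      unfolding g.scale_neg_one_powi .
  qed
qed

section \<open>3-Lie products as elements of square zero\<close>

text \<open>The common shape of \<open>\<pi>\<close>, \<open>\<mu>\<close> and
  \<open>\<pi> + \<mu>\<close> on the direct sum, so that one computation of the square serves all
  three.\<close>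

definition ternary_cochain :: "('v \<Rightarrow> 'v \<Rightarrow> 'v \<Rightarrow> 'v) \<Rightarrow> ('v, 'v) cochain" where
  "ternary_cochain T = (\<lambda>Xs z. case Xs of [(x, y)] \<Rightarrow> T x y z | _ \<Rightarrow> 0)"

lemma ternary_cochain_simps [simp]:
  "ternary_cochain T [] z = 0" "ternary_cochain T [X] z = T (fst X) (snd X) z"
  "ternary_cochain T (X # Y # Xs) z = 0"
  by (auto simp: ternary_cochain_def case_prod_unfold)

lemma ternary_cochain_cochain:
  assumes "three_lie_algebra scale T" shows "ternary_cochain T \<in> C 1"
proof -
  interpret T: three_lie_algebra scale T by fact
  note lin = T.linear1[unfolded lin_iff] T.linear2[unfolded lin_iff] T.linear3[unfolded lin_iff]
  have "ternary_cochain T \<in> C (Suc 0)"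
    unfolding cochain_Suc_iff
  proof (intro conjI allI impI)
    show "contract X (ternary_cochain T) \<in> C 0" for X
      by (rule cochain_0I) (use lin in \<open>auto simp: fun_eq_iff lin_iff\<close>)
    show "lin (\<lambda>u. ternary_cochain T ((u, v) # Xs) x)" "lin (\<lambda>u. ternary_cochain T ((v, u) # Xs) x)" for v Xs x
      using lin by (cases Xs; simp add: lin_iff)+
    show "contract (u, u) (ternary_cochain T) = 0" for u
    proof (intro ext)
      fix Xs z show "contract (u, u) (ternary_cochain T) Xs z = 0 Xs z"
        by (cases Xs) (simp_all add: T.alternating)
    qed
  qed (simp_all add: T.alternating)
  then show ?thesis by simp
qed

text \<open>\<open>contract X A\<close> is the inner map ad_X. By the fundamental identity it is a
  derivation of the product, that is \<open>br A (contract X A) = 0\<close>, and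
  \<open>contract_br\<close> reduces \<open>br A A\<close> to this bracket and its mirror
  image.\<close>

lemma br_ternary_cochain:
  assumes "three_lie_algebra scale T"
  shows "br (ternary_cochain T) (ternary_cochain T) = 0"
proof -
  interpret T: three_lie_algebra scale T by fact
  define A where "A = ternary_cochain T"
  have A: "A \<in> C 1" unfolding A_def by (rule ternary_cochain_cochain[OF assms])
  note mA = multilinear_cochain[OF A]
  have cA: "contract X A \<in> C 0" for X using cochain_contract[OF A, of X] by simp
  have A0: "A [] = (\<lambda>_. 0)" using cochain_length(2)[OF A, of "[]"] by simp
  have br: "br A (contract X A) = 0" for X
  proof (rule cochain_eqI)
    show "br A (contract X A) [] x = 0 [] x" for x
      using multilinear_zero_slot(1)[OF mA, of "[X]"] by (simp add: br_Nil A0)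
  next
    fix Y
    have c: "contract Y (br A (contract X A)) = br (contract Y A) (contract X A) + act (contract X A) Y A"
      using contract_br[OF A cA, of Y X] cochain_contract_0[OF cA, of Y X] br_zero(1)[OF mA]
        act_zero[OF multilinear_cochain[OF cA], of A Y X] A0 by simp
    show "contract Y (br A (contract X A)) = contract Y 0"
      unfolding c
    proof (rule cochain_eqI)
      \<comment> \<open>The commutator of ad_Y and ad_X plus the action of ad_X on the pair
        \<open>Y\<close>, evaluated at \<open>z\<close>: this is the fundamental identity with all
        terms on one side.\<close>
      show "(br (contract Y A) (contract X A) + act (contract X A) Y A) [] z = contract Y 0 [] z" for z
        using T.fundamental_identity[of "fst X" "snd X" "fst Y" "snd Y" z]
        by (simp add: br_Nil act_def A_def algebra_simps)
    next
      fix Z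
      have "contract Z (br (contract Y A) (contract X A)) = 0"
        using cochain_contract_0[OF br_cochain[OF cA cA, simplified]] .
      moreover have "contract Z (act (contract X A) Y A) = 0"
        using act_cochain[OF A, of "contract X A" Y] cochain_contract_0 by simp
      ultimately show "contract Z (br (contract Y A) (contract X A) + act (contract X A) Y A) =
        contract Z (contract Y 0)" by simp
    qed
  qed
  have "br A A = 0"
  proof (rule cochain_eqI)
    show "br A A [] x = 0 [] x" for x by (simp add: br_Nil A0)
  next
    fix X
    have "br (contract X A) A = 0" using br_antisym[OF cA A, of X] br[of X] by simp
    then show "contract X (br A A) = contract X 0"
      using contract_br[OF A A, of X] br[of X] by simp
  qed
  then show ?thesis by (simp add: A_def)
qed

end

text \<open>
  \<open>summand 0\<close> and \<open>summand 1\<close> are the two summands of the direct sum, all other \<open>summand m\<close> are zero.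
  A cochain has weight \<open>w\<close> if it takes inputs from summands with indices of sum \<open>m\<close> to
  \<open>summand (m - w)\<close>; thus \<open>\<pi>\<close> has weight 0, \<open>\<mu>\<close> has weight 2, and the elements of \<open>F\<close> are
  those of weight \<open>- 1\<close>.
\<close>

definition summand :: "int \<Rightarrow> ('g::ab_group_add \<times> 'h::ab_group_add) set" where
  "summand m = {z. (m \<noteq> 0 \<longrightarrow> fst z = 0) \<and> (m \<noteq> 1 \<longrightarrow> snd z = 0)}"

text \<open>The total index \<open>k\<close> need not be unique, since 0 lies in every
  \<open>summand\<close>; \<open>has_weight\<close> therefore quantifies over all admissible
  \<open>k\<close>.\<close>

primrec pure_inputs :: "int \<Rightarrow> (('g::ab_group_add \<times> 'h::ab_group_add) \<times> ('g \<times> 'h)) list \<Rightarrow> bool" where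
  "pure_inputs k [] \<longleftrightarrow> k = 0"
| "pure_inputs k (X # Xs) \<longleftrightarrow>
    (\<exists>i j. fst X \<in> summand i \<and> snd X \<in> summand j \<and> pure_inputs (k - i - j) Xs)"

definition has_weight ::
  "int \<Rightarrow> ('g::ab_group_add \<times> 'h::ab_group_add, 'g \<times> 'h) cochain \<Rightarrow> bool" where
  "has_weight w A \<longleftrightarrow>
    (\<forall>k Xs m x. pure_inputs k Xs \<longrightarrow> x \<in> summand m \<longrightarrow> A Xs x \<in> summand (k + m - w))"

lemma summand_ops:
  "0 \<in> summand m" "u \<in> summand m \<Longrightarrow> v \<in> summand m \<Longrightarrow> u + v \<in> summand m"
  "u \<in> summand m \<Longrightarrow> v \<in> summand m \<Longrightarrow> u - v \<in> summand m"
  "u \<in> summand m \<Longrightarrow> neg_pow n u \<in> summand m"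
  by (auto simp: summand_def neg_pow_def)

lemma summand_zero: "u \<in> summand m \<Longrightarrow> m \<noteq> 0 \<Longrightarrow> m \<noteq> 1 \<Longrightarrow> u = 0"
  by (auto simp: summand_def prod_eq_iff)

lemma summand_split:
  fixes z :: "'g::ab_group_add \<times> 'h::ab_group_add"
  shows "z = (fst z, 0) + (0, snd z)" "(x, 0) \<in> summand 0" "(0, a) \<in> summand 1"
  by (auto simp: summand_def prod_eq_iff)

lemma has_weightD:
  "has_weight w A \<Longrightarrow> pure_inputs k Xs \<Longrightarrow> x \<in> summand m \<Longrightarrow> A Xs x \<in> summand (k + m - w)"
  unfolding has_weight_def by blast

lemma has_weight_contract:
  assumes "has_weight w A" "u \<in> summand i" "v \<in> summand j"
  shows "has_weight (w - i - j) (contract (u, v) A)"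
  unfolding has_weight_def
proof (intro allI impI)
  fix k and Xs :: "(('a \<times> 'b) \<times> ('a \<times> 'b)) list" and m and x :: "'a \<times> 'b"
  assume k: "pure_inputs k Xs" and x: "x \<in> summand m"
  have "pure_inputs (k + i + j) ((u, v) # Xs)"
    unfolding pure_inputs.simps
    by (intro exI[of _ i] exI[of _ j]) (use assms(2,3) k in \<open>simp add: algebra_simps\<close>)
  from has_weightD[OF assms(1) this x]
  show "contract (u, v) A Xs x \<in> summand (k + m - (w - i - j))"
    by (simp add: algebra_simps)
qed

lemma has_weight_ops:
  "has_weight w 0" "has_weight w A \<Longrightarrow> has_weight w B \<Longrightarrow> has_weight w (A + B)"
  "has_weight w A \<Longrightarrow> has_weight w B \<Longrightarrow> has_weight w (A - B)"
  "has_weight w A \<Longrightarrow> has_weight w (neg_pow n A)"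
  by (auto simp: has_weight_def summand_ops neg_pow_apply)

lemma has_weightI:
  assumes "\<And>m x. x \<in> summand m \<Longrightarrow> A [] x \<in> summand (m - w)"
    and "\<And>u v i j. u \<in> summand i \<Longrightarrow> v \<in> summand j \<Longrightarrow> has_weight (w - i - j) (contract (u, v) A)"
  shows "has_weight w A"
  unfolding has_weight_def
proof (intro allI impI)
  fix k and Xs :: "(('a \<times> 'b) \<times> ('a \<times> 'b)) list" and m and x :: "'a \<times> 'b"
  assume k: "pure_inputs k Xs" and x: "x \<in> summand m"
  show "A Xs x \<in> summand (k + m - w)"
  proof (cases Xs)
    case Nil then show ?thesis using k assms(1)[OF x] by simp
  next
    case (Cons X Ys)
    then obtain i j where ij: "fst X \<in> summand i" "snd X \<in> summand j" "pure_inputs (k - i - j) Ys"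
      using k by auto
    show ?thesis
      using has_weightD[OF assms(2)[OF ij(1,2)] ij(3) x] by (simp add: Cons algebra_simps)
  qed
qed

locale direct_sum =
  fixes sg :: "'k::field_char_0 \<Rightarrow> 'g::ab_group_add \<Rightarrow> 'g"
    and sh :: "'k \<Rightarrow> 'h::ab_group_add \<Rightarrow> 'h"
  assumes vs_g: "vector_space sg" and vs_h: "vector_space sh"
begin

abbreviation "s \<equiv> module_prod.scale sg sh"

lemma s_eq: "s c z = (sg c (fst z), sh c (snd z))"
proof -
  interpret vector_space_prod sg sh
    using vs_g vs_h by (simp add: vector_space_prod_def vector_space_pair_def)
  show ?thesis by (rule scale_def)
qed

sublocale g: vector_space sg by (rule vs_g)
sublocale h: vector_space sh by (rule vs_h)

sublocale char_0_vector_space s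
  by unfold_locales
    (auto simp: s_eq g.scale_right_distrib h.scale_right_distrib g.scale_left_distrib h.scale_left_distrib)

text \<open>Induction along \<open>contract_br\<close>: contraction with a pair of indices
  \<open>i\<close> and \<open>j\<close> lowers the weight by \<open>i + j\<close>. In the actions
  \<open>B\<close> first moves an entry from index \<open>i\<close> to \<open>i - w'\<close>, so the
  contraction of \<open>A\<close> has weight \<open>w + w' - i - j\<close> as well.\<close>

lemma br_has_weight:
  assumes "A \<in> C p" "B \<in> C q" "has_weight w A" "has_weight w' B"
  shows "has_weight (w + w') (br A B)"
  using assms
proof (induction "p + q" arbitrary: p q A B w w' rule: less_induct)
  case less
  note A = less.prems(1) and B = less.prems(2) and wA = less.prems(3) and wB = less.prems(4)
  have A0: "A [] x \<in> summand (m - w)" and B0: "B [] x \<in> summand (m - w')" if "x \<in> summand m" for x m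
    using has_weightD[OF wA, of 0 "[]"] has_weightD[OF wB, of 0 "[]"] that by simp_all
  show ?case
  proof (rule has_weightI)
    fix m and x :: "'g \<times> 'h" assume x: "x \<in> summand m"
    show "br A B [] x \<in> summand (m - (w + w'))"
      using A0[OF B0[OF x]] B0[OF A0[OF x]] by (simp add: br_Nil summand_ops algebra_simps)
  next
    fix u v :: "'g \<times> 'h" and i j assume uv: "u \<in> summand i" "v \<in> summand j"
    have 1: "has_weight (w + w' - i - j) (br A (contract (u, v) B))"
    proof (cases "q = 0")
      case True
      then show ?thesis
        using cochain_contract_0 B br_zero(1)[OF multilinear_cochain[OF A]] has_weight_ops(1) by metis
    next
      case False
      then show ?thesis
        using less.hyps[OF _ A cochain_contract[OF B] wA has_weight_contract[OF wB uv]]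
        by (simp add: algebra_simps)
    qed
    have 2: "has_weight (w + w' - i - j) (br (contract (u, v) A) B)"
    proof (cases "p = 0")
      case True
      then show ?thesis
        using cochain_contract_0 A br_zero(2)[OF multilinear_cochain[OF B]] has_weight_ops(1) by metis
    next
      case False
      then show ?thesis
        using less.hyps[OF _ cochain_contract[OF A] B has_weight_contract[OF wA uv] wB]
        by (simp add: algebra_simps)
    qed
    have 3: "has_weight (w + w' - i - j) (act B (u, v) A)"
      using has_weight_contract[OF wA B0[OF uv(1)] uv(2)] has_weight_contract[OF wA uv(1) B0[OF uv(2)]]
      by (simp add: act_def has_weight_ops algebra_simps)
    have 4: "has_weight (w + w' - i - j) (act A (u, v) B)"
      using has_weight_contract[OF wB A0[OF uv(1)] uv(2)] has_weight_contract[OF wB uv(1) A0[OF uv(2)]]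
      by (simp add: act_def has_weight_ops algebra_simps)
    show "has_weight (w + w' - i - j) (contract (u, v) (br A B))"
      unfolding contract_br[OF A B] by (intro has_weight_ops 1 2 3 4)
  qed
qed

lemma multilinear_split:
  assumes "multilinear A"
  shows "A [] x = A [] (fst x, 0) + A [] (0, snd x)"
    "contract (u, v) A = contract ((fst u, 0), (fst v, 0)) A + contract ((fst u, 0), (0, snd v)) A +
      contract ((0, snd u), (fst v, 0)) A + contract ((0, snd u), (0, snd v)) A"
proof -
  show "A [] x = A [] (fst x, 0) + A [] (0, snd x)"
    using multilinear_add_slot(1)[OF assms, of "[]" "(fst x, 0)" "(0, snd x)"] by simp
  have "contract (u, v) A = contract ((fst u, 0) + (0, snd u), (fst v, 0) + (0, snd v)) A" by simp
  then show "contract (u, v) A = contract ((fst u, 0), (fst v, 0)) A + contract ((fst u, 0), (0, snd v)) A +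
      contract ((0, snd u), (fst v, 0)) A + contract ((0, snd u), (0, snd v)) A"
    by (simp only: contract_slot_add[OF assms] add_ac)
qed

text \<open>Inputs have index at least 0, so the output has index at least 2, where
  \<open>summand\<close> is zero. Contraction never raises the weight, which keeps the bound in the
  induction.\<close>

lemma has_weight_le_minus_2:
  assumes "multilinear A" "has_weight w A" "w \<le> - 2"
  shows "A Xs x = 0"
  using assms
proof (induction Xs arbitrary: A w)
  case Nil
  have "A [] z \<in> summand (m - w)" if "z \<in> summand m" for z m
    using has_weightD[OF Nil(2), of 0 "[]"] that by simp
  then have z: "A [] z = 0" if "z \<in> summand m" "0 \<le> m" for z m
    using that Nil(3) summand_zero[of "A [] z" "m - w"] by simp
  have "A [] (fst x, 0) = 0" "A [] (0, snd x) = 0"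
    using z[OF summand_split(2)] z[OF summand_split(3)] by simp_all
  then show ?case using multilinear_split(1)[OF Nil(1), of x] by simp
next
  case (Cons X Xs)
  have z: "contract (u, v) A Xs x = 0" if "u \<in> summand i" "v \<in> summand j" "i \<ge> 0" "j \<ge> 0" for u v i j
    using Cons.IH[OF multilinear_contract[OF Cons.prems(1)] has_weight_contract[OF Cons.prems(2) that(1,2)]]
      that Cons.prems(3) by simp
  have "contract (fst X, snd X) A Xs x = 0"
    using fun_cong[OF fun_cong[OF multilinear_split(2)[OF Cons.prems(1), of "fst X" "snd X"], of Xs], of x]
      z[OF summand_split(2,2)] z[OF summand_split(2,3)] z[OF summand_split(3,2)] z[OF summand_split(3,3)]
    by simp
  then show ?case by simp
qed

text \<open>Contraction with a pair that has an entry in the second summand has weight at most -2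
  and vanishes, so only the components in the first summand count, which is what
  \<open>F_proj\<close> records.\<close>

lemma has_weight_minus_1:
  assumes "multilinear A" "has_weight (- 1) A"
  shows "F_proj A = A"
proof (intro ext)
  fix Xs x
  show "F_proj A Xs x = A Xs x"
    using assms
  proof (induction Xs arbitrary: A)
    case Nil
    have "A [] (fst x, 0) \<in> summand 1" "A [] (0, snd x) \<in> summand 2"
      using has_weightD[OF Nil(2), of 0 "[]" "(fst x, 0)" 0] has_weightD[OF Nil(2), of 0 "[]" "(0, snd x)" 1]
        summand_split(2,3) by auto
    then show ?case
      using multilinear_split(1)[OF Nil(1), of x] by (auto simp: F_proj_def summand_def prod_eq_iff)
  next
    case (Cons X Xs)
    let ?u = "(fst (fst X), 0)" and ?v = "(fst (snd X), 0)"
    have z: "contract (u, v) A Xs x = 0" if "u \<in> summand i" "v \<in> summand j" "i + j \<ge> 1" for u v i j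
      using has_weight_le_minus_2[OF multilinear_contract[OF Cons.prems(1)] has_weight_contract[OF Cons.prems(2) that(1,2)]]
        that by simp
    have "contract (fst X, snd X) A Xs x = contract (?u, ?v) A Xs x"
      using fun_cong[OF fun_cong[OF multilinear_split(2)[OF Cons.prems(1), of "fst X" "snd X"], of Xs], of x]
        z[OF summand_split(2,3)] z[OF summand_split(3,2)] z[OF summand_split(3,3)] by simp
    also have "\<dots> = F_proj (contract (?u, ?v) A) Xs x"
    proof (rule Cons.IH[symmetric, OF multilinear_contract[OF Cons.prems(1)]])
      show "has_weight (- 1) (contract (?u, ?v) A)"
        using has_weight_contract[OF Cons.prems(2) summand_split(2,2)] by simp
    qed
    also have "\<dots> = F_proj A (X # Xs) x" by (simp add: F_proj_def case_prod_unfold)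
    finally show ?case by simp
  qed
qed

section \<open>The subspace F, its projection and the kernel\<close>

abbreviation "F \<equiv> F_grade sg sh"

lemma linear_g_h_iff: "Vector_Spaces.linear sg sh f \<longleftrightarrow>
    (\<forall>u v. f (u + v) = f u + f v) \<and> (\<forall>c u. f (sg c u) = sh c (f u))"
  by (rule linear_iff_add_scale[OF vs_g vs_h])

lemma embed_hom_cochain:
  assumes "Q \<in> cochains sg sh n" shows "embed_hom Q \<in> C n"
  using assms unfolding cochains_def linear_g_h_iff lin_iff
  by (auto simp: embed_hom_def map_update s_eq zero_prod_def)

lemma F_proj_embed_hom: "F_proj (embed_hom Q) = embed_hom Q"
  by (intro ext) (simp add: F_proj_def embed_hom_def o_def case_prod_unfold map_prod_def)

lemma F_proj_eq_embed_hom: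
  "F_proj A = embed_hom (\<lambda>Ys y. snd (A (map (map_prod (\<lambda>u. (u, 0)) (\<lambda>u. (u, 0))) Ys) (y, 0)))"
  by (intro ext) (simp add: F_proj_def embed_hom_def o_def case_prod_unfold map_prod_def)

lemma F_proj_cochain:
  assumes "A \<in> C n"
  shows "F_proj A \<in> F (int n)"
proof -
  let ?Q = "\<lambda>Ys y. snd (A (map (map_prod (\<lambda>u. (u, 0)) (\<lambda>u. (u, 0))) Ys) (y, 0))"
  have lin: "Vector_Spaces.linear sg sh (\<lambda>u. snd (f (u, 0)))" if "lin f" for f :: "'g \<times> 'h \<Rightarrow> 'g \<times> 'h"
  proof -
    have "f ((u, 0) + (v, 0)) = f (u, 0) + f (v, 0)" "f (s c (u, 0)) = s c (f (u, 0))" for u v c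
      using that unfolding lin_iff by blast+
    then show ?thesis unfolding linear_g_h_iff by (simp add: s_eq)
  qed
  have "?Q \<in> cochains sg sh n"
    unfolding cochains_def mem_Collect_eq
  proof (intro conjI allI impI; (elim conjE)?)
    fix Ys :: "('g \<times> 'g) list" and y assume "length Ys \<noteq> n"
    then show "?Q Ys y = 0" using cochain_length(1)[OF assms] by simp
  next
    fix Ys :: "('g \<times> 'g) list" assume "length Ys = n"
    show "Vector_Spaces.linear sg sh (?Q Ys)" by (rule lin[OF cochain_linear[OF assms]])
  next
    fix Ys :: "('g \<times> 'g) list" and x y i assume "length Ys = n" "i < n"
    then show "Vector_Spaces.linear sg sh (\<lambda>u. ?Q (Ys[i := (u, y)]) x)"
      "Vector_Spaces.linear sg sh (\<lambda>u. ?Q (Ys[i := (y, u)]) x)" "?Q (Ys[i := (y, y)]) x = 0"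
      using cochain_update[OF assms, of "map (map_prod (\<lambda>u. (u, 0)) (\<lambda>u. (u, 0))) Ys" i "(y, 0)" "(x, 0)"]
      by (auto simp: map_update dest: lin)
  next
    fix Ys :: "('g \<times> 'g) list" and x y assume "length Ys + 1 = n"
    then show "?Q (Ys @ [(x, y)]) x = 0" "?Q (Ys @ [(y, x)]) x = 0"
      using cochain_last[OF assms, of "map (map_prod (\<lambda>u. (u, 0)) (\<lambda>u. (u, 0))) Ys" "(x, 0)" "(y, 0)"]
      by simp_all
  qed
  then show ?thesis unfolding F_grade_def F_proj_eq_embed_hom by auto
qed

lemma FE:
  assumes "A \<in> F i"
  obtains (neg) "i < 0" "A = 0" | (nonneg) n where "i = int n" "A \<in> C n" "F_proj A = A"
proof (cases "i < 0")
  case True then show ?thesis using assms neg by (simp add: F_grade_def)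
next
  case False
  then obtain Q where "A = embed_hom Q" "Q \<in> cochains sg sh (nat i)"
    using assms by (auto simp: F_grade_def)
  then show ?thesis
    using False by (intro nonneg[of "nat i"]) (auto simp: embed_hom_cochain F_proj_embed_hom)
qed

lemma F_int_iff: "A \<in> F (int n) \<longleftrightarrow> A \<in> C n \<and> F_proj A = A"
  using F_proj_cochain[of A n] by (auto elim: FE)

lemma pure_inputs_fst:
  "pure_inputs k Xs \<Longrightarrow> k = 0 \<or> (\<exists>Ys u v Zs. Xs = Ys @ (u, v) # Zs \<and> (fst u = 0 \<or> fst v = 0))"
proof (induction Xs arbitrary: k)
  case (Cons X Xs)
  then obtain i j where ij: "fst X \<in> summand i" "snd X \<in> summand j" "pure_inputs (k - i - j) Xs" by auto
  show ?case
  proof (cases "i = 0 \<and> j = 0")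
    case True
    then consider "k = 0" | Ys u v Zs where "Xs = Ys @ (u, v) # Zs" "fst u = 0 \<or> fst v = 0"
      using Cons.IH[of k] ij(3) by auto
    then show ?thesis
    proof cases
      case 2
      then have "X # Xs = (X # Ys) @ (u, v) # Zs" by simp
      then show ?thesis using 2(2) by blast
    qed simp
  next
    case False
    then have "fst (fst X) = 0 \<or> fst (snd X) = 0" using ij by (auto simp: summand_def)
    moreover have "X # Xs = [] @ (fst X, snd X) # Xs" by simp
    ultimately show ?thesis by blast
  qed
qed simp

text \<open>If \<open>k\<close> or \<open>m\<close> is nonzero, some input has zero component in the
  first summand, and \<open>A\<close>, being unchanged by \<open>F_proj\<close>, vanishes there. If
  both are 0, the value lies in \<open>summand 1\<close> by the form of
  \<open>F_proj\<close>.\<close>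

lemma F_proj_has_weight:
  assumes "multilinear A" "F_proj A = A"
  shows "has_weight (- 1) A"
  unfolding has_weight_def
proof (intro allI impI)
  fix k and Xs :: "(('g \<times> 'h) \<times> ('g \<times> 'h)) list" and m and x :: "'g \<times> 'h"
  assume k: "pure_inputs k Xs" and x: "x \<in> summand m"
  have A: "A Xs x = (0, snd (A (map (\<lambda>(u, v). ((fst u, 0), (fst v, 0))) Xs) (fst x, 0)))" for Xs x
    using fun_cong[OF fun_cong[OF assms(2)], of Xs x] by (simp add: F_proj_def)
  have slot: "A (Ys @ (u, v) # Zs) x = 0" if "fst u = 0 \<or> fst v = 0" for Ys u v Zs
    using that multilinear_zero_slot(2,3)[OF assms(1)]
    by (subst A) (auto simp: case_prod_unfold zero_prod_def[symmetric])
  show "A Xs x \<in> summand (k + m - - 1)"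
  proof (cases "k = 0 \<and> m = 0")
    case True then show ?thesis by (subst A) (simp add: summand_def)
  next
    case False
    have "A Xs x = 0"
    proof (cases "k = 0")
      case True
      then have "fst x = 0" using False x by (auto simp: summand_def)
      then show ?thesis
        using multilinear_zero_slot(1)[OF assms(1)] by (subst A) (simp add: zero_prod_def[symmetric])
    next
      case False then show ?thesis using pure_inputs_fst[OF k] slot by blast
    qed
    then show ?thesis by (simp add: summand_ops)
  qed
qed

lemma F_iff_weight: "A \<in> F (int n) \<longleftrightarrow> A \<in> C n \<and> has_weight (- 1) A"
  using F_int_iff F_proj_has_weight has_weight_minus_1 multilinear_cochain by blast

text \<open>\<open>F_proj A = 0\<close> means that inputs from the first summand give values in the
  first summand, a condition stable under insertion. Elements of the kernel may mix several weights,
  so the induction along \<open>contract_br\<close> is run on this condition, called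
  \<open>K\<close>, instead of on weights.\<close>

lemma kernel_br:
  assumes "A \<in> C p" "B \<in> C q" "F_proj A = 0" "F_proj B = 0"
  shows "F_proj (br A B) = 0"
proof -
  define \<iota> :: "('g \<times> 'h) \<times> ('g \<times> 'h) \<Rightarrow> ('g \<times> 'h) \<times> ('g \<times> 'h)"
    where "\<iota> = (\<lambda>(u, v). ((fst u, 0), (fst v, 0)))"
  define K where "K A \<longleftrightarrow> (\<forall>Xs x. snd (A (map \<iota> Xs) (fst (x :: 'g \<times> 'h), 0)) = 0)" for A :: "('g \<times> 'h, 'g \<times> 'h) cochain"
  have K_iff: "F_proj A = 0 \<longleftrightarrow> K A" for A
    by (simp add: F_proj_def K_def fun_eq_iff prod_eq_iff \<iota>_def)
  have K_add: "K (A + B)" "K (A - B)" "K (neg_pow n A)" if "K A" "K B" for A B n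
    using that by (auto simp: K_def neg_pow_def)
  have K0: "K 0" by (simp add: K_def)
  have K_contract: "K (contract ((x, 0), (y, 0)) A)" if "K A" for A x y
    unfolding K_def
  proof (intro allI)
    fix Xs and z :: "'g \<times> 'h"
    show "snd (contract ((x, 0), (y, 0)) A (map \<iota> Xs) (fst z, 0)) = 0"
      using that[unfolded K_def, rule_format, of "((x, 0), (y, 0)) # Xs" z] by (simp add: \<iota>_def)
  qed
  have KNil: "\<exists>y. A [] (x, 0) = (y, 0)" if "K A" for A x
  proof -
    have "snd (A [] (x, 0)) = 0"
      using that[unfolded K_def, rule_format, of "[]" "(x, 0)"] by simp
    then show ?thesis by (metis prod.collapse)
  qed
  have K_act: "K (act B ((x, 0), (y, 0)) A)" if "K A" "K B" for A B x y
    using KNil[OF that(2), of x] KNil[OF that(2), of y] K_contract[OF that(1)] K_add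
    by (auto simp: act_def)
  have "K (br A B)" if "A \<in> C p" "B \<in> C q" "K A" "K B" for A B
    using that
  proof (induction "p + q" arbitrary: p q A B rule: less_induct)
    case less
    note A = less.prems(1) and B = less.prems(2) and KA = less.prems(3) and KB = less.prems(4)
    show ?case unfolding K_def
    proof (intro allI)
      fix Xs and z :: "'g \<times> 'h"
      show "snd (br A B (map \<iota> Xs) (fst z, 0)) = 0"
      proof (cases Xs)
        case Nil
        obtain a b where ab: "A [] (fst z, 0) = (a, 0)" "B [] (fst z, 0) = (b, 0)"
          using KNil KA KB by blast
        obtain c d where "A [] (b, 0) = (c, 0)" "B [] (a, 0) = (d, 0)" using KNil KA KB by blast
        then show ?thesis using ab Nil by (simp add: br_Nil)
      next
        case (Cons X Ys)
        obtain x y where X: "\<iota> X = ((x, 0), (y, 0))" by (auto simp: \<iota>_def case_prod_unfold)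
        have 1: "K (br A (contract (\<iota> X) B))"
        proof (cases "q = 0")
          case True
          then show ?thesis using cochain_contract_0 B br_zero(1)[OF multilinear_cochain[OF A]] K0 by metis
        next
          case False
          then show ?thesis
            using less.hyps[OF _ A cochain_contract[OF B] KA K_contract[OF KB]] X by simp
        qed
        have 2: "K (br (contract (\<iota> X) A) B)"
        proof (cases "p = 0")
          case True
          then show ?thesis using cochain_contract_0 A br_zero(2)[OF multilinear_cochain[OF B]] K0 by metis
        next
          case False
          then show ?thesis
            using less.hyps[OF _ cochain_contract[OF A] B K_contract[OF KA] KB] X by simp
        qed
        have "K (contract (\<iota> X) (br A B))"
          unfolding contract_br[OF A B]
          using K_act[OF KA KB] K_act[OF KB KA] 1 2 X by (auto intro!: K_add)
        from this[unfolded K_def, rule_format, of Ys z] show ?thesis by (simp add: Cons)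
      qed
    qed
  qed
  then show ?thesis using assms by (simp add: K_iff)
qed

end

section \<open>The V-data of two 3-Lie algebras\<close>

context direct_sum
begin

text \<open>Pairing \<open>\<pi>\<close> or \<open>\<mu>\<close> with the zero product on the other
  summand makes each embedding an instance of \<open>three_lie_algebra_sum\<close>.\<close>

lemma three_lie_algebra_zero:
  assumes "vector_space r" shows "three_lie_algebra r (\<lambda>_ _ _. 0)"
proof -
  interpret r: vector_space r by fact
  have "Vector_Spaces.linear r r (\<lambda>_. 0)"
    by (simp add: linear_iff_add_scale[OF assms assms])
  then show ?thesis by unfold_locales auto
qed

lemma three_lie_algebra_sum:
  assumes "three_lie_algebra sg \<pi>" "three_lie_algebra sh \<mu>"
  shows "three_lie_algebra s (\<lambda>x y z. (\<pi> (fst x) (fst y) (fst z), \<mu> (snd x) (snd y) (snd z)))"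
proof -
  interpret p: three_lie_algebra sg \<pi> by fact
  interpret m: three_lie_algebra sh \<mu> by fact
  note lin_p = p.linear1[unfolded linear_iff_add_scale[OF vs_g vs_g]]
    p.linear2[unfolded linear_iff_add_scale[OF vs_g vs_g]] p.linear3[unfolded linear_iff_add_scale[OF vs_g vs_g]]
  note lin_m = m.linear1[unfolded linear_iff_add_scale[OF vs_h vs_h]]
    m.linear2[unfolded linear_iff_add_scale[OF vs_h vs_h]] m.linear3[unfolded linear_iff_add_scale[OF vs_h vs_h]]
  let ?T = "\<lambda>x y z. (\<pi> (fst x) (fst y) (fst z), \<mu> (snd x) (snd y) (snd z))"
  show ?thesis
  proof (intro three_lie_algebra.intro three_lie_algebra_axioms.intro vector_space_axioms)
    show "lin (\<lambda>x. ?T x y z)" "lin (\<lambda>y. ?T x y z)" "lin (\<lambda>z. ?T x y z)" for x y z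
      unfolding lin_iff by (simp_all add: lin_p lin_m s_eq)
    show "?T x x z = 0" "?T x y y = 0" "?T x y x = 0" for x y z
      by (simp_all add: p.alternating m.alternating zero_prod_def)
    show "?T x1 x2 (?T x3 x4 x5) =
        ?T (?T x1 x2 x3) x4 x5 + ?T x3 (?T x1 x2 x4) x5 + ?T x3 x4 (?T x1 x2 x5)" for x1 x2 x3 x4 x5
      by (simp add: p.fundamental_identity[of "fst x1" "fst x2" "fst x3"]
          m.fundamental_identity[of "snd x1" "snd x2" "snd x3"])
  qed
qed

lemma embed_left_eq: "embed_left \<pi> = ternary_cochain (\<lambda>x y z. (\<pi> (fst x) (fst y) (fst z), 0))"
  by (intro ext) (auto simp: embed_left_def ternary_cochain_def zero_prod_def split: list.splits)

lemma embed_right_eq: "embed_right \<mu> = ternary_cochain (\<lambda>x y z. (0, \<mu> (snd x) (snd y) (snd z)))"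
  by (intro ext) (auto simp: embed_right_def ternary_cochain_def zero_prod_def split: list.splits)

lemma embed_sum_eq: "embed_left \<pi> + embed_right \<mu> =
    ternary_cochain (\<lambda>x y z. (\<pi> (fst x) (fst y) (fst z), \<mu> (snd x) (snd y) (snd z)))"
  by (intro ext) (auto simp: embed_left_def embed_right_def ternary_cochain_def split: list.splits)

end

locale two_three_lie_algebras =
  pi: three_lie_algebra sg \<pi> + mu: three_lie_algebra sh \<mu>
  for sg :: "'k::field_char_0 \<Rightarrow> 'g::ab_group_add \<Rightarrow> 'g"
    and sh :: "'k \<Rightarrow> 'h::ab_group_add \<Rightarrow> 'h" and \<pi> \<mu>
begin

sublocale direct_sum sg sh
  by unfold_locales

abbreviation \<pi>' :: "('g \<times> 'h, 'g \<times> 'h) cochain" where "\<pi>' \<equiv> embed_left \<pi>"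
abbreviation \<mu>' :: "('g \<times> 'h, 'g \<times> 'h) cochain" where "\<mu>' \<equiv> embed_right \<mu>"

lemma algebras:
  "three_lie_algebra s (\<lambda>x y z. (\<pi> (fst x) (fst y) (fst z), 0))"
  "three_lie_algebra s (\<lambda>x y z. (0, \<mu> (snd x) (snd y) (snd z)))"
  "three_lie_algebra s (\<lambda>x y z. (\<pi> (fst x) (fst y) (fst z), \<mu> (snd x) (snd y) (snd z)))"
  using three_lie_algebra_sum[OF pi.three_lie_algebra_axioms three_lie_algebra_zero[OF vs_h]]
    three_lie_algebra_sum[OF three_lie_algebra_zero[OF vs_g] mu.three_lie_algebra_axioms]
    three_lie_algebra_sum[OF pi.three_lie_algebra_axioms mu.three_lie_algebra_axioms] .

lemma cochains_1: "\<pi>' \<in> C 1" "\<mu>' \<in> C 1" "\<pi>' + \<mu>' \<in> C 1"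
  unfolding embed_sum_eq unfolding embed_left_eq embed_right_eq
  by (intro ternary_cochain_cochain algebras)+

lemma squares: "br \<pi>' \<pi>' = 0" "br \<mu>' \<mu>' = 0" "br (\<pi>' + \<mu>') (\<pi>' + \<mu>') = 0"
  unfolding embed_sum_eq unfolding embed_left_eq embed_right_eq
  by (intro br_ternary_cochain algebras)+

text \<open>Polarisation: the squares of \<open>\<pi>'\<close>, \<open>\<mu>'\<close> and
  \<open>\<pi>' + \<mu>'\<close> vanish, and the bracket is symmetric in degree 1, so twice the
  mixed bracket is 0.\<close>

lemma br_\<pi>'_\<mu>': "br \<pi>' \<mu>' = 0"
proof -
  note m = multilinear_cochain[OF cochains_1(1)] multilinear_cochain[OF cochains_1(2)]
    multilinear_cochain[OF cochains_1(3)]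
  have "br \<mu>' \<pi>' = br \<pi>' \<mu>'"
    using br_antisym[OF cochains_1(2,1)] by (simp add: neg_pow_def)
  then have "br \<pi>' \<mu>' + br \<pi>' \<mu>' = 0"
    using squares br_add_left[OF m(3), of \<pi>' \<mu>'] br_add_right[OF m(1), of \<pi>' \<mu>']
      br_add_right[OF m(2), of \<pi>' \<mu>'] by simp
  then show ?thesis by (rule double_eq_0[OF vector_space_cscale])
qed

lemma pure_inputs_singleton:
  "pure_inputs k [X] \<longleftrightarrow> (\<exists>i. fst X \<in> summand i \<and> snd X \<in> summand (k - i))"
  by auto

lemma weight_\<pi>': "has_weight 0 \<pi>'"
  unfolding has_weight_def
proof (intro allI impI)
  fix k and Xs :: "(('g \<times> 'h) \<times> ('g \<times> 'h)) list" and m and z :: "'g \<times> 'h"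
  assume k: "pure_inputs k Xs" and z: "z \<in> summand m"
  have 0: "\<pi> 0 y w = 0" "\<pi> x 0 w = 0" "\<pi> x y 0 = 0" for x y w
    by (rule pi.linear1[unfolded Vector_Spaces.linear_iff_module_hom, THEN module_hom.zero]
        pi.linear2[unfolded Vector_Spaces.linear_iff_module_hom, THEN module_hom.zero]
        pi.linear3[unfolded Vector_Spaces.linear_iff_module_hom, THEN module_hom.zero])+
  show "\<pi>' Xs z \<in> summand (k + m - 0)"
  proof (cases "\<exists>X. Xs = [X]")
    case True
    then obtain x y where Xs: "Xs = [(x, y)]" by auto
    then obtain i where i: "x \<in> summand i" "y \<in> summand (k - i)" using k pure_inputs_singleton by auto
    \<comment> \<open>Unless all three indices are 0, some argument of \<open>\<pi>\<close> is 0,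
      and the value 0 lies in every \<open>summand\<close>.\<close>
    show ?thesis
      using i z by (cases "i = 0 \<and> k - i = 0 \<and> m = 0") (auto simp: Xs embed_left_def summand_def 0)
  next
    case False
    then have "\<pi>' Xs z = 0" by (auto simp: embed_left_def split: list.splits)
    then show ?thesis by (simp add: summand_ops)
  qed
qed

lemma weight_\<mu>': "has_weight 2 \<mu>'"
  unfolding has_weight_def
proof (intro allI impI)
  fix k and Xs :: "(('g \<times> 'h) \<times> ('g \<times> 'h)) list" and m and z :: "'g \<times> 'h"
  assume k: "pure_inputs k Xs" and z: "z \<in> summand m"
  have 0: "\<mu> 0 y w = 0" "\<mu> x 0 w = 0" "\<mu> x y 0 = 0" for x y w
    by (rule mu.linear1[unfolded Vector_Spaces.linear_iff_module_hom, THEN module_hom.zero]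
        mu.linear2[unfolded Vector_Spaces.linear_iff_module_hom, THEN module_hom.zero]
        mu.linear3[unfolded Vector_Spaces.linear_iff_module_hom, THEN module_hom.zero])+
  show "\<mu>' Xs z \<in> summand (k + m - 2)"
  proof (cases "\<exists>X. Xs = [X]")
    case True
    then obtain x y where Xs: "Xs = [(x, y)]" by auto
    then obtain i where i: "x \<in> summand i" "y \<in> summand (k - i)" using k pure_inputs_singleton by auto
    show ?thesis
      using i z by (cases "i = 1 \<and> k - i = 1 \<and> m = 1") (auto simp: Xs embed_right_def summand_def 0)
  next
    case False
    then have "\<mu>' Xs z = 0" by (auto simp: embed_right_def split: list.splits)
    then show ?thesis by (simp add: summand_ops)
  qed
qed

sublocale gla: graded_lie_algebra cscale "L_grade s" br
  by (rule graded_lie_algebra_cochains)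

lemma F_subset_L: "A \<in> F i \<Longrightarrow> A \<in> L_grade s i"
  by (elim FE) (auto simp: zero_L_grade)

lemma multilinear_L: "A \<in> L_grade s i \<Longrightarrow> multilinear A"
  by (elim L_gradeE) (auto simp: multilinear_0 multilinear_cochain)

lemma F_proj_add: "F_proj (A + B) = F_proj A + F_proj B"
  by (intro ext) (simp add: F_proj_def)

lemma F_proj_cscale: "F_proj (cscale t A) = cscale t (F_proj A)"
  by (intro ext) (simp add: F_proj_def cochain_scale_def s_eq)

lemma F_proj_0: "F_proj 0 = 0"
  by (intro ext) (simp add: F_proj_def zero_prod_def)

lemma F_proj_F: "A \<in> F i \<Longrightarrow> F_proj A = A"
  by (elim FE) (simp_all add: F_proj_0)

lemma F_proj_L: "A \<in> L_grade s i \<Longrightarrow> F_proj A \<in> F i"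
  by (elim L_gradeE) (auto simp: F_proj_0 F_grade_def[of _ _ i] F_proj_cochain)

lemma zero_F: "0 \<in> F i"
  using F_proj_L[OF zero_L_grade, of i] by (simp add: F_proj_0)

lemma subspace_F: "gla.subspace (F i)"
proof (rule gla.subspaceI)
  fix A B c assume AB: "A \<in> F i" "B \<in> F i"
  have "A + B \<in> L_grade s i" "cscale c A \<in> L_grade s i"
    using gla.subspace_add[OF gla.subspace_grade] gla.subspace_scale[OF gla.subspace_grade]
      F_subset_L[OF AB(1)] F_subset_L[OF AB(2)] by blast+
  then show "A + B \<in> F i" "cscale c A \<in> F i"
    using F_proj_L[of "A + B" i] F_proj_L[of "cscale c A" i] F_proj_F[OF AB(1)] F_proj_F[OF AB(2)]
    by (simp_all add: F_proj_add F_proj_cscale)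
qed (rule zero_F)

lemma F_abelian:
  assumes "A \<in> F i" "B \<in> F j" shows "br A B = 0"
proof (cases "A = 0 \<or> B = 0")
  case True
  then show ?thesis
    using multilinear_L[OF F_subset_L[OF assms(1)]] multilinear_L[OF F_subset_L[OF assms(2)]]
    by (auto simp: br_zero)
next
  case False
  obtain p q where pq: "i = int p" "j = int q" using assms False by (elim FE) auto
  then have A: "A \<in> C p" "has_weight (- 1) A" and B: "B \<in> C q" "has_weight (- 1) B"
    using assms F_iff_weight by auto
  have "multilinear (br A B)" by (rule multilinear_cochain[OF br_cochain[OF A(1) B(1)]])
  from has_weight_le_minus_2[OF this br_has_weight[OF A(1) B(1) A(2) B(2)]]
  show ?thesis by (simp add: fun_eq_iff)
qed

lemma F_subalgebra: "gla.graded_lie_subalgebra F"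
  unfolding gla.graded_lie_subalgebra_def
  using subspace_F F_subset_L F_abelian zero_F by auto

lemma l1_F:
  assumes "A \<in> F i" shows "br \<pi>' A \<in> F (i + 1)"
  using assms
proof (cases rule: FE)
  case neg
  then show ?thesis using br_zero(1)[OF multilinear_cochain[OF cochains_1(1)]] zero_F by simp
next
  case (nonneg n)
  then have "has_weight (- 1) A" using F_iff_weight[of A n] assms by simp
  then have "br \<pi>' A \<in> F (int (1 + n))"
    unfolding F_iff_weight
    using br_cochain[OF cochains_1(1) nonneg(2)] br_has_weight[OF cochains_1(1) nonneg(2) weight_\<pi>']
    by simp
  then show ?thesis by (simp add: nonneg(1) add.commute)
qed

lemma l3_F:
  assumes "A \<in> F i" "B \<in> F j" "D \<in> F k"
  shows "br (br (br \<mu>' A) B) D \<in> F (i + j + k + 1)"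
proof (cases "A = 0 \<or> B = 0 \<or> D = 0")
  case True
  note t = gla.grade_total[OF F_subset_L] 
  have "\<mu>' \<in> gla.total" using gla.grade_total[of \<mu>' 1] cochains_1(2) L_grade_int[of 1] by simp
  then show ?thesis
    using True t[OF assms(1)] t[OF assms(2)] t[OF assms(3)] zero_F by (auto simp: gla.br_total)
next
  case False
  obtain p q r where pqr: "i = int p" "j = int q" "k = int r"
    using assms False by (elim FE) auto
  then have A: "A \<in> C p" "has_weight (- 1) A" and B: "B \<in> C q" "has_weight (- 1) B"
    and D: "D \<in> C r" "has_weight (- 1) D"
    using assms F_iff_weight by auto
  note c1 = br_cochain[OF cochains_1(2) A(1)]
  note c2 = br_cochain[OF c1 B(1)]
  note w1 = br_has_weight[OF cochains_1(2) A(1) weight_\<mu>' A(2)]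
  note w2 = br_has_weight[OF c1 B(1) w1 B(2)]
  have "br (br (br \<mu>' A) B) D \<in> F (int (1 + p + q + r))"
    unfolding F_iff_weight
    using br_cochain[OF c2 D(1)] br_has_weight[OF c2 D(1) w2 D(2)] by simp
  then show ?thesis by (simp add: pqr add_ac)
qed

sublocale l3_data cscale "L_grade s" br F \<pi>' \<mu>'
  using F_subalgebra F_abelian cochains_1 squares br_\<pi>'_\<mu>' l1_F l3_F L_grade_int[of 1]
  by unfold_locales auto

theorem V_data: "V_data cscale (L_grade s) br F F_proj (\<pi>' + \<mu>')"
proof
  show "gla.graded_lie_subalgebra F" by (rule F_subalgebra)
  show "br A B = 0" if "A \<in> F i" "B \<in> F j" for A B i j using that by (rule F_abelian)
  show "F_proj (A + B) = F_proj A + F_proj B" for A B by (rule F_proj_add)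
  show "F_proj (cscale t A) = cscale t (F_proj A)" for t A by (rule F_proj_cscale)
  show "F_proj (F_proj A) = F_proj A" for A by (simp add: F_proj_eq_embed_hom[of A] F_proj_embed_hom)
next
  interpret P: Vector_Spaces.linear cscale cscale F_proj
    by (simp add: linear_iff_add_scale[OF vector_space_cscale vector_space_cscale] F_proj_add F_proj_cscale)
  \<comment> \<open>A linear map commutes with spans, so comparing the homogeneous parts is
    enough.\<close>
  have "F_proj ` (\<Union>i. L_grade s i) = (\<Union>i. F i)"
  proof
    show "F_proj ` (\<Union>i. L_grade s i) \<subseteq> (\<Union>i. F i)" using F_proj_L by blast
    show "(\<Union>i. F i) \<subseteq> F_proj ` (\<Union>i. L_grade s i)"
    proof safe
      fix A i assume "A \<in> F i"
      then have "A = F_proj A" "A \<in> L_grade s i" using F_proj_F F_subset_L by auto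
      then show "A \<in> F_proj ` (\<Union>i. L_grade s i)" by blast
    qed
  qed
  then show "F_proj ` gla.total = gla.span (\<Union>i. F i)"
    unfolding gla.total_def by (simp flip: P.span_image)
next
  \<comment> \<open>The complementary projection: it sends each graded part into the kernel within
    the same degree and fixes the kernel. Hence an element of the kernel is spanned by homogeneous
    elements of the kernel.\<close>
  define Q where "Q A = A - F_proj A" for A :: "('g \<times> 'h, 'g \<times> 'h) cochain"
  interpret Q: Vector_Spaces.linear cscale cscale Q
    by (simp add: linear_iff_add_scale[OF vector_space_cscale vector_space_cscale] F_proj_add F_proj_cscale
        Q_def cscale_diff)
  have Q: "Q ` (\<Union>i. L_grade s i) \<subseteq> (\<Union>i. {A \<in> L_grade s i. F_proj A = 0})"
  proof safe
    fix A i assume A: "A \<in> L_grade s i"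
    have "Q A \<in> L_grade s i"
      unfolding Q_def using A F_subset_L[OF F_proj_L[OF A]] gla.subspace_diff[OF gla.subspace_grade] by blast
    moreover have "F_proj (Q A) = 0"
      using F_proj_add[of "Q A" "F_proj A"] F_proj_F[OF F_proj_L[OF A]] by (simp add: Q_def)
    ultimately show "Q A \<in> (\<Union>i. {A \<in> L_grade s i. F_proj A = 0})" by blast
  qed
  show "{A \<in> gla.total. F_proj A = 0} = gla.span (\<Union>i. {A \<in> L_grade s i. F_proj A = 0})"
  proof
    show "{A \<in> gla.total. F_proj A = 0} \<subseteq> gla.span (\<Union>i. {A \<in> L_grade s i. F_proj A = 0})"
    proof safe
      fix A assume A: "A \<in> gla.total" "F_proj A = 0"
      have "Q A \<in> gla.span (Q ` (\<Union>i. L_grade s i))"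
        using A(1) unfolding gla.total_def by (simp add: Q.span_image)
      then have "Q A \<in> gla.span (\<Union>i. {A \<in> L_grade s i. F_proj A = 0})"
        using gla.span_mono[OF Q] by blast
      then show "A \<in> gla.span (\<Union>i. {A \<in> L_grade s i. F_proj A = 0})" using A(2) by (simp add: Q_def)
    qed
    have "gla.subspace {A \<in> gla.total. F_proj A = 0}"
      using gla.subspace_total
      by (auto simp: gla.subspace_def F_proj_add F_proj_cscale F_proj_0)
    then show "gla.span (\<Union>i. {A \<in> L_grade s i. F_proj A = 0}) \<subseteq> {A \<in> gla.total. F_proj A = 0}"
      by (rule gla.span_minimal[rotated]) (auto intro: gla.grade_total)
  qed
next
  have "gla.subspace {A \<in> L_grade s i. F_proj A = 0}" for i
    using gla.subspace_grade[of i] by (auto simp: gla.subspace_def F_proj_add F_proj_cscale F_proj_0)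
  moreover have "F_proj (br A B) = 0"
    if "A \<in> L_grade s i" "B \<in> L_grade s j" "F_proj A = 0" "F_proj B = 0" for A B i j
    using that multilinear_L[OF that(1)] multilinear_L[OF that(2)] kernel_br
    by (elim L_gradeE) (auto simp: br_zero F_proj_0)
  ultimately show "gla.graded_lie_subalgebra (\<lambda>i. {A \<in> L_grade s i. F_proj A = 0})"
    unfolding gla.graded_lie_subalgebra_def using gla.br_grade by auto
next
  show "\<pi>' + \<mu>' \<in> L_grade s 1" using cochains_1(3) L_grade_int[of 1] by simp
  show "br (\<pi>' + \<mu>') (\<pi>' + \<mu>') = 0" by (rule squares(3))
  \<comment> \<open>On inputs from the first summand \<open>\<pi>\<close> has values in that
    summand, and \<open>\<mu>\<close> is evaluated at zeros only.\<close>
  have 0: "\<mu> 0 0 0 = 0" using mu.alternating(1)[of 0 0] .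
  show "F_proj (\<pi>' + \<mu>') = 0"
    by (intro ext) (auto simp: F_proj_def embed_left_def embed_right_def 0 zero_prod_def split: list.splits)
qed

end

theorem proposition2p11:
  fixes sg :: "'k::field_char_0 \<Rightarrow> 'g::ab_group_add \<Rightarrow> 'g"
    and sh :: "'k \<Rightarrow> 'h::ab_group_add \<Rightarrow> 'h"
    and \<pi> :: "'g \<Rightarrow> 'g \<Rightarrow> 'g \<Rightarrow> 'g"
    and \<mu> :: "'h \<Rightarrow> 'h \<Rightarrow> 'h \<Rightarrow> 'h"
  defines "s \<equiv> module_prod.scale sg sh"
    and "\<pi>' \<equiv> (embed_left \<pi> :: ('g \<times> 'h, 'g \<times> 'h) cochain)"
    and "\<mu>' \<equiv> (embed_right \<mu> :: ('g \<times> 'h, 'g \<times> 'h) cochain)"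
  assumes "three_lie_algebra sg \<pi>"
    and "three_lie_algebra sh \<mu>"
  shows "V_data (cochain_scale s) (L_grade s) (rbracket s) (F_grade sg sh) F_proj (\<pi>' + \<mu>') \<and>
    L_infinity_algebra (cochain_scale s) (F_grade sg sh)
      (\<lambda>as. case as of
          [a\<^sub>1] \<Rightarrow> rbracket s \<pi>' a\<^sub>1
        | [a\<^sub>1, a\<^sub>2] \<Rightarrow> 0
        | [a\<^sub>1, a\<^sub>2, a\<^sub>3] \<Rightarrow> rbracket s (rbracket s (rbracket s \<mu>' a\<^sub>1) a\<^sub>2) a\<^sub>3
        | _ \<Rightarrow> 0)"
proof -
  interpret two_three_lie_algebras sg sh \<pi> \<mu>
    using assms(4,5) by (simp add: two_three_lie_algebras_def)
  show ?thesis
    using V_data L_infinity unfolding l_def[abs_def] s_def \<pi>'_def \<mu>'_def by blast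
qed

end
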